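(* Let $n$ be a positive integer, let $p>0$ be a constant, and let $W<n^p$ be the window size. Let $\mathbf{r}_1,\ldots,\mathbf{r}_t\in\mathbb{R}^{1\times n}$ be a stream of rows and let $\mathbf{A}=\mathbf{r}_{t-W+1}\circ\cdots\circ\mathbf{r}_t$ be the matrix consisting of the $W$ most recent rows, and suppose $\frac{1}{\mathrm{poly}(W)}\le\sigma_{\min}(\mathbf{A})\le\sigma_{\max}(\mathbf{A})\le\mathrm{poly}(W)$. Then, given a parameter $\varepsilon>0$, there exists a deterministic algorithm in the sliding window model that outputs a matrix $\mathbf{M}^\top\mathbf{M}$ such that \[(1-\varepsilon)\mathbf{M}^\top\mathbf{M}\preceq\mathbf{A}^\top\mathbf{A}\preceq(1+\varepsilon)\mathbf{M}^\top\mathbf{M}.\] The algorithm uses $O\!\left(\frac{n^3}{\varepsilon}\log n\right)$ space and has $O(n^3)$ amortized update time.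
   Context: Sliding window model: rows $\mathbf{r}_1,\mathbf{r}_2,\ldots\in\mathbb{R}^{1\times n}$ arrive one at a time in a single pass; at the current time $t$ the relevant (active) data is the matrix of the $W$ most recent rows, and the algorithm must be able to produce its output for that matrix. For row vectors/matrices, $\mathbf{X}\circ\mathbf{Y}$ denotes vertical stacking (the matrix with the rows of $\mathbf{X}$ followed by the rows of $\mathbf{Y}$). $\sigma_{\min}$ and $\sigma_{\max}$ denote the smallest nonzero and the largest singular value. $\mathbf{X}\preceq\mathbf{Y}$ means $\mathbf{Y}-\mathbf{X}$ is positive semidefinite. $\mathrm{poly}(W)$ denotes a fixed polynomial in $W$. *)

theory Defs
  imports "Jordan_Normal_Form.Char_Poly"
begin

section \<open>Linear algebra\<close>

definition singular_values :: "real mat \<Rightarrow> real set" where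
  "singular_values A = {\<sigma>. 0 \<le> \<sigma> \<and> eigenvalue (transpose_mat A * A) (\<sigma>\<^sup>2)}"

text \<open>A matrix without nonzero singular values is zero, so its largest singular value is \<open>0\<close>.
  A chain \<open>a \<le> sigma_min A \<le> sigma_max A\<close> with \<open>a > 0\<close> thus excludes the case in which the
  minimum below is taken over the empty set.\<close>

definition sigma_min :: "real mat \<Rightarrow> real" where
  "sigma_min A = Min {\<sigma> \<in> singular_values A. \<sigma> \<noteq> 0}"

definition sigma_max :: "real mat \<Rightarrow> real" where
  "sigma_max A = Max (singular_values A)"

definition psd :: "real mat \<Rightarrow> bool" where
  "psd X \<longleftrightarrow> X \<in> carrier_mat (dim_row X) (dim_row X) \<and> transpose_mat X = X \<and>
     (\<forall>v \<in> carrier_vec (dim_row X). 0 \<le> v \<bullet> (X *\<^sub>v v))"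

definition loewner_le :: "real mat \<Rightarrow> real mat \<Rightarrow> bool" (infix \<open>\<preceq>\<^sub>L\<close> 50) where
  "X \<preceq>\<^sub>L Y \<longleftrightarrow> dim_row X = dim_row Y \<and> dim_col X = dim_col Y \<and> psd (Y - X)"


section \<open>The machine model: a deterministic real RAM\<close>

text \<open>
  A program is a finite text over finitely many registers: natural-number registers, which hold
  indices and counters, and real registers. Besides these there is an array of real words, the
  memory, reached by (indirectly addressed) loads and stores. An access outside of the allocated
  array has no transition, so the length of the array is the space that a computation needs.
  The registers named in a program are part of the finite control and are not counted; their
  number is fixed together with the program text. The current stream row is read-only and the
  output tape is write-only, and neither counts as space.

  There is no rounding of reals to integers and no integer division, which are the operations
  that would allow many words to be packed into one at unit cost. The only constants are
  integers, so a program text is a finite object.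
\<close>

datatype nexp =
    NConst nat
  | NReg nat
  | NAdd nexp nexp
  | NSub nexp nexp
  | NMul nexp nexp

datatype rexp =
    RConst int
  | RReg nat
  | ROfNat nexp
  | RAdd rexp rexp
  | RSub rexp rexp
  | RMul rexp rexp
  | RDiv rexp rexp

datatype bexp =
    NLess nexp nexp
  | RLess rexp rexp
  | BNot bexp
  | BAnd bexp bexp

datatype cmd =
    Skip
  | NSet nat nexp
  | RSet nat rexp
  | Load nat nexp
  | Store nexp rexp
  | ReadRow nat nexp
  | Emit rexp
  | Seq cmd cmd
  | Cond bexp cmd cmd
  | While bexp cmd

record state =
  nreg :: "nat \<Rightarrow> nat"
  rreg :: "nat \<Rightarrow> real"
  memory :: "real list"
  input_row :: "real vec"
  out_tape :: "real list"

primrec nval :: "nexp \<Rightarrow> state \<Rightarrow> nat" where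
  "nval (NConst c) st = c"
| "nval (NReg x) st = nreg st x"
| "nval (NAdd a b) st = nval a st + nval b st"
| "nval (NSub a b) st = nval a st - nval b st"
| "nval (NMul a b) st = nval a st * nval b st"

primrec rval :: "rexp \<Rightarrow> state \<Rightarrow> real" where
  "rval (RConst c) st = of_int c"
| "rval (RReg x) st = rreg st x"
| "rval (ROfNat e) st = real (nval e st)"
| "rval (RAdd a b) st = rval a st + rval b st"
| "rval (RSub a b) st = rval a st - rval b st"
| "rval (RMul a b) st = rval a st * rval b st"
| "rval (RDiv a b) st = rval a st / rval b st"

primrec bval :: "bexp \<Rightarrow> state \<Rightarrow> bool" where
  "bval (NLess a b) st \<longleftrightarrow> nval a st < nval b st"
| "bval (RLess a b) st \<longleftrightarrow> rval a st < rval b st"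
| "bval (BNot b) st \<longleftrightarrow> \<not> bval b st"
| "bval (BAnd a b) st \<longleftrightarrow> bval a st \<and> bval b st"

text \<open>
  \<open>exec c st k st'\<close>: started in \<open>st\<close>, the command \<open>c\<close> terminates in \<open>st'\<close> after \<open>k\<close> steps.
  Assignments, memory accesses and tests take one step each. Their expressions have a size bounded
  by the program text, so this agrees with counting single operations up to a factor that depends
  on the program only.
\<close>

inductive exec :: "cmd \<Rightarrow> state \<Rightarrow> nat \<Rightarrow> state \<Rightarrow> bool" where
  exec_Skip: "exec Skip st 1 st"
| exec_NSet: "exec (NSet x e) st 1 (st\<lparr>nreg := (nreg st)(x := nval e st)\<rparr>)"
| exec_RSet: "exec (RSet x e) st 1 (st\<lparr>rreg := (rreg st)(x := rval e st)\<rparr>)"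
| exec_Load: "nval a st < length (memory st) \<Longrightarrow>
    exec (Load x a) st 1 (st\<lparr>rreg := (rreg st)(x := memory st ! nval a st)\<rparr>)"
| exec_Store: "nval a st < length (memory st) \<Longrightarrow>
    exec (Store a e) st 1 (st\<lparr>memory := (memory st)[nval a st := rval e st]\<rparr>)"
| exec_ReadRow: "nval a st < dim_vec (input_row st) \<Longrightarrow>
    exec (ReadRow x a) st 1 (st\<lparr>rreg := (rreg st)(x := input_row st $ nval a st)\<rparr>)"
| exec_Emit: "exec (Emit e) st 1 (st\<lparr>out_tape := out_tape st @ [rval e st]\<rparr>)"
| exec_Seq: "exec c1 st k1 st1 \<Longrightarrow> exec c2 st1 k2 st2 \<Longrightarrow> exec (Seq c1 c2) st (k1 + k2) st2"
| exec_CondTrue: "bval b st \<Longrightarrow> exec c1 st k st1 \<Longrightarrow> exec (Cond b c1 c2) st (k + 1) st1"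
| exec_CondFalse: "\<not> bval b st \<Longrightarrow> exec c2 st k st1 \<Longrightarrow> exec (Cond b c1 c2) st (k + 1) st1"
| exec_WhileFalse: "\<not> bval b st \<Longrightarrow> exec (While b c) st 1 st"
| exec_WhileTrue: "bval b st \<Longrightarrow> exec c st k1 st1 \<Longrightarrow> exec (While b c) st1 k2 st2 \<Longrightarrow>
    exec (While b c) st (k1 + k2 + 1) st2"

lemma exec_deterministic:
  "exec c st k st1 \<Longrightarrow> exec c st k' st2 \<Longrightarrow> k' = k \<and> st2 = st1"
proof (induction arbitrary: k' st2 rule: exec.induct)
  case (exec_Seq c1 st k1 st1 c2 k2 st2)
  from exec_Seq.prems show ?case
    by (cases rule: exec.cases) (use exec_Seq.IH in blast)+
next
  case (exec_CondTrue b st c1 k st1 c2)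
  from exec_CondTrue.prems show ?case
    by (cases rule: exec.cases) (use exec_CondTrue in blast)+
next
  case (exec_CondFalse b st c2 k st1 c1)
  from exec_CondFalse.prems show ?case
    by (cases rule: exec.cases) (use exec_CondFalse in blast)+
next
  case (exec_WhileTrue b st c k1 st1 k2 st2)
  from exec_WhileTrue.prems show ?case
    by (cases rule: exec.cases) (use exec_WhileTrue in blast)+
qed (erule exec.cases; simp)+

lemma exec_memory_length:
  "exec c st k st' \<Longrightarrow> length (memory st') = length (memory st)"
  by (induction rule: exec.induct) auto


section \<open>Algorithms in the sliding window model\<close>

record streaming_algorithm =
  init_prog :: cmd
  update_prog :: cmd
  query_prog :: cmd

text \<open>The parameters are given in registers: \<open>n\<close> and \<open>W\<close> in the index registers 0 and 1, and
  \<open>\<epsilon>\<close> in the real register 0. The memory consists of \<open>s\<close> words.\<close>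

definition start_state :: "nat \<Rightarrow> nat \<Rightarrow> real \<Rightarrow> nat \<Rightarrow> state" where
  "start_state n W \<epsilon> s =
     \<lparr>nreg = (\<lambda>_. 0)(0 := n, 1 := W), rreg = (\<lambda>_. 0)(0 := \<epsilon>), memory = replicate s 0,
      input_row = 0\<^sub>v 0, out_tape = []\<rparr>"

text \<open>\<open>processes alg st0 rs k st\<close>: from the start state \<open>st0\<close>, the algorithm reads the rows \<open>rs\<close>
  one by one in a single pass, in \<open>k\<close> steps altogether (initialization included), and is then in
  the state \<open>st\<close>.\<close>

inductive processes ::
  "streaming_algorithm \<Rightarrow> state \<Rightarrow> real vec list \<Rightarrow> nat \<Rightarrow> state \<Rightarrow> bool"
  for alg :: streaming_algorithm and st0 :: state where
  processes_init: "exec (init_prog alg) st0 k st \<Longrightarrow> processes alg st0 [] k st"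
| processes_row: "processes alg st0 rs k st \<Longrightarrow>
    exec (update_prog alg) (st\<lparr>input_row := r\<rparr>) k' st' \<Longrightarrow>
    processes alg st0 (rs @ [r]) (k + k') st'"

text \<open>A query works on a copy of the state, so that no work needed for later updates can be done
  in it. It may no longer read the last row, and it writes the entries of the
  output matrix row by row.\<close>

definition answers :: "streaming_algorithm \<Rightarrow> state \<Rightarrow> real mat \<Rightarrow> bool" where
  "answers alg st X \<longleftrightarrow>
     (\<exists>k st'. exec (query_prog alg) (st\<lparr>input_row := 0\<^sub>v 0, out_tape := []\<rparr>) k st' \<and>
        out_tape st' = concat (mat_to_list X))"

definition window :: "nat \<Rightarrow> nat \<Rightarrow> real vec list \<Rightarrow> real mat" where
  "window n W rs = mat_of_rows n (drop (length rs - W) rs)"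

end

theory Submission
  imports Defs "Jordan_Normal_Form.Schur_Decomposition" "Jordan_Normal_Form.Spectral_Radius"
begin

text \<open>
  Let \<open>S\<^sub>\<tau>\<close> be the Gram matrix of all rows from time \<open>\<tau>\<close> on and \<open>l \<ge> P(W)\<^sup>2\<close> an integer. The algorithm stores
  the prefix Gram matrices of some times \<open>\<tau>\<close>, so that every \<open>S\<^sub>\<tau>\<close> is the difference of the current prefix
  Gram matrix and a stored one, which need not be touched when a row arrives. A query outputs \<open>S\<^sub>\<tau>\<close>
  for the first stored \<open>\<tau>\<close> inside the window.

  Earlier windows and suffixes of the current one can be arbitrarily ill-conditioned, so suffixes are compared
  after the shift \<open>S\<^sub>\<tau> + I/l\<close>, and through the single number \<open>d(\<tau>) = det (S\<^sub>\<tau> + I/l)\<close>: for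
  positive definite \<open>Y \<preceq> X\<close> and every \<open>x\<close> one has \<open>det Y / det X \<le> (x\<^sup>T Y x) / (x\<^sup>T X x)\<close>, hence a determinant
  ratio of at least \<open>1 - e\<close> gives \<open>(1 - e) X \<preceq> Y\<close>. A time is dropped if \<open>d(\<tau>)\<close> exceeds the largest value
  possible for a window with \<open>\<sigma>\<^sub>m\<^sub>a\<^sub>x \<le> P(W)\<close>, or if the ratio between its two neighbours is at least \<open>1 - e\<close>. Then \<open>d\<close>
  shrinks by the factor \<open>1 - e\<close> every two stored times while staying above \<open>l\<^sup>-\<^sup>n\<close>, which leaves
  \<open>O(n log n / e)\<close> of them. On the row space of a window with \<open>\<sigma>\<^sub>m\<^sub>i\<^sub>n \<ge> 1/P(W)\<close> the shift is dominated by the Gram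
  matrix itself, and both Gram matrices vanish on its orthogonal complement.

  Dropping costs \<open>O(n\<^sup>3)\<close> per stored time and is done only when the number of stored times has doubled
  since the last time, which amortizes it without computing any logarithm. For \<open>\<epsilon> \<ge> 1\<close> the
  lower bound is void, the matrix \<open>l I\<close> is a valid answer, and no memory is used.
\<close>

section \<open>Symmetric matrices as functions on indices\<close>

text \<open>Roots and logarithms are not machine operations, so eigenvalues are out of reach,
  whereas the determinant of a positive definite matrix takes arithmetic alone, without a search for
  pivots. The conditioning hypothesis speaks of the last window only, so no earlier decision may
  rely on it. Giving up the starts above the cap is safe for good: further rows never decrease the
  determinant of a suffix, so such a window never has to be answered. Errors do not accumulate over
  deletions: a window that starts after a stored time \<open>a\<close> is compared with the suffix
  of \<open>a\<close> itself, which dominates it, and not with the suffix that answered it before.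
  The program works with \<open>e = \<epsilon> / 4\<close>: on the row space the shift costs another
  \<open>e\<close>, and \<open>1 / (1 - 2 * e) \<le> 1 + 4 * e\<close> if
  \<open>4 * e \<le> 1\<close>. The number \<open>l\<close> is a monomial in \<open>W\<close> with a
  natural coefficient, which index registers hold exactly; the cap \<open>(n * (l + 1)) ^ n\<close>
  is the Leibniz bound for entries of size at most \<open>l + 1\<close>.\<close>

definition ip :: "nat \<Rightarrow> (nat \<Rightarrow> real) \<Rightarrow> (nat \<Rightarrow> real) \<Rightarrow> real" where
  "ip n x y = (\<Sum>i<n. x i * y i)"

definition app :: "nat \<Rightarrow> (nat \<Rightarrow> nat \<Rightarrow> real) \<Rightarrow> (nat \<Rightarrow> real) \<Rightarrow> nat \<Rightarrow> real" where
  "app n G x i = (\<Sum>j<n. G i j * x j)"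

definition qf :: "nat \<Rightarrow> (nat \<Rightarrow> nat \<Rightarrow> real) \<Rightarrow> (nat \<Rightarrow> real) \<Rightarrow> real" where
  "qf n G x = ip n x (app n G x)"

definition sym_fun :: "nat \<Rightarrow> (nat \<Rightarrow> nat \<Rightarrow> real) \<Rightarrow> bool" where
  "sym_fun n G \<longleftrightarrow> (\<forall>i<n. \<forall>j<n. G i j = G j i)"

abbreviation mat_of :: "nat \<Rightarrow> (nat \<Rightarrow> nat \<Rightarrow> 'a) \<Rightarrow> 'a mat" where
  "mat_of n G \<equiv> mat n n (\<lambda>(i, j). G i j)"

lemma ip_commute: "ip n x y = ip n y x"
  by (simp add: ip_def mult.commute)

lemma ip_cong: "(\<And>i. i < n \<Longrightarrow> x i = x' i) \<Longrightarrow> (\<And>i. i < n \<Longrightarrow> y i = y' i) \<Longrightarrow> ip n x y = ip n x' y'"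
  by (simp add: ip_def)

lemma app_cong: "(\<And>i. i < n \<Longrightarrow> x i = x' i) \<Longrightarrow> app n G x = app n G x'"
  by (simp add: app_def fun_eq_iff)

lemma ip_diff_right: "ip n z (\<lambda>i. x i - y i) = ip n z x - ip n z y"
  by (simp add: ip_def sum_subtractf algebra_simps)

lemma ip_scale_right: "ip n z (\<lambda>i. c * x i) = c * ip n z x"
  by (simp add: ip_def sum_distrib_left algebra_simps)

lemma ip_scale_left: "ip n (\<lambda>i. c * x i) z = c * ip n x z"
  by (simp add: ip_def sum_distrib_left algebra_simps)

lemma ip_sum_right: "ip n z (\<lambda>i. \<Sum>a\<in>A. f a i) = (\<Sum>a\<in>A. ip n z (f a))"
proof -
  have "ip n z (\<lambda>i. \<Sum>a\<in>A. f a i) = (\<Sum>i<n. \<Sum>a\<in>A. z i * f a i)"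
    by (simp add: ip_def sum_distrib_left)
  also have "\<dots> = (\<Sum>a\<in>A. \<Sum>i<n. z i * f a i)" by (rule sum.swap)
  finally show ?thesis by (simp add: ip_def)
qed

lemma ip_sum_left: "ip n (\<lambda>i. \<Sum>a\<in>A. f a i) z = (\<Sum>a\<in>A. ip n (f a) z)"
  using ip_sum_right[of n z f A] by (simp add: ip_commute)

lemma ip_self_nonneg: "0 \<le> ip n x x"
  by (simp add: ip_def sum_nonneg)

lemma ip_self_eq_0: "ip n x x = 0 \<Longrightarrow> i < n \<Longrightarrow> x i = 0"
  by (simp add: ip_def sum_nonneg_eq_0_iff)

lemma app_diff: "app n G (\<lambda>i. x i - y i) i = app n G x i - app n G y i"
  by (simp add: app_def sum_subtractf algebra_simps)

lemma app_scale: "app n G (\<lambda>i. c * x i) i = c * app n G x i"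
  by (simp add: app_def sum_distrib_left algebra_simps)

lemma app_sum: "app n G (\<lambda>i. \<Sum>a\<in>A. f a i) i = (\<Sum>a\<in>A. app n G (f a) i)"
proof -
  have "app n G (\<lambda>i. \<Sum>a\<in>A. f a i) i = (\<Sum>j<n. \<Sum>a\<in>A. G i j * f a j)"
    by (simp add: app_def sum_distrib_left)
  also have "\<dots> = (\<Sum>a\<in>A. \<Sum>j<n. G i j * f a j)" by (rule sum.swap)
  finally show ?thesis by (simp add: app_def)
qed

lemma ip_app_sym:
  assumes "sym_fun n G"
  shows "ip n x (app n G y) = ip n (app n G x) y"
proof -
  have "ip n x (app n G y) = (\<Sum>i<n. \<Sum>j<n. x i * (G i j * y j))"
    by (simp add: ip_def app_def sum_distrib_left)
  also have "\<dots> = (\<Sum>j<n. \<Sum>i<n. x i * (G i j * y j))" by (rule sum.swap)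
  also have "\<dots> = (\<Sum>j<n. \<Sum>i<n. (G j i * x i) * y j)"
    using assms by (intro sum.cong) (auto simp: sym_fun_def)
  also have "\<dots> = ip n (app n G x) y"
    by (simp add: ip_def app_def sum_distrib_right)
  finally show ?thesis .
qed

lemma qf_cong: "(\<And>i. i < n \<Longrightarrow> x i = x' i) \<Longrightarrow> qf n G x = qf n G x'"
  unfolding qf_def by (intro ip_cong) (auto cong: app_cong simp: app_def)

subsection \<open>Decomposition into eigenvectors\<close>

text \<open>Components are indexed by eigenvalue and may vanish. This stands in for an orthonormal
  eigenbasis: multiplicities never appear, and orthogonality for distinct eigenvalues follows from
  symmetry.\<close>

definition eigen_sum :: "nat \<Rightarrow> (nat \<Rightarrow> nat \<Rightarrow> real) \<Rightarrow> real set \<Rightarrow> (nat \<Rightarrow> real) \<Rightarrow> (real \<Rightarrow> nat \<Rightarrow> real) \<Rightarrow> bool" where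
  "eigen_sum n G E x f \<longleftrightarrow> (\<forall>\<theta>\<in>E. \<forall>i<n. app n G (f \<theta>) i = \<theta> * f \<theta> i) \<and> (\<forall>i<n. x i = (\<Sum>\<theta>\<in>E. f \<theta> i))"

lemma eigen_sum_lincomb:
  assumes "\<And>a. a \<in> A \<Longrightarrow> \<exists>f. eigen_sum n G E (p a) f"
  shows "\<exists>f. eigen_sum n G E (\<lambda>i. \<Sum>a\<in>A. c a * p a i) f"
proof -
  obtain F where F: "\<And>a. a \<in> A \<Longrightarrow> eigen_sum n G E (p a) (F a)" using assms by metis
  have "eigen_sum n G E (\<lambda>i. \<Sum>a\<in>A. c a * p a i) (\<lambda>\<theta> i. \<Sum>a\<in>A. c a * F a \<theta> i)"
    unfolding eigen_sum_def
  proof (intro conjI ballI allI impI)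
    fix \<theta> i assume t: "\<theta> \<in> E" and i: "i < n"
    have "app n G (\<lambda>i. \<Sum>a\<in>A. c a * F a \<theta> i) i = (\<Sum>a\<in>A. c a * app n G (F a \<theta>) i)"
      by (simp add: app_sum app_scale)
    also have "\<dots> = (\<Sum>a\<in>A. c a * (\<theta> * F a \<theta> i))"
      using F t i by (intro sum.cong) (auto simp: eigen_sum_def)
    finally show "app n G (\<lambda>i. \<Sum>a\<in>A. c a * F a \<theta> i) i = \<theta> * (\<Sum>a\<in>A. c a * F a \<theta> i)"
      by (simp add: sum_distrib_left algebra_simps)
  next
    fix i assume i: "i < n"
    have "(\<Sum>a\<in>A. c a * p a i) = (\<Sum>a\<in>A. \<Sum>\<theta>\<in>E. c a * F a \<theta> i)"
      using F i by (intro sum.cong) (auto simp: eigen_sum_def sum_distrib_left)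
    also have "\<dots> = (\<Sum>\<theta>\<in>E. \<Sum>a\<in>A. c a * F a \<theta> i)" by (rule sum.swap)
    finally show "(\<Sum>a\<in>A. c a * p a i) = (\<Sum>\<theta>\<in>E. \<Sum>a\<in>A. c a * F a \<theta> i)" .
  qed
  then show ?thesis by blast
qed

text \<open>Symmetry excludes Jordan blocks. Dividing the components of
  \<open>(G - \<theta>) x\<close> at \<open>\<eta> \<noteq> \<theta>\<close> by
  \<open>\<eta> - \<theta>\<close> and subtracting them from \<open>x\<close> leaves
  \<open>u\<close> with \<open>(G - \<theta>) u = f \<theta>\<close>. Since
  \<open>G - \<theta>\<close> kills \<open>f \<theta>\<close>, moving it across the inner product
  shows that \<open>f \<theta>\<close> is orthogonal to itself; so \<open>u\<close> is the missing
  component.\<close>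

lemma eigen_sum_lift:
  assumes sym: "sym_fun n G" and fin: "finite E" and th: "\<theta> \<in> E"
    and f: "eigen_sum n G E (\<lambda>i. app n G x i - \<theta> * x i) f"
  shows "\<exists>h. eigen_sum n G E x h"
proof -
  define h0 where "h0 \<eta> = (\<lambda>i. inverse (\<eta> - \<theta>) * f \<eta> i)" for \<eta>
  define u where "u i = x i - (\<Sum>\<eta>\<in>E - {\<theta>}. h0 \<eta> i)" for i
  have u_fun: "u = (\<lambda>i. x i - (\<Sum>\<eta>\<in>E - {\<theta>}. h0 \<eta> i))"
    by (auto simp: u_def)
  have ev: "app n G (f \<eta>) i = \<eta> * f \<eta> i" if "\<eta> \<in> E" "i < n" for \<eta> i
    using f that by (auto simp: eigen_sum_def)
  have h0: "app n G (h0 \<eta>) i = \<eta> * h0 \<eta> i" if "\<eta> \<in> E" "i < n" for \<eta> i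
    unfolding h0_def app_scale using ev[OF that] by simp
  have v: "app n G u i - \<theta> * u i = f \<theta> i" if i: "i < n" for i
  proof -
    have "app n G u i = app n G x i - (\<Sum>\<eta>\<in>E - {\<theta>}. app n G (h0 \<eta>) i)"
      unfolding u_fun app_diff app_sum by simp
    also have "(\<Sum>\<eta>\<in>E - {\<theta>}. app n G (h0 \<eta>) i) = (\<Sum>\<eta>\<in>E - {\<theta>}. \<eta> * h0 \<eta> i)"
      using h0 i by (intro sum.cong) auto
    finally have "app n G u i - \<theta> * u i = (app n G x i - \<theta> * x i)
        - (\<Sum>\<eta>\<in>E - {\<theta>}. (\<eta> - \<theta>) * h0 \<eta> i)"
      using u_fun[THEN fun_cong, of i, symmetric, THEN arg_cong[where f = "\<lambda>t. \<theta> * t"]]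
      by (simp add: algebra_simps sum_distrib_left sum_subtractf)
    also have "(\<Sum>\<eta>\<in>E - {\<theta>}. (\<eta> - \<theta>) * h0 \<eta> i) = (\<Sum>\<eta>\<in>E - {\<theta>}. f \<eta> i)"
      by (intro sum.cong) (auto simp: h0_def)
    also have "app n G x i - \<theta> * x i = (\<Sum>\<eta>\<in>E. f \<eta> i)"
      using f i by (auto simp: eigen_sum_def)
    also have "\<dots> = f \<theta> i + (\<Sum>\<eta>\<in>E - {\<theta>}. f \<eta> i)"
      using fin th by (simp add: sum.remove)
    finally show ?thesis by simp
  qed
  have "ip n (f \<theta>) (f \<theta>) = ip n (f \<theta>) (\<lambda>i. app n G u i - \<theta> * u i)"
    by (rule ip_cong) (auto simp: v)
  also have "\<dots> = ip n (app n G (f \<theta>)) u - \<theta> * ip n (f \<theta>) u"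
    unfolding ip_diff_right ip_scale_right ip_app_sym[OF sym] by simp
  also have "ip n (app n G (f \<theta>)) u = ip n (\<lambda>i. \<theta> * f \<theta> i) u"
    by (rule ip_cong) (auto simp: ev th)
  also have "\<dots> = \<theta> * ip n (f \<theta>) u" by (rule ip_scale_left)
  finally have "ip n (f \<theta>) (f \<theta>) = 0" by simp
  then have f0: "f \<theta> i = 0" if "i < n" for i using ip_self_eq_0 that by blast
  have "eigen_sum n G E x (\<lambda>\<eta>. if \<eta> = \<theta> then u else h0 \<eta>)"
    unfolding eigen_sum_def
  proof (intro conjI ballI allI impI)
    fix \<eta> i assume "\<eta> \<in> E" "i < n"
    then show "app n G (if \<eta> = \<theta> then u else h0 \<eta>) i = \<eta> * (if \<eta> = \<theta> then u else h0 \<eta>) i"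
      using v[of i] f0[of i] h0 by auto
  next
    fix i assume "i < n"
    show "x i = (\<Sum>\<eta>\<in>E. (if \<eta> = \<theta> then u else h0 \<eta>) i)"
      using fin th by (simp add: sum.remove u_def)
  qed
  then show ?thesis by blast
qed

text \<open>Over the complex numbers the polynomial splits. At a complex eigenvector the Hermitian
  form of a real symmetric matrix is real and the squared norm is real and nonzero, so every root
  equals its conjugate; injectivity of the embedding carries the factorization back to the
  reals.\<close>

lemma symmetric_char_poly_splits:
  fixes A :: "real mat"
  assumes A: "A \<in> carrier_mat n n" and sym: "A\<^sup>T = A"
  shows "\<exists>es. char_poly A = (\<Prod>e\<leftarrow>es. [:- e, 1:])"
proof -
  let ?C = "map_mat complex_of_real A"
  have C: "?C \<in> carrier_mat n n" using A by auto
  obtain as where as: "char_poly ?C = (\<Prod>a\<leftarrow>as. [:- a, 1:])"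
    using char_poly_factorized[OF C] by blast
  have real: "Im a = 0" if "a \<in> set as" for a
  proof -
    have "poly (char_poly ?C) a = 0" unfolding as poly_prod_list
      using that by (auto simp: prod_list_zero_iff)
    then have "eigenvalue ?C a" using eigenvalue_root_char_poly[OF C] by blast
    then obtain v where v: "v \<in> carrier_vec n" "v \<noteq> 0\<^sub>v n" "?C *\<^sub>v v = a \<cdot>\<^sub>v v"
      using C unfolding eigenvalue_def eigenvector_def by auto
    have row: "(\<Sum>j<n. of_real (A $$ (i,j)) * v $ j) = a * v $ i" if "i < n" for i
      using arg_cong[OF v(3), of "\<lambda>w. w $ i"] that v(1) A
      by (simp add: scalar_prod_def lessThan_atLeast0)
    define N where "N = (\<Sum>i<n. cnj (v $ i) * v $ i)"
    have N: "a * N = (\<Sum>i<n. \<Sum>j<n. cnj (v $ i) * of_real (A $$ (i,j)) * v $ j)" (is "_ = ?S")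
      unfolding N_def sum_distrib_left
    proof (rule sum.cong)
      fix i assume i: "i \<in> {..<n}"
      have "a * (cnj (v $ i) * v $ i) = cnj (v $ i) * (a * v $ i)" by simp
      also have "\<dots> = cnj (v $ i) * (\<Sum>j<n. of_real (A $$ (i,j)) * v $ j)" using row i by simp
      finally show "a * (cnj (v $ i) * v $ i) = (\<Sum>j<n. cnj (v $ i) * of_real (A $$ (i,j)) * v $ j)"
        by (simp add: sum_distrib_left mult.assoc)
    qed simp
    have "cnj ?S = (\<Sum>i<n. \<Sum>j<n. v $ i * of_real (A $$ (i,j)) * cnj (v $ j))" by simp
    also have "\<dots> = (\<Sum>j<n. \<Sum>i<n. v $ i * of_real (A $$ (i,j)) * cnj (v $ j))" by (rule sum.swap)
    also have "\<dots> = ?S"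
    proof (intro sum.cong refl)
      fix i j assume "i \<in> {..<n}" "j \<in> {..<n}"
      moreover then have "A $$ (i,j) = A $$ (j,i)" using sym A by (metis carrier_matD index_transpose_mat(1) lessThan_iff)
      ultimately show "v $ j * of_real (A $$ (j,i)) * cnj (v $ i) = cnj (v $ i) * of_real (A $$ (i,j)) * v $ j"
        by simp
    qed
    finally have cS: "cnj ?S = ?S" .
    have cN: "N = of_real (\<Sum>i<n. (cmod (v $ i))\<^sup>2)" unfolding N_def of_real_sum
      by (intro sum.cong refl) (metis complex_norm_square mult.commute of_real_power)
    have "(\<Sum>i<n. (cmod (v $ i))\<^sup>2) \<noteq> 0"
    proof
      assume "(\<Sum>i<n. (cmod (v $ i))\<^sup>2) = 0"
      then have "\<forall>i<n. v $ i = 0" by (simp add: sum_nonneg_eq_0_iff)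
      then have "v = 0\<^sub>v n" using v(1) by auto
      with v(2) show False by simp
    qed
    then have "N \<noteq> 0" using cN by (simp del: of_real_sum)
    have "cnj a * N = a * N"
      using cS unfolding N[symmetric] using cN by simp
    then have "cnj a = a" using \<open>N \<noteq> 0\<close> by simp
    then show ?thesis by (metis Reals_cnj_iff complex_is_Real_iff)
  qed
  interpret of_real_poly: map_poly_inj_comm_ring_hom complex_of_real ..
  have lin: "[:- complex_of_real r, 1:] = map_poly complex_of_real [:- r, 1:]" for r by simp
  have "map_poly complex_of_real (char_poly A) = (\<Prod>a\<leftarrow>as. [:- a, 1:])"
    using as of_real_hom.char_poly_hom[OF A] by metis
  also have "\<dots> = map_poly complex_of_real (\<Prod>e\<leftarrow>map Re as. [:- e, 1:])"
    using real
  proof (induction as)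
    case Nil then show ?case by simp
  next
    case (Cons a as)
    have "a = complex_of_real (Re a)" using Cons.prems by (simp add: complex_eq_iff)
    then have "[:- a, 1:] = map_poly complex_of_real [:- Re a, 1:]" using lin by metis
    moreover have "(\<Prod>a\<leftarrow>as. [:- a, 1:]) = map_poly complex_of_real (\<Prod>e\<leftarrow>map Re as. [:- e, 1:])"
      by (rule Cons.IH) (use Cons.prems in auto)
    ultimately show ?case
      unfolding list.map prod_list.Cons of_real_poly.hom_mult by (simp only:)
  qed
  finally show ?thesis by (metis of_real_poly.injectivity)
qed

text \<open>As the characteristic polynomial splits, there is a real triangularization
  \<open>A P = P B\<close>, where \<open>P\<close> is only known to be invertible. The operator
  \<open>G - B $$ (j, j)\<close> maps column \<open>j\<close> of \<open>P\<close> into the span of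
  the earlier columns, so \<open>eigen_sum_lift\<close> decomposes the columns one after another,
  and with them every vector.\<close>

lemma eigen_sum_exists:
  fixes G :: "nat \<Rightarrow> nat \<Rightarrow> real"
  assumes sym: "sym_fun n G"
  defines "E \<equiv> {\<theta>. eigenvalue (mat_of n G) \<theta>}"
  shows "finite E" and "\<exists>f. eigen_sum n G E x f"
proof -
  let ?A = "mat_of n G"
  have A: "?A \<in> carrier_mat n n" by simp
  show fin: "finite E" unfolding E_def
    using card_finite_spectrum[OF A] by (simp add: spectrum_def)
  have "?A\<^sup>T = ?A" using sym by (intro eq_matI) (auto simp: sym_fun_def)
  then obtain es where es: "char_poly ?A = (\<Prod>e\<leftarrow>es. [:- e, 1:])"
    using symmetric_char_poly_splits[OF A] by blast
  obtain B P Q where "schur_decomposition ?A es = (B, P, Q)" by (cases "schur_decomposition ?A es")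
  then have wit: "similar_mat_wit ?A B P Q" and ut: "upper_triangular B" and dg: "diag_mat B = es"
    using schur_decomposition[OF A es] by auto
  have B: "B \<in> carrier_mat n n" and P: "P \<in> carrier_mat n n" and Q: "Q \<in> carrier_mat n n"
    and PQ: "P * Q = 1\<^sub>m n" and QP: "Q * P = 1\<^sub>m n" and APBQ: "?A = P * B * Q"
    using similar_mat_witD2[OF A wit] by auto
  have AP: "?A * P = P * B"
  proof -
    have "?A * P = P * B * (Q * P)" unfolding APBQ using P B Q by (simp add: assoc_mult_mat[of _ n n _ n _ n])
    then show ?thesis unfolding QP using P B by simp
  qed
  define p where "p j i = P $$ (i, j)" for i j
  have Gp: "app n G (p j) i = (\<Sum>k\<le>j. B $$ (k, j) * p k i)" if j: "j < n" and i: "i < n" for i j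
  proof -
    have "app n G (p j) i = (?A * P) $$ (i, j)"
      using i j P by (simp add: app_def p_def scalar_prod_def lessThan_atLeast0)
    also have "\<dots> = (\<Sum>k<n. P $$ (i, k) * B $$ (k, j))"
      unfolding AP using i j P B by (simp add: scalar_prod_def lessThan_atLeast0)
    also have "\<dots> = (\<Sum>k\<le>j. P $$ (i, k) * B $$ (k, j))"
      using j ut B by (intro sum.mono_neutral_right) (auto simp: upper_triangular_def)
    finally show ?thesis by (simp add: p_def mult.commute)
  qed
  have evB: "B $$ (j, j) \<in> E" if j: "j < n" for j
  proof -
    have "B $$ (j, j) \<in> set es" using j B unfolding dg[symmetric] by (auto simp: diag_mat_def)
    then have "poly (char_poly ?A) (B $$ (j, j)) = 0" unfolding es poly_prod_list
      by (auto simp: prod_list_zero_iff)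
    then show ?thesis unfolding E_def using eigenvalue_root_char_poly[OF A] by blast
  qed
  have pj: "j < n \<Longrightarrow> \<exists>f. eigen_sum n G E (p j) f" for j
  proof (induction j rule: less_induct)
    case (less j)
    have "\<exists>f. eigen_sum n G E (\<lambda>i. \<Sum>k\<in>{..<j}. B $$ (k, j) * p k i) f"
      by (rule eigen_sum_lincomb) (use less in auto)
    then obtain f where f: "eigen_sum n G E (\<lambda>i. \<Sum>k<j. B $$ (k, j) * p k i) f" by blast
    have "app n G (p j) i - B $$ (j, j) * p j i = (\<Sum>k<j. B $$ (k, j) * p k i)" if "i < n" for i
      using Gp[OF less.prems that] by (simp add: lessThan_Suc_atMost[symmetric])
    then have "eigen_sum n G E (\<lambda>i. app n G (p j) i - B $$ (j, j) * p j i) f"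
      using f by (simp add: eigen_sum_def)
    then show ?case using eigen_sum_lift[OF sym fin evB[OF less.prems]] by blast
  qed
  define c where "c = Q *\<^sub>v vec n x"
  have "P *\<^sub>v c = vec n x"
    unfolding c_def using P Q PQ by (metis assoc_mult_mat_vec one_mult_mat_vec vec_carrier)
  then have "x i = (\<Sum>j<n. c $ j * p j i)" if "i < n" for i
  proof -
    assume eq: "P *\<^sub>v c = vec n x"
    have "x i = (P *\<^sub>v c) $ i" using eq that by simp
    also have "\<dots> = (\<Sum>j<n. c $ j * p j i)"
      using that P Q by (simp add: scalar_prod_def p_def c_def lessThan_atLeast0 mult.commute)
    finally show ?thesis .
  qed
  moreover have "\<exists>f. eigen_sum n G E (\<lambda>i. \<Sum>j<n. c $ j * p j i) f"
    by (rule eigen_sum_lincomb) (use pj in auto)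
  ultimately show "\<exists>f. eigen_sum n G E x f" by (simp add: eigen_sum_def)
qed

lemma eigen_sum_orthogonal:
  assumes sym: "sym_fun n G" and "\<And>i. i < n \<Longrightarrow> app n G x i = \<theta> * x i"
    and "\<And>i. i < n \<Longrightarrow> app n G y i = \<eta> * y i" and "\<theta> \<noteq> \<eta>"
  shows "ip n x y = 0"
proof -
  have "\<eta> * ip n x y = ip n x (app n G y)" unfolding ip_scale_right[symmetric]
    by (rule ip_cong) (auto simp: assms)
  also have "\<dots> = \<theta> * ip n x y" unfolding ip_app_sym[OF sym] ip_scale_left[symmetric]
    by (rule ip_cong) (auto simp: assms)
  finally show ?thesis using \<open>\<theta> \<noteq> \<eta>\<close> by simp
qed

lemma ip_eigen_sums:
  assumes sym: "sym_fun n G" and fin: "finite E"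
    and ev: "\<And>\<theta> i. \<theta> \<in> E \<Longrightarrow> i < n \<Longrightarrow> app n G (f \<theta>) i = \<theta> * f \<theta> i"
  shows "ip n (\<lambda>i. \<Sum>\<theta>\<in>E. f \<theta> i) (\<lambda>i. \<Sum>\<theta>\<in>E. f \<theta> i) = (\<Sum>\<theta>\<in>E. ip n (f \<theta>) (f \<theta>))"
    and "qf n G (\<lambda>i. \<Sum>\<theta>\<in>E. f \<theta> i) = (\<Sum>\<theta>\<in>E. \<theta> * ip n (f \<theta>) (f \<theta>))"
proof -
  define q where "q \<theta> = ip n (f \<theta>) (f \<theta>)" for \<theta>
  have orth: "ip n (f \<theta>) (f \<eta>) = (if \<eta> = \<theta> then q \<theta> else 0)" if "\<theta> \<in> E" "\<eta> \<in> E" for \<theta> \<eta>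
    using eigen_sum_orthogonal[OF sym ev ev] that by (auto simp: q_def)
  have "ip n (\<lambda>i. \<Sum>\<theta>\<in>E. f \<theta> i) (\<lambda>i. \<Sum>\<theta>\<in>E. f \<theta> i) = (\<Sum>\<theta>\<in>E. q \<theta>)"
    unfolding ip_sum_left ip_sum_right using fin by (intro sum.cong refl) (simp add: orth cong: sum.cong)
  then show "ip n (\<lambda>i. \<Sum>\<theta>\<in>E. f \<theta> i) (\<lambda>i. \<Sum>\<theta>\<in>E. f \<theta> i) = (\<Sum>\<theta>\<in>E. ip n (f \<theta>) (f \<theta>))"
    by (simp add: q_def)
  have "qf n G (\<lambda>i. \<Sum>\<theta>\<in>E. f \<theta> i) = ip n (\<lambda>i. \<Sum>\<theta>\<in>E. f \<theta> i) (\<lambda>i. \<Sum>\<theta>\<in>E. \<theta> * f \<theta> i)"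
    unfolding qf_def by (rule ip_cong) (auto simp: app_sum ev)
  also have "\<dots> = (\<Sum>\<theta>\<in>E. \<theta> * q \<theta>)"
    unfolding ip_sum_left ip_sum_right ip_scale_right
    using fin by (intro sum.cong refl) (simp add: orth if_distrib[of "\<lambda>t. _ * t"] cong: sum.cong if_cong)
  also have "\<dots> = (\<Sum>\<theta>\<in>E. \<theta> * ip n (f \<theta>) (f \<theta>))"
    by (simp add: q_def)
  finally show "qf n G (\<lambda>i. \<Sum>\<theta>\<in>E. f \<theta> i) = (\<Sum>\<theta>\<in>E. \<theta> * ip n (f \<theta>) (f \<theta>))" .
qed

lemma qf_le_of_eigenvalues:
  assumes sym: "sym_fun n G" and "\<And>\<theta>. eigenvalue (mat_of n G) \<theta> \<Longrightarrow> \<theta> \<le> \<Lambda>"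
  shows "qf n G x \<le> \<Lambda> * ip n x x"
proof -
  let ?E = "{\<theta>. eigenvalue (mat_of n G) \<theta>}"
  obtain f where f: "eigen_sum n G ?E x f" using eigen_sum_exists[OF sym] by blast
  let ?s = "\<lambda>i. \<Sum>\<theta>\<in>?E. f \<theta> i"
  have "qf n G x = qf n G ?s" by (rule qf_cong) (use f in \<open>auto simp: eigen_sum_def\<close>)
  also have "\<dots> = (\<Sum>\<theta>\<in>?E. \<theta> * ip n (f \<theta>) (f \<theta>))"
    by (rule ip_eigen_sums(2)[OF sym eigen_sum_exists(1)[OF sym]]) (use f in \<open>auto simp: eigen_sum_def\<close>)
  also have "\<dots> \<le> (\<Sum>\<theta>\<in>?E. \<Lambda> * ip n (f \<theta>) (f \<theta>))"
    using assms(2) by (intro sum_mono mult_right_mono) (auto simp: ip_self_nonneg)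
  also have "\<dots> = \<Lambda> * ip n ?s ?s" unfolding sum_distrib_left[symmetric]
    by (subst ip_eigen_sums(1)[OF sym eigen_sum_exists(1)[OF sym]]) (use f in \<open>auto simp: eigen_sum_def\<close>)
  also have "ip n ?s ?s = ip n x x" by (rule ip_cong) (use f in \<open>auto simp: eigen_sum_def\<close>)
  finally show ?thesis .
qed

lemma split_off_kernel:
  assumes sym: "sym_fun n G" and "\<And>\<theta>. eigenvalue (mat_of n G) \<theta> \<Longrightarrow> \<theta> = 0 \<or> \<mu> \<le> \<theta>"
  obtains z where "\<And>i. i < n \<Longrightarrow> app n G z i = 0"
    "\<mu> * ip n (\<lambda>i. x i - z i) (\<lambda>i. x i - z i) \<le> qf n G (\<lambda>i. x i - z i)"
proof -
  let ?E = "{\<theta>. eigenvalue (mat_of n G) \<theta>}"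
  let ?F = "?E - {0}"
  have fin: "finite ?E" using eigen_sum_exists[OF sym] by blast
  then have finF: "finite ?F" by simp
  obtain f where f: "eigen_sum n G ?E x f" using eigen_sum_exists[OF sym] by blast
  have ev: "app n G (f \<theta>) i = \<theta> * f \<theta> i" if "\<theta> \<in> ?E" "i < n" for \<theta> i
    using f that by (auto simp: eigen_sum_def)
  \<comment> \<open>If 0 is not an eigenvalue, nothing is known about \<open>f 0\<close>, and the
    kernel component has to be 0.\<close>
  define z where "z i = (if 0 \<in> ?E then f 0 i else 0)" for i
  let ?s = "\<lambda>i. \<Sum>\<theta>\<in>?F. f \<theta> i"
  have y: "x i - z i = ?s i" if "i < n" for i
    using f that fin by (auto simp: eigen_sum_def z_def sum.remove)
  have "app n G z i = 0" if "i < n" for i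
  proof (cases "0 \<in> ?E")
    case True
    then have "z = f 0" by (auto simp: z_def)
    then show ?thesis using ev[OF True that] by simp
  next
    case False
    then have "z = (\<lambda>_. 0)" by (auto simp: z_def)
    then show ?thesis by (simp add: app_def)
  qed
  moreover have "\<mu> * ip n ?s ?s \<le> qf n G ?s"
  proof -
    have "\<mu> * ip n ?s ?s = (\<Sum>\<theta>\<in>?F. \<mu> * ip n (f \<theta>) (f \<theta>))" unfolding sum_distrib_left[symmetric]
      by (subst ip_eigen_sums(1)[OF sym finF]) (use ev in auto)
    also have "\<dots> \<le> (\<Sum>\<theta>\<in>?F. \<theta> * ip n (f \<theta>) (f \<theta>))"
      using assms(2) by (intro sum_mono mult_right_mono) (auto simp: ip_self_nonneg)
    also have "\<dots> = qf n G ?s"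
      by (rule ip_eigen_sums(2)[OF sym finF, symmetric]) (use ev in auto)
    finally show ?thesis .
  qed
  then have "\<mu> * ip n (\<lambda>i. x i - z i) (\<lambda>i. x i - z i) \<le> qf n G (\<lambda>i. x i - z i)"
    using y by (simp cong: ip_cong qf_cong)
  ultimately show thesis using that by blast
qed

subsection \<open>Determinants under rank-one updates\<close>

definition shift :: "real \<Rightarrow> (nat \<Rightarrow> nat \<Rightarrow> real) \<Rightarrow> nat \<Rightarrow> nat \<Rightarrow> real" where
  "shift \<mu> G i j = G i j + (if i = j then \<mu> else 0)"

text \<open>Rows are numbered from 0 and ranges are half open: after \<open>t\<close> rows,
  \<open>gram r \<tau> t\<close> belongs to the suffix that starts with row \<open>\<tau>\<close>,
  \<open>gram r 0 \<tau>\<close> to the prefix before it, and \<open>gram r t t\<close> is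
  zero.\<close>

definition gram :: "(nat \<Rightarrow> nat \<Rightarrow> real) \<Rightarrow> nat \<Rightarrow> nat \<Rightarrow> nat \<Rightarrow> nat \<Rightarrow> real" where
  "gram r a b i j = (\<Sum>l = a..<b. r l i * r l j)"

definition pd :: "nat \<Rightarrow> (nat \<Rightarrow> nat \<Rightarrow> real) \<Rightarrow> bool" where
  "pd n G \<longleftrightarrow> sym_fun n G \<and> (\<forall>x. (\<exists>i<n. x i \<noteq> 0) \<longrightarrow> 0 < qf n G x)"

abbreviation dt :: "nat \<Rightarrow> (nat \<Rightarrow> nat \<Rightarrow> real) \<Rightarrow> real" where
  "dt n G \<equiv> det (mat_of n G)"

lemma ip_diff_left: "ip n (\<lambda>i. x i - y i) z = ip n x z - ip n y z"
  by (simp add: ip_def sum_subtractf algebra_simps)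

lemma qf_shift: "qf n (shift \<mu> G) x = qf n G x + \<mu> * ip n x x"
proof -
  have "app n (shift \<mu> G) x i = app n G x i + \<mu> * x i" if "i < n" for i
    using that by (simp add: app_def shift_def algebra_simps sum.distrib if_distrib[of "\<lambda>t. _ * t"] cong: if_cong)
  then have "qf n (shift \<mu> G) x = ip n x (\<lambda>i. app n G x i + \<mu> * x i)"
    unfolding qf_def by (intro ip_cong) auto
  also have "\<dots> = qf n G x + \<mu> * ip n x x"
    by (simp add: qf_def ip_def algebra_simps sum.distrib sum_distrib_left)
  finally show ?thesis .
qed

lemma app_outer: "app n (\<lambda>i j. Z i j + a i * b j) x i = app n Z x i + a i * ip n b x"
  by (simp add: app_def ip_def algebra_simps sum.distrib sum_distrib_left)

lemma qf_outer: "qf n (\<lambda>i j. Z i j + a i * a j) x = qf n Z x + (ip n a x)\<^sup>2"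
proof -
  have "qf n (\<lambda>i j. Z i j + a i * a j) x = ip n x (\<lambda>i. app n Z x i + a i * ip n a x)"
    unfolding qf_def by (intro ip_cong) (auto simp: app_outer)
  also have "\<dots> = qf n Z x + ip n x a * ip n a x"
    by (simp add: qf_def ip_def algebra_simps sum.distrib sum_distrib_left)
  finally show ?thesis by (simp add: ip_commute power2_eq_square)
qed

lemma gram_step: "a < b \<Longrightarrow> gram r a b = (\<lambda>i j. gram r (Suc a) b i j + r a i * r a j)"
  by (simp add: gram_def fun_eq_iff sum.atLeast_Suc_lessThan)

lemma gram_empty: "b \<le> a \<Longrightarrow> gram r a b = (\<lambda>i j. 0)"
  by (simp add: gram_def fun_eq_iff)

lemma gram_Suc: "a \<le> b \<Longrightarrow> gram r a (Suc b) = (\<lambda>i j. gram r a b i j + r b i * r b j)"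
  by (simp add: gram_def fun_eq_iff)

lemma gram_sym: "gram r a b i j = gram r a b j i"
  by (simp add: gram_def mult.commute)

lemma qf_gram_nonneg: "0 \<le> qf n (gram r a b) x"
proof (induction "b - a" arbitrary: a)
  case 0 then show ?case by (simp add: gram_empty qf_def app_def ip_def)
next
  case (Suc k)
  then have "a < b" by simp
  then show ?case using Suc by (simp add: gram_step qf_outer)
qed

lemma qf_gram_mono:
  assumes "a \<le> a'"
  shows "qf n (gram r a' b) x \<le> qf n (gram r a b) x"
  using assms
proof (induction rule: inc_induct)
  case base show ?case by simp
next
  case (step a)
  have "qf n (gram r (Suc a) b) x \<le> qf n (gram r a b) x"
    by (cases "a < b") (simp_all add: gram_step qf_outer gram_empty)
  then show ?case using step by linarith
qed

lemma shift_gram_step: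
  "a < b \<Longrightarrow> shift \<mu> (gram r a b) = (\<lambda>i j. shift \<mu> (gram r (Suc a) b) i j + r a i * r a j)"
  by (simp add: gram_step shift_def fun_eq_iff)

lemma pd_shift_gram:
  assumes "\<mu> > 0"
  shows "pd n (shift \<mu> (gram r a b))"
  unfolding pd_def
proof (intro conjI allI impI)
  show "sym_fun n (shift \<mu> (gram r a b))"
    by (simp add: sym_fun_def shift_def gram_sym)
next
  fix x :: "nat \<Rightarrow> real" assume "\<exists>i<n. x i \<noteq> 0"
  then have "ip n x x \<noteq> 0" using ip_self_eq_0 by blast
  then have "0 < ip n x x" using ip_self_nonneg[of n x] by linarith
  then show "0 < qf n (shift \<mu> (gram r a b)) x"
    using assms qf_gram_nonneg[of n r a b x] by (simp add: qf_shift add_nonneg_pos)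
qed

text \<open>Sylvester's identity for rank one. The unit triangular \<open>?M1\<close> intertwines
  \<open>?M2\<close>, which carries the determinant of size \<open>n\<close>, with
  \<open>?M3\<close>, which carries the scalar; the sign in \<open>R\<close> cancels the outer
  product in one corner and the inner product in the other.\<close>

lemma det_one_plus_outer:
  "dt n (\<lambda>i j. (if i = j then 1 else 0) + u i * r j) = 1 + ip n r u"
proof -
  define R where "R = mat 1 n (\<lambda>(i, j). - r j)"
  define U where "U = mat n 1 (\<lambda>(i, j). u i)"
  define K where "K = mat_of n (\<lambda>i j. (if i = j then 1 else 0) + u i * r j)"
  define c where "c = mat 1 1 (\<lambda>_. 1 + ip n r u)"
  have R: "R \<in> carrier_mat 1 n" and U: "U \<in> carrier_mat n 1" and K: "K \<in> carrier_mat n n"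
    and c: "c \<in> carrier_mat 1 1" by (simp_all add: R_def U_def K_def c_def)
  let ?M1 = "four_block_mat (1\<^sub>m 1) (0\<^sub>m 1 n) U (1\<^sub>m n)"
  let ?M2 = "four_block_mat (1\<^sub>m 1) R (0\<^sub>m n 1) K"
  let ?M3 = "four_block_mat c R (0\<^sub>m n 1) (1\<^sub>m n)"
  have M: "?M1 \<in> carrier_mat (1 + n) (1 + n)" "?M2 \<in> carrier_mat (1 + n) (1 + n)"
    "?M3 \<in> carrier_mat (1 + n) (1 + n)"
    using K c by auto
  have eq: "?M1 * ?M2 = ?M3 * ?M1"
  proof -
    have "?M1 * ?M2 = four_block_mat (1\<^sub>m 1) R U (U * R + K)"
      by (subst mult_four_block_mat[where ?nr1.0=1 and ?n1.0=1 and ?n2.0=n and ?nr2.0=n and ?nc1.0=1 and ?nc2.0=n])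
        (use R U K in auto)
    moreover have "?M3 * ?M1 = four_block_mat (c + R * U) R U (1\<^sub>m n)"
      by (subst mult_four_block_mat[where ?nr1.0=1 and ?n1.0=1 and ?n2.0=n and ?nr2.0=n and ?nc1.0=1 and ?nc2.0=n])
        (use R U c in auto)
    moreover have "U * R + K = 1\<^sub>m n"
      by (rule eq_matI) (auto simp: R_def U_def K_def scalar_prod_def)
    moreover have "c + R * U = 1\<^sub>m 1"
      by (rule eq_matI) (auto simp: R_def U_def c_def scalar_prod_def ip_def lessThan_atLeast0 sum_negf)
    ultimately show ?thesis by simp
  qed
  have d1: "det ?M1 = 1"
    by (subst det_four_block_mat_upper_right_zero[where n = 1 and m = n]) (use U in auto)
  have d2: "det ?M2 = det K"
    by (subst det_four_block_mat_lower_left_zero[where n = 1 and m = n]) (use R K in auto)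
  have dc: "det c = 1 + ip n r u" by (simp add: c_def det_def sign_def)
  have d3: "det ?M3 = 1 + ip n r u"
    by (subst det_four_block_mat_lower_left_zero[where n = 1 and m = n])
      (use R c dc in auto)
  have "det ?M1 * det ?M2 = det ?M3 * det ?M1"
    using eq det_mult[OF M(1) M(2)] det_mult[OF M(3) M(1)] by simp
  then have "det K = 1 + ip n r u" unfolding d1 d2 d3 by simp
  then show ?thesis by (simp add: K_def)
qed

text \<open>With \<open>Z u = a\<close> the update factors as \<open>Z (I + u b\<^sup>T)\<close>;
  the solution \<open>u\<close> takes the place of the inverse of \<open>Z\<close>.\<close>

lemma det_rank_one_update:
  assumes "\<And>i. i < n \<Longrightarrow> app n Z u i = a i"
  shows "dt n (\<lambda>i j. Z i j + a i * b j) = dt n Z * (1 + ip n b u)"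
proof -
  let ?K = "mat_of n (\<lambda>i j. (if i = j then 1 else 0) + u i * b j)"
  have "mat_of n (\<lambda>i j. Z i j + a i * b j) = mat_of n Z * ?K"
  proof (rule eq_matI)
    fix i j assume "i < dim_row (mat_of n Z * ?K)" "j < dim_col (mat_of n Z * ?K)"
    then have i: "i < n" and j: "j < n" by auto
    have "(mat_of n Z * ?K) $$ (i, j) = (\<Sum>l<n. Z i l * ((if l = j then 1 else 0) + u l * b j))"
      using i j by (simp add: scalar_prod_def lessThan_atLeast0)
    also have "\<dots> = Z i j + app n Z u i * b j"
      using j by (simp add: app_def algebra_simps sum.distrib sum_distrib_left
          if_distrib[of "\<lambda>t. _ * t"] cong: if_cong)
    finally show "mat_of n (\<lambda>i j. Z i j + a i * b j) $$ (i, j) = (mat_of n Z * ?K) $$ (i, j)"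
      using i j assms by simp
  qed auto
  then show ?thesis using det_mult[of "mat_of n Z" n ?K] by (simp add: det_one_plus_outer)
qed

lemma pd_solve:
  assumes "pd n Z"
  obtains u where "\<And>i. i < n \<Longrightarrow> app n Z u i = a i"
proof -
  let ?A = "mat_of n Z"
  have A: "?A \<in> carrier_mat n n" by simp
  have "det ?A \<noteq> 0"
  proof
    assume "det ?A = 0"
    then obtain v where v: "v \<in> carrier_vec n" "v \<noteq> 0\<^sub>v n" "?A *\<^sub>v v = 0\<^sub>v n"
      using det_0_iff_vec_prod_zero_field[OF A] by blast
    have "app n Z (\<lambda>i. v $ i) i = 0" if "i < n" for i
      using arg_cong[OF v(3), of "\<lambda>w. w $ i"] that v(1)
      by (simp add: app_def scalar_prod_def lessThan_atLeast0)
    then have "qf n Z (\<lambda>i. v $ i) = 0" by (simp add: qf_def ip_def)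
    moreover have "\<exists>i<n. v $ i \<noteq> 0" using v(1,2) by auto
    ultimately show False using assms by (auto simp: pd_def)
  qed
  then have "?A \<in> Units (ring_mat TYPE(real) n ())" by (rule det_non_zero_imp_unit[OF A])
  then obtain B where B: "B \<in> carrier_mat n n" "?A * B = 1\<^sub>m n"
    unfolding Units_def ring_mat_def by auto
  define u where "u = B *\<^sub>v vec n a"
  have u: "u \<in> carrier_vec n" using B by (simp add: u_def)
  have Au: "?A *\<^sub>v u = vec n a"
    unfolding u_def using A B by (metis assoc_mult_mat_vec one_mult_mat_vec vec_carrier)
  have "app n Z (\<lambda>i. u $ i) i = a i" if "i < n" for i
    using arg_cong[OF Au, of "\<lambda>w. w $ i"] that u
    by (simp add: app_def scalar_prod_def lessThan_atLeast0)
  then show thesis using that by blast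
qed

lemma pd_nonneg: "pd n Z \<Longrightarrow> 0 \<le> qf n Z x"
  by (cases "\<exists>i<n. x i \<noteq> 0") (auto simp: pd_def qf_def ip_def less_imp_le)

text \<open>The matrix determinant lemma turns the claim into the Cauchy-Schwarz inequality
  \<open>(a \<bullet> x)\<^sup>2 \<le> (a \<bullet> Z\<^sup>-\<^sup>1 a) (x \<bullet> Z x)\<close>.\<close>

lemma det_qf_rank_one:
  assumes Z: "pd n Z" and pos: "0 < dt n Z"
  shows "dt n Z \<le> dt n (\<lambda>i j. Z i j + a i * a j)"
    and "dt n Z * qf n (\<lambda>i j. Z i j + a i * a j) x \<le> dt n (\<lambda>i j. Z i j + a i * a j) * qf n Z x"
proof -
  obtain u where u: "\<And>i. i < n \<Longrightarrow> app n Z u i = a i" using pd_solve[OF Z] by blast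
  have sym: "sym_fun n Z" using Z by (simp add: pd_def)
  have det: "dt n (\<lambda>i j. Z i j + a i * a j) = dt n Z * (1 + ip n a u)"
    by (rule det_rank_one_update) (rule u)
  have au: "ip n a u = qf n Z u" unfolding qf_def ip_commute[of n a] by (rule ip_cong) (auto simp: u)
  then have "0 \<le> ip n a u" using pd_nonneg[OF Z] by simp
  then show "dt n Z \<le> dt n (\<lambda>i j. Z i j + a i * a j)"
    unfolding det using pos by (simp add: algebra_simps)
  let ?a = "ip n a u" and ?b = "ip n a x" and ?c = "qf n Z x"
  have cs: "?b\<^sup>2 \<le> ?a * ?c"
  proof (cases "\<exists>i<n. u i \<noteq> 0")
    case True
    then have apos: "0 < ?a" using Z unfolding au by (simp add: pd_def)
    have xu: "ip n x (app n Z u) = ?b" unfolding ip_commute[of n a] by (rule ip_cong) (auto simp: u)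
    then have ux: "ip n u (app n Z x) = ?b" using ip_app_sym[OF sym, of u x] ip_commute by metis
    \<comment> \<open>The vector is \<open>?a\<close> times the residual of \<open>x\<close> after
      projection onto \<open>u\<close> in the inner product of \<open>Z\<close>, so its quadratic
      form is \<open>?a\<close> times the Cauchy-Schwarz gap.\<close>
    have "0 \<le> qf n Z (\<lambda>i. ?a * x i - ?b * u i)" by (rule pd_nonneg[OF Z])
    also have "\<dots> = ip n (\<lambda>i. ?a * x i - ?b * u i) (\<lambda>i. ?a * app n Z x i - ?b * app n Z u i)"
      unfolding qf_def app_diff[abs_def] app_scale[abs_def] ..
    also have "\<dots> = ?a * (?a * qf n Z x - ?b * ip n x (app n Z u)) - ?b * (?a * ip n u (app n Z x) - ?b * qf n Z u)"
      unfolding qf_def ip_diff_right ip_scale_right ip_diff_left ip_scale_left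
      by (simp add: algebra_simps)
    also have "\<dots> = ?a * (?a * ?c - ?b\<^sup>2)"
      unfolding xu ux au[symmetric] by (simp add: power2_eq_square algebra_simps)
    finally show ?thesis using apos by (simp add: zero_le_mult_iff)
  next
    case False
    then have "app n Z u i = 0" for i by (simp add: app_def)
    then have "?b = 0" using u by (simp add: ip_def)
    moreover have "0 \<le> ?a * ?c" using pd_nonneg[OF Z] \<open>0 \<le> ip n a u\<close> by simp
    ultimately show ?thesis by simp
  qed
  have "dt n Z * (qf n Z x + (ip n a x)\<^sup>2) \<le> dt n Z * (qf n Z x + ip n a u * qf n Z x)"
    using cs pos by (intro mult_left_mono) auto
  then show "dt n Z * qf n (\<lambda>i j. Z i j + a i * a j) x \<le> dt n (\<lambda>i j. Z i j + a i * a j) * qf n Z x"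
    unfolding det qf_outer by (simp add: algebra_simps)
qed

section \<open>Determinants of shifted suffix Gram matrices\<close>

lemma dt_shift_empty: "dt n (shift \<mu> (\<lambda>i j. 0)) = \<mu> ^ n"
proof -
  have "mat_of n (shift \<mu> (\<lambda>i j. 0)) = \<mu> \<cdot>\<^sub>m 1\<^sub>m n"
    by (rule eq_matI) (auto simp: shift_def)
  then show ?thesis by (simp add: det_smult)
qed

lemma dt_shift_gram_step:
  assumes "\<mu> > 0" "0 < dt n (shift \<mu> (gram r (Suc a) b))"
  shows "dt n (shift \<mu> (gram r (Suc a) b)) \<le> dt n (shift \<mu> (gram r a b))"
    and "dt n (shift \<mu> (gram r (Suc a) b)) * qf n (shift \<mu> (gram r a b)) x
      \<le> dt n (shift \<mu> (gram r a b)) * qf n (shift \<mu> (gram r (Suc a) b)) x"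
  using det_qf_rank_one[OF pd_shift_gram[OF assms(1)] assms(2)]
  by (cases "a < b"; simp add: shift_gram_step gram_empty)+

text \<open>Starting from the empty suffix, rows are added at the front. The positivity that each
  rank-one step requires is supplied by the bound itself.\<close>

lemma dt_shift_gram_ge:
  assumes "\<mu> > 0"
  shows "\<mu> ^ n \<le> dt n (shift \<mu> (gram r a b))"
proof (induction "b - a" arbitrary: a)
  case 0 then show ?case by (simp add: gram_empty dt_shift_empty)
next
  case (Suc k)
  then have IH: "\<mu> ^ n \<le> dt n (shift \<mu> (gram r (Suc a) b))" by simp
  moreover have "0 < \<mu> ^ n" using assms by simp
  ultimately have "0 < dt n (shift \<mu> (gram r (Suc a) b))" by linarith
  from dt_shift_gram_step(1)[OF assms this] IH show ?case by linarith
qed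

lemma dt_shift_gram_pos: "\<mu> > 0 \<Longrightarrow> 0 < dt n (shift \<mu> (gram r a b))"
  using dt_shift_gram_ge[of \<mu> n r a b] zero_less_power[of \<mu> n] by linarith

lemma dt_shift_gram_mono:
  assumes "\<mu> > 0" "a \<le> a'"
  shows "dt n (shift \<mu> (gram r a' b)) \<le> dt n (shift \<mu> (gram r a b))"
  using assms(2)
proof (induction rule: inc_induct)
  case (step a)
  then show ?case
    using dt_shift_gram_step(1)[OF assms(1) dt_shift_gram_pos[OF assms(1)], of n r a b] by linarith
qed simp

text \<open>A telescoping product of the one-row inequalities, from \<open>a\<close> up to
  \<open>a'\<close>. It is cross-multiplied because the quadratic forms vanish at
  \<open>x = 0\<close>; only determinants, which are positive, are cancelled.\<close>

lemma dt_qf_shift_gram: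
  assumes \<mu>: "\<mu> > 0" and "a \<le> a'"
  shows "dt n (shift \<mu> (gram r a' b)) * qf n (shift \<mu> (gram r a b)) x
     \<le> dt n (shift \<mu> (gram r a b)) * qf n (shift \<mu> (gram r a' b)) x"
  using assms(2)
proof (induction rule: inc_induct)
  case (step a)
  let ?d = "\<lambda>a. dt n (shift \<mu> (gram r a b))" and ?q = "\<lambda>a. qf n (shift \<mu> (gram r a b)) x"
  have p: "0 < ?d c" for c by (rule dt_shift_gram_pos[OF \<mu>])
  have "?d (Suc a) * (?d a' * ?q a) = ?d a' * (?d (Suc a) * ?q a)" by simp
  also have "\<dots> \<le> ?d a' * (?d a * ?q (Suc a))"
    using dt_shift_gram_step(2)[OF \<mu> p] p[of a'] by (intro mult_left_mono) auto
  also have "\<dots> = ?d a * (?d a' * ?q (Suc a))" by simp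
  also have "\<dots> \<le> ?d a * (?d (Suc a) * ?q a')"
    using step.IH p[of a] by (intro mult_left_mono) auto
  finally have "?d (Suc a) * (?d a' * ?q a) \<le> ?d (Suc a) * (?d a * ?q a')" by (simp add: ac_simps)
  then show ?case using p[of "Suc a"] by simp
qed simp

lemma loewner_of_dt:
  assumes \<mu>: "\<mu> > 0" and "a \<le> a'"
    and d: "c * dt n (shift \<mu> (gram r a b)) \<le> dt n (shift \<mu> (gram r a' b))"
  shows "c * qf n (shift \<mu> (gram r a b)) x \<le> qf n (shift \<mu> (gram r a' b)) x"
proof -
  let ?d = "\<lambda>a. dt n (shift \<mu> (gram r a b))" and ?q = "\<lambda>a. qf n (shift \<mu> (gram r a b)) x"
  have "?d a * (c * ?q a) = (c * ?d a) * ?q a" by simp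
  also have "\<dots> \<le> ?d a' * ?q a"
    using d pd_nonneg[OF pd_shift_gram[OF \<mu>]] by (rule mult_right_mono)
  also have "\<dots> \<le> ?d a * ?q a'" by (rule dt_qf_shift_gram[OF \<mu> \<open>a \<le> a'\<close>])
  finally show ?thesis using dt_shift_gram_pos[OF \<mu>, of n r a b] by simp
qed

text \<open>Leibniz expansion with \<open>n! \<le> n ^ n\<close>. A sharper bound would gain little,
  since only the logarithm of this one enters the space, and this one can be computed by
  multiplications.\<close>

lemma det_le_of_entries:
  fixes Z :: "nat \<Rightarrow> nat \<Rightarrow> real"
  assumes "\<And>i j. i < n \<Longrightarrow> j < n \<Longrightarrow> \<bar>Z i j\<bar> \<le> B"
  shows "dt n Z \<le> (real n * B) ^ n"
proof (cases "n = 0")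
  case True
  have "mat 0 0 (\<lambda>(i, j). Z i j) = 1\<^sub>m 0" by (rule eq_matI) auto
  then show ?thesis using True by simp
next
  case False
  then have B: "0 \<le> B" using assms[of 0 0] by force
  have "dt n Z = (\<Sum>p | p permutes {0..<n}. signof p * (\<Prod>i = 0..<n. Z i (p i)))"
    by (subst det_def'[of _ n]) (auto intro!: sum.cong prod.cong dest: permutes_in_image)
  also have "\<dots> \<le> (\<Sum>p | p permutes {0..<n}. B ^ n)"
  proof (rule sum_mono)
    fix p assume p: "p \<in> {p. p permutes {0..<n}}"
    have "signof p * (\<Prod>i = 0..<n. Z i (p i)) \<le> \<bar>\<Prod>i = 0..<n. Z i (p i)\<bar>"
      by (auto simp: sign_def)
    also have "\<dots> = (\<Prod>i = 0..<n. \<bar>Z i (p i)\<bar>)" by (rule abs_prod)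
    also have "\<dots> \<le> (\<Prod>i = 0..<n. B)"
    proof (rule prod_mono)
      fix i assume i: "i \<in> {0..<n}"
      then have "p i < n" using p permutes_in_image by fastforce
      then show "0 \<le> \<bar>Z i (p i)\<bar> \<and> \<bar>Z i (p i)\<bar> \<le> B" using assms i by simp
    qed
    finally show "signof p * (\<Prod>i = 0..<n. Z i (p i)) \<le> B ^ n" by simp
  qed
  also have "\<dots> = fact n * B ^ n" by (simp add: card_permutations)
  also have "\<dots> \<le> real n ^ n * B ^ n"
    using fact_le_power[of n, where 'a = real] B by (intro mult_right_mono) auto
  finally show ?thesis by (simp add: power_mult_distrib)
qed

subsection \<open>Gaussian elimination of a positive definite matrix\<close>

text \<open>Row \<open>a\<close> of the current matrix \<open>Z\<close> is \<open>y\<^sup>T A\<close> for some \<open>y\<close> supported on \<open>{0..a}\<close> with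
  \<open>y a = 1\<close>. If the entries left of the pivot vanish, the pivot is the quadratic form of \<open>A\<close> at
  \<open>y\<close>, hence positive.\<close>

definition ge_inv :: "nat \<Rightarrow> (nat \<Rightarrow> nat \<Rightarrow> real) \<Rightarrow> nat \<Rightarrow> nat \<Rightarrow> (nat \<Rightarrow> nat \<Rightarrow> real) \<Rightarrow> bool" where
  "ge_inv n A k i Z \<longleftrightarrow> dt n Z = dt n A
     \<and> (\<forall>a<n. \<exists>y. y a = 1 \<and> (\<forall>l>a. y l = 0) \<and> (\<forall>j<n. Z a j = (\<Sum>l<n. y l * A l j)))
     \<and> (\<forall>a<n. \<forall>j<k. j < a \<longrightarrow> Z a j = 0) \<and> (\<forall>a<n. a < i \<longrightarrow> k < a \<longrightarrow> Z a k = 0)"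

lemma ge_inv_init: "ge_inv n A 0 0 A"
proof -
  have "\<exists>y. y a = 1 \<and> (\<forall>l>a. y l = 0) \<and> (\<forall>j<n. A a j = (\<Sum>l<n. y l * A l j))" if "a < n" for a
    using that by (intro exI[of _ "\<lambda>l. if l = a then 1 else 0"]) (auto simp: if_distrib[of "\<lambda>t. t * _"] cong: if_cong)
  then show ?thesis by (simp add: ge_inv_def)
qed

lemma ge_inv_pivot:
  assumes inv: "ge_inv n A k i Z" and k: "k < n" and A: "pd n A"
  shows "0 < Z k k"
proof -
  obtain y where y: "y k = 1" "\<forall>l>k. y l = 0" "\<forall>j<n. Z k j = (\<Sum>l<n. y l * A l j)"
    using inv k by (auto simp: ge_inv_def)
  have "qf n A y = (\<Sum>j<n. app n A y j * y j)" by (simp add: qf_def ip_def mult.commute)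
  also have "\<dots> = (\<Sum>j<n. Z k j * y j)"
    using y(3) A by (intro sum.cong refl) (auto simp: app_def pd_def sym_fun_def mult.commute)
  \<comment> \<open>Left of the pivot \<open>Z k j\<close> has been eliminated, right of it
    \<open>y j\<close> vanishes by its support.\<close>
  also have "\<dots> = (\<Sum>j<n. if j = k then Z k k else 0)"
  proof (intro sum.cong refl)
    fix j assume "j \<in> {..<n}"
    then show "Z k j * y j = (if j = k then Z k k else 0)"
      using inv y k by (cases j k rule: linorder_cases) (auto simp: ge_inv_def)
  qed
  also have "\<dots> = Z k k" using k by simp
  finally have "qf n A y = Z k k" .
  moreover have "\<exists>i<n. y i \<noteq> 0" using y(1) k by (intro exI[of _ k]) simp
  then have "0 < qf n A y" using A by (simp add: pd_def)
  ultimately show ?thesis by simp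
qed

lemma ge_inv_skip: "ge_inv n A k i Z \<Longrightarrow> i \<le> k \<Longrightarrow> ge_inv n A k (Suc i) Z"
  by (auto simp: ge_inv_def less_Suc_eq)

lemma ge_inv_elim:
  assumes inv: "ge_inv n A k i Z" and ik: "k < i" "i < n" and A: "pd n A"
    and Z': "\<And>a j. a < n \<Longrightarrow> j < n \<Longrightarrow> Z' a j = (if a = i then Z i j - Z i k / Z k k * Z k j else Z a j)"
  shows "ge_inv n A k (Suc i) Z'"
proof -
  have piv: "Z k k \<noteq> 0" using ge_inv_pivot[OF inv _ A] ik by force
  have "mat_of n Z' = addrow (- (Z i k / Z k k)) i k (mat_of n Z)"
    using ik by (intro eq_matI) (auto simp: Z' mat_addrow_def)
  then have "dt n Z' = dt n Z" using det_addrow[of k n i "mat_of n Z"] ik by simp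
  moreover have "\<exists>y. y a = 1 \<and> (\<forall>l>a. y l = 0) \<and> (\<forall>j<n. Z' a j = (\<Sum>l<n. y l * A l j))"
    if a: "a < n" for a
  proof (cases "a = i")
    case True
    obtain y where y: "y i = 1" "\<forall>l>i. y l = 0" "\<forall>j<n. Z i j = (\<Sum>l<n. y l * A l j)"
      using inv ik unfolding ge_inv_def by blast
    obtain x where x: "x k = 1" "\<forall>l>k. x l = 0" "\<forall>j<n. Z k j = (\<Sum>l<n. x l * A l j)"
      using inv less_trans[OF ik] unfolding ge_inv_def by blast
    define f where "f = Z i k / Z k k"
    have "Z' i j = (\<Sum>l<n. (y l - f * x l) * A l j)" if "j < n" for j
    proof -
      have "Z' i j = Z i j - f * Z k j" using that ik by (simp add: Z' f_def)
      also have "\<dots> = (\<Sum>l<n. y l * A l j) - f * (\<Sum>l<n. x l * A l j)"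
        using that x(3) y(3) by metis
      finally show ?thesis by (simp add: algebra_simps sum_subtractf sum_distrib_left)
    qed
    \<comment> \<open>The coefficients \<open>x\<close> of the pivot row vanish beyond
      \<open>k < i\<close>, so subtracting a multiple of them changes neither the entry 1 at
      \<open>i\<close> nor the support bound.\<close>
    then show ?thesis using x y ik True
      by (intro exI[of _ "\<lambda>l. y l - f * x l"]) auto
  next
    case False
    then show ?thesis using inv a by (simp add: ge_inv_def Z')
  qed
  moreover have "\<forall>a<n. \<forall>j<k. j < a \<longrightarrow> Z' a j = 0"
    using inv ik by (auto simp: ge_inv_def Z')
  moreover have "\<forall>a<n. a < Suc i \<longrightarrow> k < a \<longrightarrow> Z' a k = 0"
    using inv ik piv by (auto simp: ge_inv_def Z' less_Suc_eq)
  ultimately show ?thesis using inv by (simp add: ge_inv_def)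
qed

lemma ge_inv_next: "ge_inv n A k n Z \<Longrightarrow> ge_inv n A (Suc k) 0 Z"
  by (auto simp: ge_inv_def less_Suc_eq)

lemma ge_inv_final:
  assumes "ge_inv n A n 0 Z"
  shows "dt n A = (\<Prod>j<n. Z j j)"
proof -
  have "upper_triangular (mat_of n Z)" using assms by (auto simp: ge_inv_def upper_triangular_def)
  then have "dt n Z = prod_list (diag_mat (mat_of n Z))" by (rule det_upper_triangular[where n = n]) simp
  also have "\<dots> = (\<Prod>j<n. Z j j)"
    by (simp add: diag_mat_def prod.list_conv_set_nth lessThan_atLeast0)
  finally show ?thesis using assms by (simp add: ge_inv_def)
qed

section \<open>The list of stored times\<close>

text \<open>The last argument is the answer if no stored time lies in the window; for the current
  time it denotes the empty suffix. Leaving it variable makes \<open>sel\<close> compose along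
  concatenation.\<close>

primrec sel :: "nat \<Rightarrow> nat list \<Rightarrow> nat \<Rightarrow> nat" where
  "sel w [] t = t"
| "sel w (\<tau> # I) t = (if w \<le> \<tau> then \<tau> else sel w I t)"

definition dtime :: "nat \<Rightarrow> real \<Rightarrow> (nat \<Rightarrow> nat \<Rightarrow> real) \<Rightarrow> nat \<Rightarrow> nat \<Rightarrow> real" where
  "dtime n \<mu> r t \<tau> = dt n (shift \<mu> (gram r \<tau> t))"

definition qtime :: "nat \<Rightarrow> real \<Rightarrow> (nat \<Rightarrow> nat \<Rightarrow> real) \<Rightarrow> nat \<Rightarrow> nat \<Rightarrow> (nat \<Rightarrow> real) \<Rightarrow> real" where
  "qtime n \<mu> r t \<tau> x = qf n (shift \<mu> (gram r \<tau> t)) x"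

text \<open>Windows of shifted determinant above \<open>cap\<close> are never queried; all others are approximated
  by the first stored suffix inside them.\<close>

definition covers :: "nat \<Rightarrow> real \<Rightarrow> real \<Rightarrow> real \<Rightarrow> (nat \<Rightarrow> nat \<Rightarrow> real) \<Rightarrow> nat \<Rightarrow> nat list \<Rightarrow> bool" where
  "covers n \<mu> cap e r t I \<longleftrightarrow> sorted_wrt (<) I \<and> (\<forall>\<tau>\<in>set I. \<tau> < t) \<and>
     (\<forall>w\<le>t. cap < dtime n \<mu> r t w \<or>
       (\<forall>x. (1 - e) * qtime n \<mu> r t w x \<le> qtime n \<mu> r t (sel w I t) x))"

text \<open>The list is a stack with the latest time on top. A time can only be judged when its
  later neighbour is known, so the arrival of \<open>i\<close> decides about the top
  \<open>c\<close>, whose other neighbour is \<open>a\<close>.\<close>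

fun push :: "(nat \<Rightarrow> real) \<Rightarrow> real \<Rightarrow> real \<Rightarrow> nat \<Rightarrow> nat list \<Rightarrow> nat list" where
  "push d cap e i (c # a # s) = (if cap < d i then c # a # s
     else if (1 - e) * d a \<le> d i then i # a # s else i # c # a # s)"
| "push d cap e i s = (if cap < d i then s else i # s)"

definition spaced :: "(nat \<Rightarrow> real) \<Rightarrow> real \<Rightarrow> real \<Rightarrow> nat list \<Rightarrow> bool" where
  "spaced d cap e s \<longleftrightarrow> (\<forall>x\<in>set s. d x \<le> cap) \<and>
     (\<forall>j. j + 2 < length s \<longrightarrow> d (s ! j) < (1 - e) * d (s ! (j + 2)))"

lemma sel_append: "sel w (I @ J) t = sel w I (sel w J t)"
  by (induction I) auto

lemma sel_ge: "w \<le> t \<Longrightarrow> w \<le> sel w I t"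
  by (induction I) auto

lemma sel_le: "\<forall>\<tau>\<in>set I. \<tau> < t \<Longrightarrow> sel w I t \<le> t"
  by (induction I) (auto simp: less_imp_le)

lemma sel_default: "(\<forall>x. sel w I x = x) \<or> (\<forall>x y. sel w I x = sel w I y)"
  by (induction I) auto

lemma sel_in: "sel w I t = t \<or> sel w I t \<in> set I"
  by (induction I) auto

lemma dtime_mono: "\<mu> > 0 \<Longrightarrow> a \<le> a' \<Longrightarrow> dtime n \<mu> r t a' \<le> dtime n \<mu> r t a"
  unfolding dtime_def by (rule dt_shift_gram_mono)

lemma qtime_mono: "a \<le> a' \<Longrightarrow> qtime n \<mu> r t a' x \<le> qtime n \<mu> r t a x"
  unfolding qtime_def qf_shift using qf_gram_mono[of a a' n r t x] by simp

lemma dtime_Suc_ge: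
  assumes "\<mu> > 0" "w \<le> t"
  shows "dtime n \<mu> r t w \<le> dtime n \<mu> r (Suc t) w"
proof -
  have "shift \<mu> (gram r w (Suc t)) = (\<lambda>i j. shift \<mu> (gram r w t) i j + r t i * r t j)"
    using assms by (simp add: gram_Suc shift_def fun_eq_iff)
  then show ?thesis unfolding dtime_def
    using det_qf_rank_one(1)[OF pd_shift_gram[OF assms(1)] dt_shift_gram_pos[OF assms(1)], where a = "r t"] by (simp only:)
qed

lemma qtime_Suc:
  assumes "w \<le> t"
  shows "qtime n \<mu> r (Suc t) w x = qtime n \<mu> r t w x + (ip n (r t) x)\<^sup>2"
  unfolding qtime_def qf_shift gram_Suc[OF assms] qf_outer by simp

lemma covers_Nil: "covers n \<mu> cap e r 0 []" if "e \<ge> 0" "\<mu> > 0"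
proof -
  have "(1 - e) * qtime n \<mu> r 0 0 x \<le> qtime n \<mu> r 0 0 x" for x
    using mult_right_mono[of "1 - e" 1 "qtime n \<mu> r 0 0 x"] pd_nonneg[OF pd_shift_gram[OF that(2)]] that(1)
    by (simp add: qtime_def)
  then show ?thesis by (simp add: covers_def)
qed

text \<open>A new row adds the same square to both quadratic forms, weighted by
  \<open>1 - e \<le> 1\<close> on the smaller side; a determinant above the cap stays there. The
  only new start, \<open>Suc t\<close>, is the empty window.\<close>

lemma covers_row:
  assumes cov: "covers n \<mu> cap e r t I" and e: "0 \<le> e" and \<mu>: "\<mu> > 0"
  shows "covers n \<mu> cap e r (Suc t) (I @ [t])"
  unfolding covers_def
proof (intro conjI allI impI)
  show "sorted_wrt (<) (I @ [t])" "\<forall>\<tau>\<in>set (I @ [t]). \<tau> < Suc t"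
    using cov by (auto simp: covers_def sorted_wrt_append)
next
  fix w assume w: "w \<le> Suc t"
  show "cap < dtime n \<mu> r (Suc t) w \<or>
    (\<forall>x. (1 - e) * qtime n \<mu> r (Suc t) w x \<le> qtime n \<mu> r (Suc t) (sel w (I @ [t]) (Suc t)) x)"
  proof (cases "w \<le> t")
    case True
    let ?s = "sel w I t"
    have s: "sel w (I @ [t]) (Suc t) = ?s" using True by (simp add: sel_append)
    have le: "?s \<le> t" using cov by (intro sel_le) (simp add: covers_def)
    from cov True consider "cap < dtime n \<mu> r t w"
      | "\<forall>x. (1 - e) * qtime n \<mu> r t w x \<le> qtime n \<mu> r t ?s x" unfolding covers_def by blast
    then show ?thesis
    proof cases
      case 1 then show ?thesis using dtime_Suc_ge[OF \<mu> True, of n r] by linarith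
    next
      case 2
      have "(1 - e) * qtime n \<mu> r (Suc t) w x \<le> qtime n \<mu> r (Suc t) ?s x" for x
      proof -
        have "(1 - e) * (ip n (r t) x)\<^sup>2 \<le> (ip n (r t) x)\<^sup>2"
          using e mult_right_mono[of "1 - e" 1 "(ip n (r t) x)\<^sup>2"] by simp
        then show ?thesis using 2[rule_format, of x]
          unfolding qtime_Suc[OF True] qtime_Suc[OF le] by (simp add: distrib_left)
      qed
      then show ?thesis unfolding s by blast
    qed
  next
    case False
    have "sel w (I @ [t]) (Suc t) = Suc t"
      using sel_in[of w "I @ [t]" "Suc t"] sel_ge[OF w, of "I @ [t]"] False cov
      by (auto simp: covers_def dest!: bspec)
    moreover have "w = Suc t" using False w by simp
    moreover have "(1 - e) * q \<le> q" if "0 \<le> q" for q :: real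
      using mult_right_mono[of "1 - e" 1 q] that e by simp
    ultimately show ?thesis using pd_nonneg[OF pd_shift_gram[OF \<mu>]] by (simp add: qtime_def)
  qed
qed

section \<open>One step of dropping: coverage and spacing\<close>

lemma push_cases [case_names drop replace keep]:
  assumes "cap < d i \<Longrightarrow> push d cap e i s = s \<Longrightarrow> thesis"
    and "\<And>c a s'. s = c # a # s' \<Longrightarrow> d i \<le> cap \<Longrightarrow> (1 - e) * d a \<le> d i \<Longrightarrow>
      push d cap e i s = i # a # s' \<Longrightarrow> thesis"
    and "push d cap e i s = i # s \<Longrightarrow> d i \<le> cap \<Longrightarrow>
      (\<And>c a s'. s = c # a # s' \<Longrightarrow> d i < (1 - e) * d a) \<Longrightarrow> thesis"
  shows thesis
proof (cases "cap < d i")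
  case True
  then show ?thesis using assms(1) by (cases "(d, cap, e, i, s)" rule: push.cases) auto
next
  case False
  show ?thesis
  proof (cases "\<exists>c a s'. s = c # a # s' \<and> (1 - e) * d a \<le> d i")
    case True
    then show ?thesis using False assms(2) by auto
  next
    case nr: False
    then have "push d cap e i s = i # s"
      using False by (cases "(d, cap, e, i, s)" rule: push.cases) auto
    then show ?thesis using False assms(3) nr by (meson linorder_not_less)
  qed
qed

text \<open>\<open>J\<close> holds the times still to be processed. If \<open>i\<close> is dropped,
  every start up to \<open>i\<close> has a determinant above the cap and later starts are answered
  as before. If \<open>i\<close> replaces \<open>c\<close>, only starts in \<open>(a, c]\<close>
  change their answer; their forms lie below that of \<open>a\<close>, and \<open>i\<close>
  approximates \<open>a\<close> by the determinant test.\<close>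

lemma covers_push:
  assumes cov: "covers n \<mu> cap e r t (rev s @ i # J)" and e: "0 \<le> e" "e \<le> 1" and \<mu>: "\<mu> > 0"
  shows "covers n \<mu> cap e r t (rev (push (dtime n \<mu> r t) cap e i s) @ J)"
proof -
  let ?d = "dtime n \<mu> r t"
  have srt: "sorted_wrt (<) (rev s @ i # J)" and lt: "\<forall>\<tau>\<in>set (rev s @ i # J). \<tau> < t"
    and ap: "\<And>w. w \<le> t \<Longrightarrow> cap < ?d w \<or>
       (\<forall>x. (1 - e) * qtime n \<mu> r t w x \<le> qtime n \<mu> r t (sel w (rev s @ i # J) t) x)"
    using cov by (auto simp: covers_def)
  show ?thesis
  proof (cases rule: push_cases[where cap = cap and d = ?d and i = i and e = e and s = s])
    case drop
    have "cap < ?d w \<or> (\<forall>x. (1 - e) * qtime n \<mu> r t w x \<le> qtime n \<mu> r t (sel w (rev s @ J) t) x)"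
      if w: "w \<le> t" for w
    proof (cases "w \<le> i")
      case True
      then show ?thesis using dtime_mono[OF \<mu> True, of n r t] drop by linarith
    next
      case False
      then show ?thesis using ap[OF w] by (simp add: sel_append)
    qed
    then show ?thesis using srt lt drop by (auto simp: covers_def sorted_wrt_append)
  next
    case (replace c a s')
    have ord: "a < c" "c < i" using srt replace(1) by (auto simp: sorted_wrt_append)
    have "cap < ?d w \<or> (\<forall>x. (1 - e) * qtime n \<mu> r t w x
        \<le> qtime n \<mu> r t (sel w (rev (i # a # s') @ J) t) x)" if w: "w \<le> t" for w
    \<comment> \<open>The last conjunct says that nothing before \<open>a\<close> is selected. In
      the complementary case \<open>sel_default\<close> shows that the answer is unchanged.\<close>
    proof (cases "a < w \<and> w \<le> c \<and> sel w (rev s') i = i")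
      case True
      have "(1 - e) * qtime n \<mu> r t w x \<le> qtime n \<mu> r t i x" for x
      proof -
        have "(1 - e) * qtime n \<mu> r t w x \<le> (1 - e) * qtime n \<mu> r t a x"
          using True e qtime_mono[of a w] by (intro mult_left_mono) auto
        also have "\<dots> \<le> qtime n \<mu> r t i x"
          using loewner_of_dt[OF \<mu>, of a i "1 - e" n r t x] replace(3) ord
          by (simp add: dtime_def qtime_def)
        finally show ?thesis .
      qed
      moreover have "sel w (rev (i # a # s') @ J) t = i" using True ord by (simp add: sel_append)
      ultimately show ?thesis by simp
    next
      case False
      have "(\<forall>x. sel w (rev s') x = x) \<or> (\<forall>x y. sel w (rev s') x = sel w (rev s') y)"
        by (rule sel_default)
      then have "sel w (rev s @ i # J) t = sel w (rev (i # a # s') @ J) t"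
        using False ord replace(1) by (auto simp: sel_append)
      then show ?thesis using ap[OF w] by simp
    qed
    then show ?thesis using srt lt replace by (auto simp: covers_def sorted_wrt_append)
  next
    case keep
    then show ?thesis using cov by simp
  qed
qed

text \<open>When \<open>i\<close> replaces the top \<open>c\<close>, it inherits the inequality that
  \<open>c\<close> satisfied, because \<open>d i \<le> d c\<close>; hence one removal per push is
  enough.\<close>

lemma spaced_push:
  assumes sp: "spaced d cap e s" and mono: "\<And>a b. a \<le> b \<Longrightarrow> d b \<le> d a"
    and srt: "sorted_wrt (<) (rev s @ [i])"
  shows "spaced d cap e (push d cap e i s)"
proof -
  show ?thesis
  proof (cases rule: push_cases[where cap = cap and d = d and i = i and e = e and s = s])
    case drop then show ?thesis using sp by simp
  next
    case (replace c a s')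
    have "d i \<le> d c" using srt replace(1) by (intro mono) (auto simp: sorted_wrt_append)
    have "d ((i # a # s') ! j) < (1 - e) * d ((i # a # s') ! (j + 2))"
      if "j + 2 < length (i # a # s')" for j
    proof -
      have "d (s ! j) < (1 - e) * d (s ! (j + 2))" using sp that replace(1) by (simp add: spaced_def)
      then show ?thesis using replace(1) \<open>d i \<le> d c\<close> by (cases j) auto
    qed
    then show ?thesis using sp replace by (auto simp: spaced_def)
  next
    case keep
    have "d ((i # s) ! j) < (1 - e) * d ((i # s) ! (j + 2))" if "j + 2 < length (i # s)" for j
    proof (cases j)
      case 0
      then obtain c a s' where "s = c # a # s'" using \<open>j + 2 < length (i # s)\<close>
        by (cases s rule: remdups_adj.cases) auto
      then show ?thesis using keep(3) 0 by simp
    next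
      case (Suc j')
      then show ?thesis using sp that by (simp add: spaced_def)
    qed
    then show ?thesis using sp keep by (auto simp: spaced_def)
  qed
qed

section \<open>Counting the times that survive\<close>

lemma spaced_power:
  assumes sp: "spaced d cap e s" and e: "0 \<le> e" "e < 1"
  shows "2 * j < length s \<Longrightarrow> d (s ! 0) \<le> (1 - e) ^ j * cap"
proof -
  have "2 * j < length s \<Longrightarrow> d (s ! 0) \<le> (1 - e) ^ j * d (s ! (2 * j))"
  proof (induction j)
    case (Suc j)
    have "d (s ! (2 * j)) \<le> (1 - e) * d (s ! (2 * Suc j))"
      using sp Suc.prems by (auto simp: spaced_def intro: less_imp_le)
    then have "(1 - e) ^ j * d (s ! (2 * j)) \<le> (1 - e) ^ j * ((1 - e) * d (s ! (2 * Suc j)))"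
      using e by (intro mult_left_mono) auto
    then show ?case using Suc by (simp add: ac_simps)
  qed simp
  then show "2 * j < length s \<Longrightarrow> d (s ! 0) \<le> (1 - e) ^ j * cap"
  proof -
    assume j: "2 * j < length s"
    then have "d (s ! (2 * j)) \<le> cap" using sp by (auto simp: spaced_def)
    then have "(1 - e) ^ j * d (s ! (2 * j)) \<le> (1 - e) ^ j * cap"
      using e by (intro mult_left_mono) auto
    then show ?thesis using \<open>2 * j < length s \<Longrightarrow> d (s ! 0) \<le> (1 - e) ^ j * d (s ! (2 * j))\<close> j by linarith
  qed
qed

text \<open>Logarithms of \<open>lo \<le> (1 - e) ^ j * cap\<close> together with
  \<open>ln (1 - e) \<le> - e\<close>. Here \<open>j\<close> is the largest number such that
  position \<open>2 * j\<close> exists; rounding costs the additive 2.\<close>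

lemma length_spaced:
  assumes sp: "spaced d cap e s" and e: "0 < e" "e < 1"
    and lo: "\<And>x. lo \<le> d x" and "0 < lo" and "lo \<le> cap"
  shows "e * real (length s) \<le> 2 + 2 * ln (cap / lo)"
proof (cases "s = []")
  case True
  then show ?thesis using \<open>0 < lo\<close> \<open>lo \<le> cap\<close> by simp
next
  case False
  define j where "j = (length s - 1) div 2"
  have j: "2 * j < length s" "length s \<le> 2 * j + 2"
    using False by (cases s; simp add: j_def less_Suc_eq_le; fail)+
  have ineq: "lo \<le> (1 - e) ^ j * cap" using spaced_power[OF sp _ _ j(1)] e lo[of "s ! 0"] by simp
  have pw: "0 < (1 - e) ^ j" using e by simp
  have cap: "0 < cap" using ineq \<open>0 < lo\<close> pw by (meson less_le_trans zero_less_mult_pos)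
  have "ln lo \<le> ln ((1 - e) ^ j * cap)" using ineq \<open>0 < lo\<close> by simp
  also have "\<dots> = real j * ln (1 - e) + ln cap" using pw cap e by (simp add: ln_mult ln_realpow)
  also have "\<dots> \<le> real j * (- e) + ln cap"
    using ln_add_one_self_le_self2[of "- e"] e by (intro add_right_mono mult_left_mono) auto
  finally have "e * real j \<le> ln (cap / lo)" using cap \<open>0 < lo\<close> by (simp add: ln_div algebra_simps)
  moreover have "e * real (length s) \<le> e * (2 * real j + 2)" using j(2) e by (intro mult_left_mono) auto
  ultimately show ?thesis using e by (simp add: algebra_simps)
qed

lemma length_push: "length (push d cap e i s) \<le> Suc (length s)"
  by (cases "(d, cap, e, i, s)" rule: push.cases) auto

text \<open>Times are processed from the oldest on and end up newest first, hence the
  \<open>rev\<close> wherever the result is again a list of stored times.\<close>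

definition compress :: "(nat \<Rightarrow> real) \<Rightarrow> real \<Rightarrow> real \<Rightarrow> nat list \<Rightarrow> nat list" where
  "compress d cap e I = fold (push d cap e) I []"

lemma compress_snoc: "compress d cap e (I @ [i]) = push d cap e i (compress d cap e I)"
  by (simp add: compress_def)

lemma length_compress: "length (compress d cap e I) \<le> length I"
proof (induction I rule: rev_induct)
  case (snoc i I)
  then show ?case using length_push[of d cap e i "compress d cap e I"] by (simp add: compress_snoc)
qed (simp add: compress_def)

text \<open>Generalizing over the unprocessed tail \<open>J\<close> makes coverage meaningful
  halfway: at each stage the stack, reversed, followed by \<open>J\<close> is a valid list of stored
  times.\<close>

lemma compress_invariant:
  assumes cov: "covers n \<mu> cap e r t (I @ J)" and e: "0 \<le> e" "e \<le> 1" and \<mu>: "\<mu> > 0"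
  shows "covers n \<mu> cap e r t (rev (compress (dtime n \<mu> r t) cap e I) @ J)
    \<and> spaced (dtime n \<mu> r t) cap e (compress (dtime n \<mu> r t) cap e I)"
  using cov
proof (induction I arbitrary: J rule: rev_induct)
  case Nil then show ?case by (simp add: compress_def spaced_def)
next
  case (snoc i I)
  let ?s = "compress (dtime n \<mu> r t) cap e I"
  have IH: "covers n \<mu> cap e r t (rev ?s @ i # J)" "spaced (dtime n \<mu> r t) cap e ?s"
    using snoc.IH[of "i # J"] snoc.prems by auto
  have "sorted_wrt (<) (rev ?s @ [i])" using IH(1) by (auto simp: covers_def sorted_wrt_append)
  then show ?case unfolding compress_snoc
    using covers_push[OF IH(1) e \<mu>] spaced_push[OF IH(2) dtime_mono[OF \<mu>]] by blast
qed

section \<open>Reasoning about programs\<close>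

text \<open>Execution is deterministic, so existence of a run is total correctness. The
  postcondition receives the step count, and cost and result are proved together.\<close>

definition wp :: "cmd \<Rightarrow> state \<Rightarrow> (nat \<Rightarrow> state \<Rightarrow> bool) \<Rightarrow> bool" where
  "wp c st Q \<longleftrightarrow> (\<exists>k st'. exec c st k st' \<and> Q k st')"

lemma wp_Skip: "wp Skip st Q \<longleftrightarrow> Q 1 st"
  unfolding wp_def by (auto simp: exec.simps[of "Skip"])

lemma wp_NSet: "wp (NSet x e) st Q \<longleftrightarrow> Q 1 (st\<lparr>nreg := (nreg st)(x := nval e st)\<rparr>)"
  unfolding wp_def by (auto simp: exec.simps[of "NSet x e"])

lemma wp_RSet: "wp (RSet x e) st Q \<longleftrightarrow> Q 1 (st\<lparr>rreg := (rreg st)(x := rval e st)\<rparr>)"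
  unfolding wp_def by (auto simp: exec.simps[of "RSet x e"])

lemma wp_Load: "wp (Load x a) st Q \<longleftrightarrow> nval a st < length (memory st) \<and>
    Q 1 (st\<lparr>rreg := (rreg st)(x := memory st ! nval a st)\<rparr>)"
  unfolding wp_def by (auto simp: exec.simps[of "Load x a"])

lemma wp_Store: "wp (Store a e) st Q \<longleftrightarrow> nval a st < length (memory st) \<and>
    Q 1 (st\<lparr>memory := (memory st)[nval a st := rval e st]\<rparr>)"
  unfolding wp_def by (auto simp: exec.simps[of "Store a e"])

lemma wp_ReadRow: "wp (ReadRow x a) st Q \<longleftrightarrow> nval a st < dim_vec (input_row st) \<and>
    Q 1 (st\<lparr>rreg := (rreg st)(x := input_row st $ nval a st)\<rparr>)"
  unfolding wp_def by (auto simp: exec.simps[of "ReadRow x a"])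

lemma wp_Emit: "wp (Emit e) st Q \<longleftrightarrow> Q 1 (st\<lparr>out_tape := out_tape st @ [rval e st]\<rparr>)"
  unfolding wp_def by (auto simp: exec.simps[of "Emit e"])

lemma wp_Seq: "wp (Seq c1 c2) st Q \<longleftrightarrow> wp c1 st (\<lambda>k s. wp c2 s (\<lambda>k'. Q (k + k')))"
  unfolding wp_def by (simp add: exec.simps[of "Seq c1 c2"]) blast

lemma wp_Cond: "wp (Cond b c1 c2) st Q \<longleftrightarrow>
    (if bval b st then wp c1 st (\<lambda>k. Q (k + 1)) else wp c2 st (\<lambda>k. Q (k + 1)))"
  unfolding wp_def by (auto simp: exec.simps[of "Cond b c1 c2"])

lemmas wp_simps = wp_Skip wp_NSet wp_RSet wp_Load wp_Store wp_ReadRow wp_Emit wp_Seq wp_Cond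

lemma wp_mono: "wp c st Q \<Longrightarrow> (\<And>k s. Q k s \<Longrightarrow> Q' k s) \<Longrightarrow> wp c st Q'"
  unfolding wp_def by blast

subsection \<open>Frames\<close>

text \<open>The index registers that a command may write, read off its text; \<open>rw\<close> does
  the same for real registers. Through \<open>eff\<close> this gives the frame conditions of every
  specification.\<close>

primrec nw :: "cmd \<Rightarrow> nat set" where
  "nw Skip = {}" | "nw (NSet x e) = {x}" | "nw (RSet x e) = {}" | "nw (Load x a) = {}"
| "nw (Store a e) = {}" | "nw (ReadRow x a) = {}" | "nw (Emit e) = {}"
| "nw (Seq c1 c2) = nw c1 \<union> nw c2" | "nw (Cond b c1 c2) = nw c1 \<union> nw c2" | "nw (While b c) = nw c"

primrec rw :: "cmd \<Rightarrow> nat set" where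
  "rw Skip = {}" | "rw (NSet x e) = {}" | "rw (RSet x e) = {x}" | "rw (Load x a) = {x}"
| "rw (Store a e) = {}" | "rw (ReadRow x a) = {x}" | "rw (Emit e) = {}"
| "rw (Seq c1 c2) = rw c1 \<union> rw c2" | "rw (Cond b c1 c2) = rw c1 \<union> rw c2" | "rw (While b c) = rw c"

primrec emits :: "cmd \<Rightarrow> bool" where
  "emits Skip = False" | "emits (NSet x e) = False" | "emits (RSet x e) = False"
| "emits (Load x a) = False" | "emits (Store a e) = False" | "emits (ReadRow x a) = False"
| "emits (Emit e) = True" | "emits (Seq c1 c2) = (emits c1 \<or> emits c2)"
| "emits (Cond b c1 c2) = (emits c1 \<or> emits c2)" | "emits (While b c) = emits c"

primrec stores :: "cmd \<Rightarrow> bool" where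
  "stores Skip = False" | "stores (NSet x e) = False" | "stores (RSet x e) = False"
| "stores (Load x a) = False" | "stores (Store a e) = True" | "stores (ReadRow x a) = False"
| "stores (Emit e) = False" | "stores (Seq c1 c2) = (stores c1 \<or> stores c2)"
| "stores (Cond b c1 c2) = (stores c1 \<or> stores c2)" | "stores (While b c) = stores c"

definition eff :: "cmd \<Rightarrow> state \<Rightarrow> state \<Rightarrow> bool" where
  "eff c st s \<longleftrightarrow> (\<forall>x. x \<notin> nw c \<longrightarrow> nreg s x = nreg st x) \<and> (\<forall>x. x \<notin> rw c \<longrightarrow> rreg s x = rreg st x)
     \<and> input_row s = input_row st \<and> length (memory s) = length (memory st)
     \<and> (\<not> emits c \<longrightarrow> out_tape s = out_tape st) \<and> (\<not> stores c \<longrightarrow> memory s = memory st)"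

lemma exec_eff: "exec c st k s \<Longrightarrow> eff c st s"
  by (induction rule: exec.induct) (auto simp: eff_def)

lemma wp_eff: "wp c st Q \<Longrightarrow> wp c st (\<lambda>k s. Q k s \<and> eff c st s)"
  unfolding wp_def using exec_eff by blast

lemma wp_use:
  assumes "wp c st Q" "\<And>k s. Q k s \<Longrightarrow> eff c st s \<Longrightarrow> Q' k s"
  shows "wp c st Q'"
  using wp_mono[OF wp_eff[OF assms(1)]] assms(2) by blast

subsection \<open>Counting loops\<close>

definition For :: "nat \<Rightarrow> nexp \<Rightarrow> cmd \<Rightarrow> cmd" where
  "For x e c = Seq (NSet x (NConst 0))
     (While (NLess (NReg x) e) (Seq c (NSet x (NAdd (NReg x) (NConst 1)))))"

lemma For_effects [simp]: "nw (For x e c) = insert x (nw c)" "rw (For x e c) = rw c"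
  "emits (For x e c) = emits c" "stores (For x e c) = stores c"
  by (auto simp: For_def)

text \<open>The frame of the whole loop is available for the bound, the body and the exit, so
  invariants mention only what changes. Each round costs 2 beyond the body, for the test and the
  increment; the final 2 are the initialization and the failing test.\<close>

lemma wp_For:
  assumes N: "\<And>s. eff (For x e c) st s \<Longrightarrow> nval e s = N"
    and x: "x \<notin> nw c"
    and init: "I 0 (st\<lparr>nreg := (nreg st)(x := 0)\<rparr>)"
    and body: "\<And>i s. i < N \<Longrightarrow> I i s \<Longrightarrow> nreg s x = i \<Longrightarrow> eff (For x e c) st s \<Longrightarrow>
       wp c s (\<lambda>k s'. k \<le> K \<and> I (Suc i) (s'\<lparr>nreg := (nreg s')(x := Suc i)\<rparr>))"
    and post: "\<And>k s. k \<le> N * (K + 2) + 2 \<Longrightarrow> I N s \<Longrightarrow> eff (For x e c) st s \<Longrightarrow> Q k s"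
  shows "wp (For x e c) st Q"
proof -
  let ?b = "NLess (NReg x) e" and ?c = "Seq c (NSet x (NAdd (NReg x) (NConst 1)))"
  have loop: "\<exists>k s'. exec (While ?b ?c) s k s' \<and> k \<le> d * (K + 2) + 1 \<and> I N s' \<and> eff (For x e c) st s'"
    if "d \<le> N" "I (N - d) s" "nreg s x = N - d" "eff (For x e c) st s" for d s
    using that
  proof (induction d arbitrary: s)
    case 0
    then have "\<not> bval ?b s" using N by simp
    then have "exec (While ?b ?c) s 1 s" by (rule exec_WhileFalse)
    then show ?case using 0 by (intro exI[of _ 1] exI[of _ s]) simp
  next
    case (Suc d)
    let ?i = "N - Suc d"
    have i: "?i < N" "Suc ?i = N - d" using Suc.prems(1) by auto
    obtain k1 s1 where s1: "exec c s k1 s1" "k1 \<le> K" "I (Suc ?i) (s1\<lparr>nreg := (nreg s1)(x := Suc ?i)\<rparr>)"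
      using body[OF i(1) Suc.prems(2,3,4)] by (auto simp: wp_def)
    have e1: "eff c s s1" using exec_eff[OF s1(1)] .
    let ?s2 = "s1\<lparr>nreg := (nreg s1)(x := Suc ?i)\<rparr>"
    have "nreg s1 x = ?i" using e1 x Suc.prems(3) by (simp add: eff_def)
    then have step: "exec ?c s (k1 + 1) ?s2"
      using exec_Seq[OF s1(1) exec_NSet[of x "NAdd (NReg x) (NConst 1)" s1]] by simp
    have eff2: "eff (For x e c) st ?s2" using e1 Suc.prems(4) by (auto simp: eff_def)
    obtain k2 s' where s': "exec (While ?b ?c) ?s2 k2 s'" "k2 \<le> d * (K + 2) + 1" "I N s'"
      "eff (For x e c) st s'"
      using Suc.IH[of ?s2] s1(3) eff2 Suc.prems(1) i(2) by auto
    have "bval ?b s" using N[OF Suc.prems(4)] Suc.prems(3) i by simp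
    from exec_WhileTrue[OF this step s'(1)]
    have "exec (While ?b ?c) s (k1 + 1 + k2 + 1) s'" .
    then show ?case using s' s1(2) by (intro exI[of _ "k1 + 1 + k2 + 1"] exI[of _ s']) simp
  qed
  let ?s0 = "st\<lparr>nreg := (nreg st)(x := 0)\<rparr>"
  have "eff (For x e c) st ?s0" by (simp add: eff_def)
  then obtain k s' where *: "exec (While ?b ?c) ?s0 k s'" "k \<le> N * (K + 2) + 1" "I N s'"
      "eff (For x e c) st s'"
    using loop[of N ?s0] init by auto
  have "exec (For x e c) st (1 + k) s'"
    unfolding For_def using exec_Seq[OF exec_NSet[of x "NConst 0" st]] *(1) by simp
  then show ?thesis unfolding wp_def using post[of "1 + k" s'] * by auto
qed

subsection \<open>Slots\<close>

text \<open>The memory is divided into slots of \<open>n\<^sup>2 + 1\<close> words: the entries of an \<open>n \<times> n\<close> matrix, row by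
  row, followed by a time stamp.\<close>

definition adr :: "nat \<Rightarrow> nat \<Rightarrow> nat \<Rightarrow> nat" where
  "adr n b w = b * (n * n + 1) + w"

definition slot :: "nat \<Rightarrow> real list \<Rightarrow> nat \<Rightarrow> nat \<Rightarrow> real" where
  "slot n M b w = M ! adr n b w"

lemma adr_eq_iff:
  assumes "w \<le> n * n" "w' \<le> n * n"
  shows "adr n b w = adr n b' w' \<longleftrightarrow> b = b' \<and> w = w'"
proof
  assume eq: "adr n b w = adr n b' w'"
  have "(c * d + v) div d = c" if "v < d" for c d v :: nat using that by simp
  then have "adr n b w div (n * n + 1) = b" "adr n b' w' div (n * n + 1) = b'"
    using assms unfolding adr_def by (metis Suc_eq_plus1 less_Suc_eq_le)+
  then show "b = b' \<and> w = w'" using eq by (simp add: adr_def)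
qed simp

lemma adr_less:
  assumes "b < B" "w \<le> n * n" "length M = B * (n * n + 1)"
  shows "adr n b w < length M"
proof -
  have "adr n b w < (b + 1) * (n * n + 1)" using assms(2) by (simp add: adr_def algebra_simps)
  also have "\<dots> \<le> B * (n * n + 1)" using assms(1) by (intro mult_right_mono) auto
  finally show ?thesis using assms(3) by simp
qed

lemma slot_update:
  assumes "b < B" "w \<le> n * n" "w' \<le> n * n" "length M = B * (n * n + 1)"
  shows "slot n (M[adr n b w := v]) b' w' = (if b' = b \<and> w' = w then v else slot n M b' w')"
  using assms adr_less[OF assms(1,2,4)] by (auto simp: slot_def nth_list_update adr_eq_iff)

lemma pos_less:
  fixes i j n :: nat
  assumes "i < n" "j < n" shows "i * n + j < n * n"
proof -
  have "i * n + j < (i + 1) * n" using assms by simp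
  also have "\<dots> \<le> n * n" using assms by (intro mult_right_mono) auto
  finally show ?thesis .
qed

lemma pos_eq_iff:
  fixes i j n :: nat
  assumes "j < n" "j' < n" shows "i * n + j = i' * n + j' \<longleftrightarrow> i = i' \<and> j = j'"
proof
  assume eq: "i * n + j = i' * n + j'"
  have "(i * n + j) div n = i" "(i' * n + j') div n = i'" using assms by simp_all
  then show "i = i' \<and> j = j'" using eq by auto
qed simp

section \<open>The program\<close>

declare One_nat_def [simp del]

abbreviation nn :: nexp where "nn \<equiv> NMul (NReg 0) (NReg 0)"

definition slot_at :: "nexp \<Rightarrow> nexp \<Rightarrow> nexp" where
  "slot_at S w = NAdd (NMul S (NAdd nn (NConst 1))) w"

abbreviation ent :: "nat \<Rightarrow> nat \<Rightarrow> nexp" where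
  "ent i j \<equiv> NAdd (NMul (NReg i) (NReg 0)) (NReg j)"

lemma nval_slot_at [simp]: "nval (slot_at S w) st = adr (nreg st 0) (nval S st) (nval w st)"
  by (simp add: slot_at_def adr_def)

definition copy :: "nexp \<Rightarrow> nexp \<Rightarrow> cmd" where
  "copy S D = For 20 (NAdd nn (NConst 1))
     (Seq (Load 20 (slot_at S (NReg 20))) (Store (slot_at D (NReg 20)) (RReg 20)))"

definition add_row :: cmd where
  "add_row = Seq
     (For 21 (NReg 0) (Seq (ReadRow 21 (NReg 21)) (For 22 (NReg 0)
        (Seq (ReadRow 22 (NReg 22)) (Seq (Load 23 (slot_at (NConst 1) (ent 21 22)))
          (Store (slot_at (NConst 1) (ent 21 22)) (RAdd (RReg 23) (RMul (RReg 21) (RReg 22)))))))))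
     (Seq (Load 23 (slot_at (NConst 1) nn)) (Store (slot_at (NConst 1) nn) (RAdd (RReg 23) (RConst 1))))"

definition build :: "nexp \<Rightarrow> cmd" where
  "build S = Seq
     (For 22 nn (Seq (Load 20 (slot_at (NConst 1) (NReg 22))) (Seq (Load 21 (slot_at S (NReg 22)))
        (Store (slot_at (NConst 0) (NReg 22)) (RSub (RReg 20) (RReg 21))))))
     (For 22 (NReg 0) (Seq (Load 20 (slot_at (NConst 0) (ent 22 22)))
        (Store (slot_at (NConst 0) (ent 22 22)) (RAdd (RReg 20) (RReg 1)))))"

definition elim_row :: cmd where
  "elim_row = For 22 (NReg 0) (Seq (Load 24 (slot_at (NConst 0) (ent 23 22)))
     (Seq (Load 25 (slot_at (NConst 0) (ent 21 22)))
       (Store (slot_at (NConst 0) (ent 21 22)) (RSub (RReg 25) (RMul (RReg 22) (RReg 24))))))"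

definition elim_column :: cmd where
  "elim_column = For 21 (NReg 0) (Cond (NLess (NReg 23) (NReg 21))
     (Seq (Load 22 (slot_at (NConst 0) (ent 21 23))) (Seq (RSet 22 (RDiv (RReg 22) (RReg 21))) elim_row))
     Skip)"

definition det_prog :: cmd where
  "det_prog = Seq (RSet 3 (RConst 1)) (For 23 (NReg 0)
     (Seq (Load 21 (slot_at (NConst 0) (ent 23 23))) (Seq (RSet 3 (RMul (RReg 3) (RReg 21))) elim_column)))"

text \<open>A push replaces at most the top entry and never uncovers the third one, so two cached
  determinants suffice and each stored time needs a single elimination. The quotient of real
  register 0 by 4 is \<open>e\<close>.\<close>

definition push_prog :: cmd where
  "push_prog = Cond (RLess (RReg 2) (RReg 3)) Skip
     (Seq (Cond (BAnd (NLess (NConst 1) (NReg 5))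
               (BNot (RLess (RReg 3) (RMul (RSub (RConst 1) (RDiv (RReg 0) (RConst 4))) (RReg 5)))))
             (NSet 5 (NSub (NReg 5) (NConst 1))) (RSet 5 (RReg 4)))
     (Seq (RSet 4 (RReg 3)) (Seq (copy (NAdd (NConst 2) (NReg 6)) (NAdd (NConst 2) (NReg 5)))
       (NSet 5 (NAdd (NReg 5) (NConst 1))))))"

definition compress_prog :: cmd where
  "compress_prog = Seq (NSet 5 (NConst 0))
     (Seq (For 6 (NReg 2) (Seq (build (NAdd (NConst 2) (NReg 6))) (Seq det_prog push_prog)))
     (Seq (NSet 2 (NReg 5)) (NSet 3 (NAdd (NMul (NConst 2) (NReg 5)) (NConst 2)))))"

text \<open>The prefix is copied before the row is added: with stamp \<open>t\<close> it represents
  the suffix that begins with the new row.\<close>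

definition update :: cmd where
  "update = Cond (RLess (RReg 0) (RConst 1))
     (Seq (copy (NConst 1) (NAdd (NConst 2) (NReg 2))) (Seq add_row
       (Seq (NSet 2 (NAdd (NReg 2) (NConst 1))) (Cond (NLess (NReg 2) (NReg 3)) Skip compress_prog))))
     Skip"

section \<open>Frames and specifications of the subroutines\<close>

lemma effects [simp]:
  "nw (copy S D) = {20}" "rw (copy S D) = {20}" "\<not> emits (copy S D)"
  "nw add_row = {21, 22}" "rw add_row = {21, 22, 23}" "\<not> emits add_row"
  "nw (build S) = {22}" "rw (build S) = {20, 21}" "\<not> emits (build S)"
  "nw elim_row = {22}" "rw elim_row = {24, 25}" "\<not> emits elim_row"
  "nw elim_column = {21, 22}" "rw elim_column = {22, 24, 25}" "\<not> emits elim_column"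
  "nw det_prog = {21, 22, 23}" "rw det_prog = {3, 21, 22, 24, 25}" "\<not> emits det_prog"
  "nw push_prog = {5, 20}" "rw push_prog = {4, 5, 20}" "\<not> emits push_prog"
  by (auto simp: copy_def add_row_def build_def elim_row_def elim_column_def det_prog_def push_prog_def)

lemma eff_simps:
  assumes "eff c st s"
  shows "x \<notin> nw c \<Longrightarrow> nreg s x = nreg st x" "x \<notin> rw c \<Longrightarrow> rreg s x = rreg st x"
    "input_row s = input_row st" "length (memory s) = length (memory st)"
    "\<not> emits c \<Longrightarrow> out_tape s = out_tape st" "\<not> stores c \<Longrightarrow> memory s = memory st"
  using assms by (auto simp: eff_def)

lemma wp_eff_conj: "wp c st (\<lambda>k s. P k s \<and> R k s) \<Longrightarrow> wp c st (\<lambda>k s. P k s \<and> eff c st s \<and> R k s)"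
  by (drule wp_eff) (erule wp_mono, blast)

text \<open>The slot expressions have to keep their values while the loop counter, index register
  20, runs. The case \<open>b = d\<close> is included; it occurs while nothing has been dropped from
  the stack.\<close>

lemma wp_copy:
  assumes n: "nreg st 0 = n" and len: "length (memory st) = B * (n * n + 1)"
    and S: "\<And>s. (\<And>x. x \<noteq> 20 \<Longrightarrow> nreg s x = nreg st x) \<Longrightarrow> nval S s = b"
    and D: "\<And>s. (\<And>x. x \<noteq> 20 \<Longrightarrow> nreg s x = nreg st x) \<Longrightarrow> nval D s = d"
    and "b < B" "d < B"
  shows "wp (copy S D) st (\<lambda>k s. k \<le> 4 * (n * n) + 6 \<and> eff (copy S D) st s \<and>
    (\<forall>c w. w \<le> n * n \<longrightarrow> slot n (memory s) c w = slot n (memory st) (if c = d then b else c) w))"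
  unfolding copy_def
proof (rule wp_For[where N = "n * n + 1" and K = 2 and I = "\<lambda>i s. \<forall>c w. w \<le> n * n \<longrightarrow>
      slot n (memory s) c w = slot n (memory st) (if c = d \<and> w < i then b else c) w"], goal_cases)
  case (1 s)
  then show ?case using n by (simp add: eff_def)
next
  case (4 i s)
  have r: "nreg s x = nreg st x" if "x \<noteq> 20" for x using 4(4) that by (simp add: eff_def)
  have l: "length (memory s) = B * (n * n + 1)" using 4(4) len by (simp add: eff_def)
  have i: "i \<le> n * n" using 4(1) by simp
  note upd = slot_update[OF \<open>d < B\<close> i _ l]
  have v: "nval S s = b" "nval D (s\<lparr>rreg := f\<rparr>) = d" for f by (auto intro!: S D r)
  have a: "adr n b i < length (memory s)" "adr n d i < length (memory s)"
    using adr_less[OF _ i l] assms(5,6) by auto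
  show ?case using 4 a i n r[of 0] unfolding wp_simps
    by (auto simp: v upd slot_def[symmetric] less_Suc_eq)
qed auto

lemma wp_add_row:
  assumes n: "nreg st 0 = n" and len: "length (memory st) = B * (n * n + 1)" and B: "1 < B"
    and row: "input_row st = r" "dim_vec r = n"
  shows "wp add_row st (\<lambda>k s. k \<le> 5 * (n * n) + 5 * n + 4 \<and> eff add_row st s \<and>
    (\<forall>c w. c \<noteq> 1 \<longrightarrow> w \<le> n * n \<longrightarrow> slot n (memory s) c w = slot n (memory st) c w) \<and>
    (\<forall>w<n * n. slot n (memory s) 1 w = slot n (memory st) 1 w + r $ (w div n) * r $ (w mod n)) \<and>
    slot n (memory s) 1 (n * n) = slot n (memory st) 1 (n * n) + 1)"
proof -
  \<comment> \<open>One invariant serves both loops: \<open>p\<close> counts the entries already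
    updated in row-major order.\<close>
  define J where "J p s \<longleftrightarrow> (\<forall>c w. w \<le> n * n \<longrightarrow> slot n (memory s) c w =
      (if c = 1 \<and> w < p then slot n (memory st) 1 w + r $ (w div n) * r $ (w mod n)
       else slot n (memory st) c w))" for p and s :: state
  let ?inner = "Seq (ReadRow 22 (NReg 22)) (Seq (Load 23 (slot_at (NConst 1) (ent 21 22)))
          (Store (slot_at (NConst 1) (ent 21 22)) (RAdd (RReg 23) (RMul (RReg 21) (RReg 22)))))"
  let ?body = "Seq (ReadRow 21 (NReg 21)) (For 22 (NReg 0) ?inner)"
  have loop: "wp (For 21 (NReg 0) ?body) st (\<lambda>k s. k \<le> n * (5 * n + 5) + 2 \<and> J (n * n) s
      \<and> nreg s 0 = n \<and> length (memory s) = B * (n * n + 1))"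
  proof (rule wp_For[where N = n and K = "5 * n + 3" and I = "\<lambda>i s. J (i * n) s"], goal_cases)
    case (1 s) then show ?case using n by (simp add: eff_def)
  next
    case (4 i s)
    have s0: "nreg s 0 = n" "length (memory s) = B * (n * n + 1)" "input_row s = r"
      using 4(4) n len row by (auto simp: eff_def)
    let ?s1 = "s\<lparr>rreg := (rreg s)(21 := r $ i)\<rparr>"
    have "wp (For 22 (NReg 0) ?inner) ?s1 (\<lambda>k s'. k \<le> 5 * n + 2 \<and> J (i * n + n) s')"
    proof (rule wp_For[where N = n and K = 3 and I = "\<lambda>j s. J (i * n + j) s"], goal_cases)
      case (1 s') then show ?case using s0 by (simp add: eff_def)
    next
      case 3 then show ?case using 4(2) by (simp add: J_def)
    next
      case (4 j s2)
      have s2: "nreg s2 0 = n" "length (memory s2) = B * (n * n + 1)" "input_row s2 = r"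
          "nreg s2 21 = i" "rreg s2 21 = r $ i" "nreg s2 22 = j"
        using 4(3,4) s0 \<open>nreg s 21 = i\<close> by (auto simp: eff_def)
      have w: "i * n + j < n * n" using pos_less \<open>i < n\<close> 4(1) by blast
      then have w': "i * n + j \<le> n * n" by simp
      have a: "adr n 1 (i * n + j) < length (memory s2)" using adr_less[OF B w' s2(2)] .
      have "J (i * n + Suc j) (s2\<lparr>memory := (memory s2)[adr n 1 (i * n + j) :=
          slot n (memory s2) 1 (i * n + j) + r $ i * r $ j]\<rparr>)"
        using 4(1,2) by (auto simp: J_def slot_update[OF B w' _ s2(2)] less_Suc_eq w')
      then show ?case using s2 a 4(1) row(2) unfolding wp_simps
        by (simp add: slot_def J_def)
    qed auto
    then show ?case using s0 4(1,3) row(2) unfolding wp_simps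
      by (auto elim!: wp_mono simp: J_def add.commute)
  next
    case (5 k s)
    then show ?case using n len by (auto simp: eff_def algebra_simps)
  qed (auto simp: J_def)
  have nnle: "n * n \<le> n * n" by simp
  show ?thesis
  proof (rule wp_eff_conj, unfold add_row_def wp_Seq[of "For _ _ _"], rule wp_mono[OF loop], goal_cases)
    case (1 k s)
    then have s: "nreg s 0 = n" "length (memory s) = B * (n * n + 1)" "J (n * n) s"
      "k \<le> n * (5 * n + 5) + 2" by auto
    have a: "adr n 1 (n * n) < length (memory s)" using adr_less[OF B nnle s(2)] .
    show ?case
      using s a n unfolding wp_simps
      by (auto simp: J_def slot_update[OF B nnle _ s(2)] slot_def[symmetric] algebra_simps)
  qed
qed

lemma wp_build:
  assumes n: "nreg st 0 = n" and len: "length (memory st) = B * (n * n + 1)" and B: "1 < B" "b < B" "b \<noteq> 0"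
    and S: "\<And>s. (\<And>x. x \<noteq> 22 \<Longrightarrow> nreg s x = nreg st x) \<Longrightarrow> nval S s = b"
  shows "wp (build S) st (\<lambda>k s. k \<le> 5 * (n * n) + 4 * n + 4 \<and> eff (build S) st s \<and>
    (\<forall>c w. c \<noteq> 0 \<longrightarrow> w \<le> n * n \<longrightarrow> slot n (memory s) c w = slot n (memory st) c w) \<and>
    (\<forall>i<n. \<forall>j<n. slot n (memory s) 0 (i * n + j) = shift (rreg st 1)
       (\<lambda>i j. slot n (memory st) 1 (i * n + j) - slot n (memory st) b (i * n + j)) i j))"
proof -
  define J where "J p s \<longleftrightarrow> (\<forall>c w. w \<le> n * n \<longrightarrow> slot n (memory s) c w =
      (if c = 0 \<and> w < p then slot n (memory st) 1 w - slot n (memory st) b w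
       else slot n (memory st) c w))" for p and s :: state
  have B0: "0 < B" using B by simp
  let ?c1 = "Seq (Load 20 (slot_at (NConst 1) (NReg 22))) (Seq (Load 21 (slot_at S (NReg 22)))
        (Store (slot_at (NConst 0) (NReg 22)) (RSub (RReg 20) (RReg 21))))"
  let ?c2 = "Seq (Load 20 (slot_at (NConst 0) (ent 22 22)))
        (Store (slot_at (NConst 0) (ent 22 22)) (RAdd (RReg 20) (RReg 1)))"
  have loop1: "wp (For 22 nn ?c1) st (\<lambda>k s. k \<le> 5 * (n * n) + 2 \<and> J (n * n) s
      \<and> nreg s 0 = n \<and> length (memory s) = B * (n * n + 1) \<and> rreg s 1 = rreg st 1)"
  proof (rule wp_For[where N = "n * n" and K = 3 and I = J], goal_cases)
    case (1 s) then show ?case using n by (simp add: eff_def)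
  next
    case (4 p s)
    have s: "nreg s 0 = n" "length (memory s) = B * (n * n + 1)"
      using 4(4) n len by (auto simp: eff_def)
    have p: "p \<le> n * n" using 4(1) by simp
    have v: "nval S (s\<lparr>rreg := f\<rparr>) = b" for f using 4(4) by (auto intro!: S simp: eff_def)
    have a: "adr n c p < length (memory s)" if "c < B" for c using adr_less[OF that p s(2)] .
    show ?case using 4(1-3) s a[OF B(1)] a[OF B(2)] a[OF B0] \<open>b \<noteq> 0\<close> unfolding wp_simps
      by (auto simp: v J_def slot_update[OF B0 p _ s(2)] slot_def[symmetric] less_Suc_eq)
  next
    case (5 k s) then show ?case using n len by (auto simp: eff_def)
  qed (auto simp: J_def)
  show ?thesis
  proof (rule wp_eff_conj, unfold build_def wp_Seq[of "For _ _ _"], rule wp_mono[OF loop1], goal_cases)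
    case (1 k s)
    then have s: "nreg s 0 = n" "length (memory s) = B * (n * n + 1)" "J (n * n) s"
      "k \<le> 5 * (n * n) + 2" "rreg s 1 = rreg st 1" by auto
    \<comment> \<open>The first \<open>p\<close> diagonal entries are shifted already. For
      \<open>p = 0\<close> this is the unshifted difference that the previous loop leaves
      behind.\<close>
    define D where "D p s' \<longleftrightarrow>
      (\<forall>c w. c \<noteq> 0 \<longrightarrow> w \<le> n * n \<longrightarrow> slot n (memory s') c w = slot n (memory st) c w) \<and>
      (\<forall>i<n. \<forall>j<n. slot n (memory s') 0 (i * n + j) = shift (if i < p then rreg st 1 else 0)
       (\<lambda>i j. slot n (memory st) 1 (i * n + j) - slot n (memory st) b (i * n + j)) i j)" for p and s' :: state
    show ?case
    proof (rule wp_For[where N = n and K = 2 and I = D], goal_cases)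
      case (1 s') then show ?case using s by (simp add: eff_def)
    next
      case 3
      show ?case using s(3) pos_less by (auto simp: D_def J_def shift_def less_imp_le)
    next
      case (4 i s2)
      have s2: "nreg s2 0 = n" "length (memory s2) = B * (n * n + 1)" "rreg s2 1 = rreg st 1"
        using 4(4) s by (auto simp: eff_def)
      have p: "i * n + i \<le> n * n" using pos_less[OF 4(1) 4(1)] by simp
      have a: "adr n 0 (i * n + i) < length (memory s2)" using adr_less[OF B0 p s2(2)] .
      have le: "i' * n + j' \<le> n * n" if "i' < n" "j' < n" for i' j' using pos_less[OF that] by simp
      have eq: "i' * n + j' = i * n + i \<longleftrightarrow> i' = i \<and> j' = i" if "j' < n" for i' j'
        using pos_eq_iff[OF that 4(1)] by simp
      show ?case using 4(1-3) s2 a unfolding wp_simps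
        by (auto simp: D_def slot_update[OF B0 p _ s2(2)] slot_def[symmetric] less_Suc_eq shift_def le eq)
    next
      case (5 k' s')
      then show ?case using s(4) by (auto simp: D_def)
    qed simp
  qed
qed

definition Zs :: "nat \<Rightarrow> state \<Rightarrow> nat \<Rightarrow> nat \<Rightarrow> real" where
  "Zs n s i j = slot n (memory s) 0 (i * n + j)"

definition same_slots :: "nat \<Rightarrow> state \<Rightarrow> state \<Rightarrow> bool" where
  "same_slots n st s \<longleftrightarrow> (\<forall>c w. c \<noteq> 0 \<longrightarrow> w \<le> n * n \<longrightarrow> slot n (memory s) c w = slot n (memory st) c w)"

lemma wp_elim_row:
  assumes n: "nreg st 0 = n" and len: "length (memory st) = B * (n * n + 1)" and B: "0 < B"
    and ik: "nreg st 21 = i" "nreg st 23 = k" "i < n" "k < n" "i \<noteq> k"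
  shows "wp elim_row st (\<lambda>t s. t \<le> 5 * n + 2 \<and> eff elim_row st s \<and> same_slots n st s \<and>
    (\<forall>a<n. \<forall>j<n. Zs n s a j = (if a = i then Zs n st i j - rreg st 22 * Zs n st k j else Zs n st a j)))"
  unfolding elim_row_def
proof (rule wp_For[where N = n and K = 3 and I = "\<lambda>p s. same_slots n st s \<and>
    (\<forall>a<n. \<forall>j<n. Zs n s a j = (if a = i \<and> j < p then Zs n st i j - rreg st 22 * Zs n st k j else Zs n st a j))"],
    goal_cases)
  case (1 s) then show ?case using n by (simp add: eff_def)
next
  case (4 p s)
  have s: "nreg s 0 = n" "length (memory s) = B * (n * n + 1)" "nreg s 21 = i" "nreg s 23 = k"
    "rreg s 22 = rreg st 22"
    using 4(4) n len ik by (auto simp: eff_def)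
  have le: "i' * n + j' \<le> n * n" if "i' < n" "j' < n" for i' j' using pos_less[OF that] by simp
  have eq: "i' * n + j' = i * n + p \<longleftrightarrow> i' = i \<and> j' = p" if "j' < n" for i' j'
    using pos_eq_iff[OF that 4(1)] by simp
  have a: "adr n 0 (a * n + p) < length (memory s)" if "a < n" for a
    using adr_less[OF B le[OF that 4(1)] s(2)] .
  show ?case using 4(1-3) s a ik unfolding wp_simps
    by (auto simp: same_slots_def Zs_def slot_update[OF B le[OF ik(3) 4(1)] _ s(2)]
        slot_def[symmetric] less_Suc_eq le eq)
qed (auto simp: same_slots_def Zs_def)

text \<open>Only rows below \<open>k\<close> change, so the pivots found so far stay on the
  diagonal. This is why the running product kept by \<open>det_prog\<close> is the diagonal product
  of the final matrix.\<close>

lemma wp_elim_column: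
  assumes n: "nreg st 0 = n" and len: "length (memory st) = B * (n * n + 1)" and B: "0 < B"
    and k: "nreg st 23 = k" "k < n" and piv: "rreg st 21 = Zs n st k k"
    and A: "pd n A" and inv: "ge_inv n A k 0 (Zs n st)"
  shows "wp elim_column st (\<lambda>t s. t \<le> 5 * (n * n) + 7 * n + 2 \<and> eff elim_column st s \<and> same_slots n st s \<and>
    ge_inv n A k n (Zs n s) \<and> (\<forall>j\<le>k. Zs n s j j = Zs n st j j))"
  unfolding elim_column_def
proof (rule wp_For[where N = n and K = "5 * n + 5" and I = "\<lambda>i s. same_slots n st s \<and>
    ge_inv n A k i (Zs n s) \<and> (\<forall>j\<le>k. Zs n s j j = Zs n st j j)"], goal_cases)
  case (1 s) then show ?case using n by (simp add: eff_def)
next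
  case 3
  then show ?case using inv by (simp add: same_slots_def Zs_def[abs_def])
next
  case (4 i s)
  have s: "nreg s 0 = n" "length (memory s) = B * (n * n + 1)" "nreg s 23 = k" "rreg s 21 = Zs n st k k"
    using 4(4) n len k piv by (auto simp: eff_def)
  show ?case
  proof (cases "k < i")
    case False
    then have "ge_inv n A k (Suc i) (Zs n s)" using 4(2) by (intro ge_inv_skip) auto
    then show ?thesis using False 4(2,3) s unfolding wp_simps by (auto simp: same_slots_def Zs_def[abs_def])
  next
    case True
    have le: "i * n + k \<le> n * n" using pos_less[OF 4(1) k(2)] by simp
    have a: "adr n 0 (i * n + k) < length (memory s)" using adr_less[OF B le s(2)] .
    let ?f = "Zs n s i k / Zs n s k k"
    let ?s = "s\<lparr>rreg := (rreg s)(22 := ?f)\<rparr>"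
    have "wp elim_row ?s (\<lambda>t s'. t \<le> 5 * n + 2 \<and> eff elim_row ?s s' \<and> same_slots n ?s s' \<and>
      (\<forall>a<n. \<forall>j<n. Zs n s' a j = (if a = i then Zs n ?s i j - rreg ?s 22 * Zs n ?s k j else Zs n ?s a j)))"
      by (rule wp_elim_row) (use s B 4(1,3) k True in auto)
    then have *: "wp elim_row ?s (\<lambda>t s'. t \<le> 5 * n + 2 \<and> same_slots n s s' \<and>
      (\<forall>a<n. \<forall>j<n. Zs n s' a j = (if a = i then Zs n s i j - Zs n s i k / Zs n s k k * Zs n s k j else Zs n s a j)))"
      by (rule wp_mono) (simp add: same_slots_def Zs_def[abs_def])
    have "wp elim_row ?s (\<lambda>t s'. t \<le> 5 * n + 2 \<and> same_slots n st s' \<and> ge_inv n A k (Suc i) (Zs n s')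
       \<and> (\<forall>j\<le>k. Zs n s' j j = Zs n st j j))"
    proof (rule wp_mono[OF *], goal_cases)
      case (1 t s')
      then have "ge_inv n A k (Suc i) (Zs n s')"
        using 4(1,2) True by (intro ge_inv_elim[OF _ True 4(1) A]) auto
      then show ?case using 1 4(2) True k by (auto simp: same_slots_def)
    qed
    then have "wp elim_row ?s (\<lambda>t s'. t + 3 \<le> 5 * n + 5 \<and> same_slots n st s' \<and> ge_inv n A k (Suc i) (Zs n s')
       \<and> (\<forall>j\<le>k. Zs n s' j j = Zs n st j j))" by (rule wp_mono) simp
    moreover have "Zs n s k k = Zs n st k k" using 4(2) by simp
    ultimately show ?thesis using True 4(2,3) s a unfolding wp_simps
      by (simp add: same_slots_def Zs_def[abs_def] slot_def[symmetric] fun_upd_upd algebra_simps)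
  qed
next
  case (5 t s)
  then show ?case by (simp add: algebra_simps)
qed auto

lemma wp_det_prog:
  assumes n: "nreg st 0 = n" and len: "length (memory st) = B * (n * n + 1)" and B: "0 < B"
    and A: "pd n A" and init: "\<And>i j. i < n \<Longrightarrow> j < n \<Longrightarrow> Zs n st i j = A i j"
  shows "wp det_prog st (\<lambda>t s. t \<le> n * (5 * (n * n) + 7 * n + 6) + 3 \<and> eff det_prog st s \<and>
    same_slots n st s \<and> rreg s 3 = dt n A)"
proof (rule wp_eff_conj, unfold det_prog_def wp_simps, rule wp_For[where N = n and
    K = "5 * (n * n) + 7 * n + 4" and I = "\<lambda>k s. same_slots n st s \<and> ge_inv n A k 0 (Zs n s) \<and>
      rreg s 3 = (\<Prod>j<k. Zs n s j j)"], goal_cases)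
  case (1 s) then show ?case using n by (simp add: eff_def)
next
  case 3
  have "mat_of n (Zs n st) = mat_of n A" using init by (intro eq_matI) auto
  then have "ge_inv n A 0 0 (Zs n st)" using ge_inv_init[of n A] init by (simp add: ge_inv_def)
  then show ?case by (simp add: same_slots_def Zs_def[abs_def])
next
  case (4 k s)
  have s: "nreg s 0 = n" "length (memory s) = B * (n * n + 1)"
    using 4(4) n len by (auto simp: eff_def)
  have le: "k * n + k \<le> n * n" using pos_less[OF 4(1) 4(1)] by simp
  have a: "adr n 0 (k * n + k) < length (memory s)" using adr_less[OF B le s(2)] .
  let ?s = "s\<lparr>rreg := (rreg s)(21 := Zs n s k k, 3 := rreg s 3 * Zs n s k k)\<rparr>"
  have "wp elim_column ?s (\<lambda>t s'. t \<le> 5 * (n * n) + 7 * n + 2 \<and> eff elim_column ?s s' \<and> same_slots n ?s s' \<and>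
    ge_inv n A k n (Zs n s') \<and> (\<forall>j\<le>k. Zs n s' j j = Zs n ?s j j))"
    by (rule wp_elim_column) (use s B 4(1-3) A in \<open>auto simp: Zs_def[abs_def]\<close>)
  then have "wp elim_column ?s (\<lambda>t s'. 1 + (1 + t) \<le> 5 * (n * n) + 7 * n + 4 \<and> same_slots n st s' \<and>
    ge_inv n A (Suc k) 0 (Zs n s') \<and> rreg s' 3 = (\<Prod>j<Suc k. Zs n s' j j))"
  proof (rule wp_mono, goal_cases)
    case (1 t s')
    then have "rreg s' 3 = rreg s 3 * Zs n s k k" by (simp add: eff_def)
    also have "\<dots> = (\<Prod>j<Suc k. Zs n s j j)" using 4(2) by simp
    also have "\<dots> = (\<Prod>j<Suc k. Zs n s' j j)"
      using 1 by (intro prod.cong) (auto simp: Zs_def)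
    finally show ?case using 1 4(2) by (auto intro: ge_inv_next simp: same_slots_def)
  qed
  then show ?case using s a 4(3) unfolding wp_simps
    by (simp add: same_slots_def Zs_def[abs_def] slot_def[symmetric])
next
  case (5 t s)
  have "dt n A = (\<Prod>j<n. Zs n s j j)" using 5(2) by (intro ge_inv_final) simp
  then show ?case using 5 by (simp add: algebra_simps same_slots_def)
qed auto

section \<open>Maintaining the stored suffixes\<close>

definition cell :: "nat \<Rightarrow> (nat \<Rightarrow> nat \<Rightarrow> real) \<Rightarrow> nat \<Rightarrow> nat \<Rightarrow> real" where
  "cell n r \<tau> w = (if w < n * n then gram r 0 \<tau> (w div n) (w mod n) else real \<tau>)"

lemma cell_diff:
  assumes "\<tau> \<le> t" "i < n" "j < n"
  shows "cell n r t (i * n + j) - cell n r \<tau> (i * n + j) = gram r \<tau> t i j"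
proof -
  have "gram r 0 t i j = gram r 0 \<tau> i j + gram r \<tau> t i j"
    unfolding gram_def using assms(1) by (simp add: sum.atLeastLessThan_concat)
  then show ?thesis using assms pos_less[OF assms(2,3)] by (simp add: cell_def)
qed

definition holds :: "nat \<Rightarrow> (nat \<Rightarrow> nat \<Rightarrow> real) \<Rightarrow> state \<Rightarrow> nat \<Rightarrow> nat \<Rightarrow> bool" where
  "holds n r st c \<tau> \<longleftrightarrow> (\<forall>w\<le>n * n. slot n (memory st) c w = cell n r \<tau> w)"

definition stack_ok :: "nat \<Rightarrow> (nat \<Rightarrow> nat \<Rightarrow> real) \<Rightarrow> (nat \<Rightarrow> real) \<Rightarrow> state \<Rightarrow> nat list \<Rightarrow> bool" where
  "stack_ok n r d st S \<longleftrightarrow> nreg st 5 = length S \<and> (\<forall>j<length S. holds n r st (2 + j) (rev S ! j)) \<and>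
     (\<forall>x S'. S = x # S' \<longrightarrow> rreg st 4 = d x) \<and> (\<forall>x y S'. S = x # y # S' \<longrightarrow> rreg st 5 = d y)"

lemma wp_push_tail:
  assumes n: "nreg st 0 = n" and len: "length (memory st) = B * (n * n + 1)"
    and b: "nreg st 6 = b" "2 + b < B" and m: "nreg st 5 = m" "m \<le> b"
  shows "wp (Seq (RSet 4 (RReg 3)) (Seq (copy (NAdd (NConst 2) (NReg 6)) (NAdd (NConst 2) (NReg 5)))
       (NSet 5 (NAdd (NReg 5) (NConst 1))))) st
    (\<lambda>k s. k \<le> 4 * (n * n) + 8 \<and> nreg s 5 = m + 1 \<and> rreg s 4 = rreg st 3 \<and> rreg s 5 = rreg st 5 \<and>
      (\<forall>c w. w \<le> n * n \<longrightarrow> slot n (memory s) c w = slot n (memory st) (if c = 2 + m then 2 + b else c) w))"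
proof -
  let ?st = "st\<lparr>rreg := (rreg st)(4 := rreg st 3)\<rparr>"
  let ?c = "copy (NAdd (NConst 2) (NReg 6)) (NAdd (NConst 2) (NReg 5))"
  have "wp ?c ?st (\<lambda>k s. k \<le> 4 * (n * n) + 6 \<and> eff ?c ?st s \<and>
    (\<forall>c w. w \<le> n * n \<longrightarrow> slot n (memory s) c w = slot n (memory ?st) (if c = 2 + m then 2 + b else c) w))"
    by (rule wp_copy) (use assms in auto)
  then show ?thesis unfolding wp_Seq wp_RSet wp_NSet rval.simps nval.simps
  proof (rule wp_mono, goal_cases)
    case (1 k s)
    then show ?case using m by (auto simp: eff_def)
  qed
qed

lemma wp_push_prog:
  assumes n: "nreg st 0 = n" and len: "length (memory st) = B * (n * n + 1)"
    and b: "nreg st 6 = b" "2 + b < B" and S: "stack_ok n r d st S" "length S \<le> b"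
    and regs: "rreg st 0 = 4 * e" "rreg st 2 = cap" "rreg st 3 = d i"
    and i: "holds n r st (2 + b) i"
  shows "wp push_prog st (\<lambda>k s. k \<le> 4 * (n * n) + 11 \<and> eff push_prog st s \<and>
     stack_ok n r d s (push d cap e i S) \<and>
     (\<forall>c w. c < 2 \<or> 2 + b < c \<longrightarrow> w \<le> n * n \<longrightarrow> slot n (memory s) c w = slot n (memory st) c w))"
proof (rule wp_eff_conj, cases rule: push_cases[where cap = cap and d = d and i = i and e = e and s = S], goal_cases)
  case 1
  then show ?case
    using S regs unfolding push_prog_def wp_simps by simp
next
  case (2 c a S')
  have l: "nreg st 5 = length S' + 2" "rreg st 5 = d a" using S(1) 2 by (auto simp: stack_ok_def)
  let ?st = "st\<lparr>nreg := (nreg st)(5 := Suc (length S'))\<rparr>"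
  let ?tail = "Seq (RSet 4 (RReg 3)) (Seq (copy (NAdd (NConst 2) (NReg 6)) (NAdd (NConst 2) (NReg 5)))
       (NSet 5 (NAdd (NReg 5) (NConst 1))))"
  have "wp ?tail ?st (\<lambda>k s. k \<le> 4 * (n * n) + 8 \<and> nreg s 5 = Suc (length S') + 1 \<and> rreg s 4 = rreg ?st 3 \<and>
      rreg s 5 = rreg ?st 5 \<and> (\<forall>c w. w \<le> n * n \<longrightarrow>
        slot n (memory s) c w = slot n (memory ?st) (if c = 2 + Suc (length S') then 2 + b else c) w))"
    by (rule wp_push_tail) (use n len b S 2(1) in auto)
  then have *: "wp ?tail ?st (\<lambda>k s. k + 3 \<le> 4 * (n * n) + 11 \<and> stack_ok n r d s (push d cap e i S) \<and>
     (\<forall>c w. c < 2 \<or> 2 + b < c \<longrightarrow> w \<le> n * n \<longrightarrow> slot n (memory s) c w = slot n (memory st) c w))"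
  proof (rule wp_mono, goal_cases)
    case (1 k s)
    have "holds n r s (2 + j) (rev (i # a # S') ! j)" if "j < length S' + 2" for j
    proof (cases "j = length S' + 1")
      case True
      then show ?thesis using 1 i by (auto simp: holds_def nth_append)
    next
      case False
      have "holds n r st (2 + j) (rev S ! j)" using S(1) that 2(1) by (auto simp: stack_ok_def)
      moreover have "rev S ! j = rev (i # a # S') ! j" using False that 2(1) by (auto simp: nth_append)
      ultimately show ?thesis using 1 False by (auto simp: holds_def)
    qed
    then show ?case using 1 2 l regs S(2) by (auto simp: stack_ok_def)
  qed
  have "(1 - rreg st 0 / 4) * rreg st 5 \<le> rreg st 3" using 2(3) regs l by simp
  then show ?case
    using * 2(2) regs l unfolding push_prog_def wp_Seq[of "Cond _ _ _"] wp_Cond wp_NSet wp_RSet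
    by (simp add: add.commute not_less)
next
  case 3
  let ?st = "st\<lparr>rreg := (rreg st)(5 := rreg st 4)\<rparr>"
  let ?tail = "Seq (RSet 4 (RReg 3)) (Seq (copy (NAdd (NConst 2) (NReg 6)) (NAdd (NConst 2) (NReg 5)))
       (NSet 5 (NAdd (NReg 5) (NConst 1))))"
  have l: "nreg st 5 = length S" using S(1) by (simp add: stack_ok_def)
  have "wp ?tail ?st (\<lambda>k s. k \<le> 4 * (n * n) + 8 \<and> nreg s 5 = length S + 1 \<and> rreg s 4 = rreg ?st 3 \<and>
      rreg s 5 = rreg ?st 5 \<and> (\<forall>c w. w \<le> n * n \<longrightarrow>
        slot n (memory s) c w = slot n (memory ?st) (if c = 2 + length S then 2 + b else c) w))"
    by (rule wp_push_tail) (use n len b S l in auto)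
  then have *: "wp ?tail ?st (\<lambda>k s. k + 3 \<le> 4 * (n * n) + 11 \<and> stack_ok n r d s (push d cap e i S) \<and>
     (\<forall>c w. c < 2 \<or> 2 + b < c \<longrightarrow> w \<le> n * n \<longrightarrow> slot n (memory s) c w = slot n (memory st) c w))"
  proof (rule wp_mono, goal_cases)
    case (1 k s)
    have "holds n r s (2 + j) (rev (i # S) ! j)" if "j < length S + 1" for j
    proof (cases "j = length S")
      case True
      then show ?thesis using 1 i by (auto simp: holds_def nth_append)
    next
      case False
      then have "holds n r st (2 + j) (rev S ! j)" using S(1) that by (auto simp: stack_ok_def)
      then show ?thesis using 1 False that by (auto simp: holds_def nth_append)
    qed
    then show ?case using 1 3 l regs S by (auto simp: stack_ok_def)
  qed
  have "\<not> (1 < nreg st 5 \<and> \<not> rreg st 3 < (1 - rreg st 0 / 4) * rreg st 5)"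
  proof
    assume a: "1 < nreg st 5 \<and> \<not> rreg st 3 < (1 - rreg st 0 / 4) * rreg st 5"
    then obtain x y S' where "S = x # y # S'" using l by (cases S rule: remdups_adj.cases) auto
    then show False using a 3(3) S(1) regs by (auto simp: stack_ok_def)
  qed
  then show ?case
    using * 3(2) regs l unfolding push_prog_def wp_Seq[of "Cond _ _ _"] wp_Cond wp_NSet wp_RSet
    by (auto simp: add.commute not_less)
qed

lemma cube_bounds: "1 \<le> n \<Longrightarrow> 1 \<le> n ^ 3 \<and> n \<le> n ^ 3 \<and> n * n \<le> n ^ 3" for n :: nat
  using self_le_power[of n 3] power_increasing[of 2 3 n] by (simp add: power2_eq_square)

text \<open>The stack is built in place. After \<open>b\<close> times it has height at most
  \<open>b\<close>, so it occupies slots that have been read already, and the times not yet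
  inspected are intact.\<close>

lemma wp_compress_prog:
  assumes n: "nreg st 0 = n" "1 \<le> n" and len: "length (memory st) = B * (n * n + 1)"
    and cnt: "nreg st 2 = length I" "length I + 2 \<le> B"
    and regs: "rreg st 0 = 4 * e" "rreg st 1 = \<mu>" "rreg st 2 = cap" and \<mu>: "\<mu> > 0"
    and cur: "holds n r st 1 t" and lt: "\<forall>\<tau>\<in>set I. \<tau> < t"
    and rep: "\<And>j. j < length I \<Longrightarrow> holds n r st (2 + j) (I ! j)"
  defines "S \<equiv> compress (dtime n \<mu> r t) cap e I"
  shows "wp compress_prog st (\<lambda>k s. k \<le> 60 * n ^ 3 * (length I + 1) \<and> eff compress_prog st s \<and>
    nreg s 2 = length S \<and> nreg s 3 = 2 * length S + 2 \<and> holds n r s 1 t \<and>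
    (\<forall>j<length S. holds n r s (2 + j) (rev S ! j)))"
proof -
  let ?d = "dtime n \<mu> r t"
  let ?S = "\<lambda>b. compress ?d cap e (take b I)"
  let ?body = "Seq (build (NAdd (NConst 2) (NReg 6))) (Seq det_prog push_prog)"
  let ?st = "st\<lparr>nreg := (nreg st)(5 := 0)\<rparr>"
  have cube: "1 \<le> n ^ 3" "n \<le> n ^ 3" "n * n \<le> n ^ 3" using cube_bounds[OF n(2)] by auto
  have loop: "wp (For 6 (NReg 2) ?body) ?st (\<lambda>k s. k \<le> length I * (58 * n ^ 3 + 2) + 2 \<and>
      stack_ok n r ?d s S \<and> holds n r s 1 t)"
  proof (rule wp_For[where N = "length I" and K = "58 * n ^ 3" and I = "\<lambda>b s. stack_ok n r ?d s (?S b) \<and>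
      holds n r s 1 t \<and> (\<forall>j. b \<le> j \<longrightarrow> j < length I \<longrightarrow> holds n r s (2 + j) (I ! j))"], goal_cases)
    case (1 s) then show ?case using cnt by (simp add: eff_def)
  next
    case 3
    then show ?case using cur rep by (simp add: compress_def stack_ok_def holds_def)
  next
    case (4 b s)
    have s: "nreg s 0 = n" "length (memory s) = B * (n * n + 1)" "nreg s 6 = b"
      "rreg s 0 = 4 * e" "rreg s 1 = \<mu>" "rreg s 2 = cap"
      using 4(3,4) n len regs by (auto simp: eff_def)
    have B: "1 < B" "2 + b < B" "0 < B" using cnt(2) 4(1) by auto
    let ?bd = "build (NAdd (NConst 2) (NReg 6))"
    let ?\<tau> = "I ! b"
    let ?A = "shift \<mu> (gram r ?\<tau> t)"
    have \<tau>: "?\<tau> \<le> t" using lt 4(1) by (auto simp: less_imp_le)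
    have hb: "holds n r s (2 + b) ?\<tau>" using 4(1,2) by auto
    have "wp ?bd s (\<lambda>k s1. k \<le> 5 * (n * n) + 4 * n + 4 \<and> eff ?bd s s1 \<and>
      (\<forall>c w. c \<noteq> 0 \<longrightarrow> w \<le> n * n \<longrightarrow> slot n (memory s1) c w = slot n (memory s) c w) \<and>
      (\<forall>i<n. \<forall>j<n. slot n (memory s1) 0 (i * n + j) = shift (rreg s 1)
         (\<lambda>i j. slot n (memory s) 1 (i * n + j) - slot n (memory s) (2 + b) (i * n + j)) i j))"
      by (rule wp_build) (use s B in auto)
    then have "wp ?bd s (\<lambda>k1 s1. wp det_prog s1 (\<lambda>k2 s2. wp push_prog s2 (\<lambda>k3 s3. k1 + (k2 + k3) \<le> 58 * n ^ 3 \<and>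
       stack_ok n r ?d s3 (?S (Suc b)) \<and> holds n r s3 1 t \<and>
       (\<forall>j. Suc b \<le> j \<longrightarrow> j < length I \<longrightarrow> holds n r s3 (2 + j) (I ! j)))))"
    proof (rule wp_mono, goal_cases)
      case (1 k1 s1)
      have e1: "eff ?bd s s1" and k1: "k1 \<le> 5 * (n * n) + 4 * n + 4" and
        sl1: "\<And>c w. c \<noteq> 0 \<Longrightarrow> w \<le> n * n \<Longrightarrow> slot n (memory s1) c w = slot n (memory s) c w"
        using 1 by auto
      have s1: "nreg s1 0 = n" "length (memory s1) = B * (n * n + 1)" using 1 s by (auto simp: eff_def)
      have Z: "Zs n s1 i j = ?A i j" if "i < n" "j < n" for i j
      proof -
        have "i * n + j \<le> n * n" using pos_less[OF that] by simp
        then show ?thesis using 1 that s(5) 4(2) hb cell_diff[OF \<tau> that, of r]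
          by (simp add: Zs_def shift_def holds_def)
      qed
      have "wp det_prog s1 (\<lambda>k2 s2. k2 \<le> n * (5 * (n * n) + 7 * n + 6) + 3 \<and> eff det_prog s1 s2 \<and>
        same_slots n s1 s2 \<and> rreg s2 3 = dt n ?A)"
        using wp_det_prog[OF s1 B(3) pd_shift_gram[OF \<mu>] Z] by simp
      then show ?case
      proof (rule wp_mono, goal_cases)
        case (1 k2 s2)
        note eqs = e1[THEN eff_simps(1)] e1[THEN eff_simps(2)] e1[THEN eff_simps(4)]
        have e2: "eff det_prog s1 s2" and k2: "k2 \<le> n * (5 * (n * n) + 7 * n + 6) + 3" using 1 by auto
        note eqs2 = e2[THEN eff_simps(1)] e2[THEN eff_simps(2)] e2[THEN eff_simps(4)]
        have sl: "slot n (memory s2) c w = slot n (memory s) c w" if "c \<noteq> 0" "w \<le> n * n" for c w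
          using 1 sl1 that by (auto simp: same_slots_def)
        have hs: "holds n r s2 c \<tau> = holds n r s c \<tau>" if "c \<noteq> 0" for c \<tau> using sl that by (simp add: holds_def)
        have st2: "stack_ok n r ?d s2 (?S b)" using 4(2) by (simp add: stack_ok_def eqs eqs2 hs)
        have lS: "length (?S b) \<le> b" using length_compress[of ?d cap e "take b I"] 4(1) by simp
        have "wp push_prog s2 (\<lambda>k s3. k \<le> 4 * (n * n) + 11 \<and> eff push_prog s2 s3 \<and>
           stack_ok n r ?d s3 (push ?d cap e ?\<tau> (?S b)) \<and>
           (\<forall>c w. c < 2 \<or> 2 + b < c \<longrightarrow> w \<le> n * n \<longrightarrow> slot n (memory s3) c w = slot n (memory s2) c w))"
          by (rule wp_push_prog) (use s B 1 st2 lS hs hb in \<open>auto simp: eqs eqs2 dtime_def\<close>)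
        then show ?case
        proof (rule wp_mono, goal_cases)
          case (1 k3 s3)
          have sl3: "holds n r s3 c \<tau>' = holds n r s c \<tau>'" if "c = 1 \<or> 2 + b < c" for c \<tau>'
            using 1 sl that by (auto simp: holds_def)
          have "?S (Suc b) = push ?d cap e ?\<tau> (?S b)"
            using 4(1) by (simp add: take_Suc_conv_app_nth compress_snoc)
          moreover have "k1 + (k2 + k3) \<le> 58 * n ^ 3"
          proof -
            have "k2 \<le> 5 * n ^ 3 + 7 * (n * n) + 6 * n + 3"
              using k2 by (simp add: power3_eq_cube algebra_simps)
            then show ?thesis using k1 1 cube by linarith
          qed
          ultimately show ?case using 1 4(2) by (auto simp: sl3)
        qed
      qed
    qed
    then show ?case unfolding wp_Seq
      by (auto elim!: wp_mono simp: stack_ok_def holds_def)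
  next
    case (5 k s)
    then show ?case using S_def by simp
  qed simp
  show ?thesis
  proof (rule wp_eff_conj, unfold compress_prog_def wp_Seq[of "NSet _ _"] wp_NSet wp_Seq[of "For _ _ _"]
      nval.simps, rule wp_mono[OF loop], goal_cases)
    case (1 k s)
    have "k + 4 \<le> 60 * n ^ 3 * (length I + 1)"
    proof -
      have "k \<le> 58 * (length I * n ^ 3) + 2 * length I + 2" using 1 by (simp add: algebra_simps)
      moreover have "length I \<le> length I * n ^ 3" using cube(1) by simp
      moreover have "60 * n ^ 3 * (length I + 1) = 60 * (length I * n ^ 3) + 60 * n ^ 3"
        by (simp add: algebra_simps)
      ultimately show ?thesis using cube(1) by linarith
    qed
    then show ?case using 1 by (auto simp: stack_ok_def holds_def)
  qed
qed

section \<open>The invariant between rows and the amortized cost of an update\<close>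

lemma wp_Seq_assoc: "wp (Seq (Seq a b) c) st Q \<longleftrightarrow> wp (Seq a (Seq b c)) st Q"
  by (simp add: wp_Seq add.assoc)

text \<open>\<open>N\<close> bounds the length of a spaced list. A threshold is at most
  \<open>2 * N + 2\<close>, and dropping starts as soon as it is reached, so this many slots besides
  0 and 1 are enough. The upper bound by \<open>2 * length I + 2\<close> is what keeps the potential
  bounded below.\<close>

definition tracks :: "nat \<Rightarrow> nat \<Rightarrow> real \<Rightarrow> real \<Rightarrow> real \<Rightarrow> nat \<Rightarrow> (nat \<Rightarrow> nat \<Rightarrow> real) \<Rightarrow> nat \<Rightarrow> nat list \<Rightarrow> state \<Rightarrow> bool" where
  "tracks n W e \<mu> cap N r t I st \<longleftrightarrow>
     nreg st 0 = n \<and> nreg st 1 = W \<and> rreg st 0 = 4 * e \<and> rreg st 1 = \<mu> \<and> rreg st 2 = cap \<and>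
     length (memory st) = (2 * N + 4) * (n * n + 1) \<and> nreg st 2 = length I \<and>
     length I < nreg st 3 \<and> nreg st 3 \<le> 2 * length I + 2 \<and> nreg st 3 \<le> 2 * N + 2 \<and>
     covers n \<mu> cap e r t I \<and> holds n r st 1 t \<and> (\<forall>j<length I. holds n r st (2 + j) (I ! j))"

lemma holds_add_row:
  assumes row: "\<And>i. i < n \<Longrightarrow> v $ i = r t i" and h: "holds n r st 1 t"
    and a: "\<forall>w<n * n. slot n (memory s) 1 w = slot n (memory st) 1 w + v $ (w div n) * v $ (w mod n)"
    and b: "slot n (memory s) 1 (n * n) = slot n (memory st) 1 (n * n) + 1"
  shows "holds n r s 1 (Suc t)"
  unfolding holds_def
proof (intro allI impI)
  fix w assume w: "w \<le> n * n"
  show "slot n (memory s) 1 w = cell n r (Suc t) w"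
  proof (cases "w = n * n")
    case True then show ?thesis using b h by (simp add: holds_def cell_def)
  next
    case False
    then have w: "w < n * n" using w by simp
    then have "0 < n" by (cases n) auto
    then have "w div n < n" "w mod n < n" using w by (simp_all add: less_mult_imp_div_less)
    then show ?thesis using w a h row by (simp add: holds_def cell_def gram_Suc)
  qed
qed

text \<open>The potential is \<open>120 * n ^ 3 * length I - 60 * n ^ 3 * nreg st 3\<close>, written
  without subtraction. Storing one time raises it by \<open>120 * n ^ 3\<close>. When the threshold
  is reached it equals \<open>60 * n ^ 3 * length I\<close> up to a constant multiple of
  \<open>n ^ 3\<close>, which pays for the elimination of all stored times, and afterwards it is
  \<open>- 120 * n ^ 3\<close>.\<close>

lemma wp_update:
  assumes tr: "tracks n W e \<mu> cap N r t I st" and n: "1 \<le> n" and e: "0 \<le> e" "4 * e < 1" and \<mu>: "\<mu> > 0"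
    and row: "input_row st = v" "dim_vec v = n" "\<And>i. i < n \<Longrightarrow> v $ i = r t i"
    and N: "\<And>S. spaced (dtime n \<mu> r (Suc t)) cap e S \<Longrightarrow> length S \<le> N"
  shows "wp update st (\<lambda>k s. \<exists>I'. tracks n W e \<mu> cap N r (Suc t) I' s \<and>
    k + 120 * n ^ 3 * length I' + 60 * n ^ 3 * nreg st 3 \<le> 150 * n ^ 3 + 120 * n ^ 3 * length I + 60 * n ^ 3 * nreg s 3)"
proof -
  let ?B = "2 * N + 4"
  have cube: "1 \<le> n ^ 3" "n \<le> n ^ 3" "n * n \<le> n ^ 3" using cube_bounds[OF n] by auto
  have st: "nreg st 0 = n" "nreg st 1 = W" "rreg st 0 = 4 * e" "rreg st 1 = \<mu>" "rreg st 2 = cap"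
    "length (memory st) = ?B * (n * n + 1)" "nreg st 2 = length I" "length I < nreg st 3"
    "nreg st 3 \<le> 2 * length I + 2" "nreg st 3 \<le> 2 * N + 2"
    "covers n \<mu> cap e r t I" "holds n r st 1 t" "\<And>j. j < length I \<Longrightarrow> holds n r st (2 + j) (I ! j)"
    using tr by (auto simp: tracks_def)
  let ?J = "I @ [t]"
  let ?c = "copy (NConst 1) (NAdd (NConst 2) (NReg 2))"
  have cov: "covers n \<mu> cap e r (Suc t) ?J" using covers_row[OF st(11) e(1) \<mu>] .
  have ltJ: "\<forall>\<tau>\<in>set ?J. \<tau> < Suc t" using cov by (simp add: covers_def)
  have c: "wp ?c st (\<lambda>k s. k \<le> 4 * (n * n) + 6 \<and> eff ?c st s \<and> (\<forall>c w. w \<le> n * n \<longrightarrow>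
      slot n (memory s) c w = slot n (memory st) (if c = 2 + length I then 1 else c) w))"
    by (rule wp_copy) (use st in auto)
  have pre: "wp (Seq ?c add_row) st (\<lambda>k s. k \<le> 24 * n ^ 3 \<and> eff (Seq ?c add_row) st s \<and>
     holds n r s 1 (Suc t) \<and> (\<forall>j<length ?J. holds n r s (2 + j) (?J ! j)))"
  proof (rule wp_eff_conj, unfold wp_Seq, rule wp_mono[OF c], goal_cases)
    case (1 k1 s1)
    have s1: "nreg s1 0 = n" "length (memory s1) = ?B * (n * n + 1)" "input_row s1 = v"
      using 1 st row by (auto simp: eff_def)
    have k1: "k1 \<le> 4 * (n * n) + 6" and
      sl1: "\<And>c w. w \<le> n * n \<Longrightarrow> slot n (memory s1) c w = slot n (memory st) (if c = 2 + length I then 1 else c) w"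
      using 1 by auto
    have "holds n r s1 1 t" using st(12) sl1 by (simp add: holds_def)
    have hJ: "holds n r s1 (2 + j) (?J ! j)" if "j < length ?J" for j
      using st(12,13) sl1 that by (cases "j = length I") (auto simp: holds_def nth_append)
    have "wp add_row s1 (\<lambda>k s. k \<le> 5 * (n * n) + 5 * n + 4 \<and> eff add_row s1 s \<and>
      (\<forall>c w. c \<noteq> 1 \<longrightarrow> w \<le> n * n \<longrightarrow> slot n (memory s) c w = slot n (memory s1) c w) \<and>
      (\<forall>w<n * n. slot n (memory s) 1 w = slot n (memory s1) 1 w + v $ (w div n) * v $ (w mod n)) \<and>
      slot n (memory s) 1 (n * n) = slot n (memory s1) 1 (n * n) + 1)"
      by (rule wp_add_row[where B = ?B]) (use s1 row in auto)
    then show ?case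
    proof (rule wp_mono, goal_cases)
      case (1 k2 s2)
      have "holds n r s2 1 (Suc t)" using holds_add_row[OF row(3) \<open>holds n r s1 1 t\<close>] 1 by blast
      moreover have "k1 + k2 \<le> 24 * n ^ 3" using k1 1 cube by linarith
      moreover have "holds n r s2 (2 + j) (?J ! j)" if "j < length ?J" for j
        using hJ[OF that] 1 by (simp add: holds_def)
      ultimately show ?case by blast
    qed
  qed
  let ?tail = "Seq (NSet 2 (NAdd (NReg 2) (NConst 1))) (Cond (NLess (NReg 2) (NReg 3)) Skip compress_prog)"
  have seq: "wp (Seq (Seq ?c add_row) ?tail) st (\<lambda>k s. \<exists>I'. tracks n W e \<mu> cap N r (Suc t) I' s \<and>
    (k + 1) + 120 * n ^ 3 * length I' + 60 * n ^ 3 * nreg st 3 \<le> 150 * n ^ 3 + 120 * n ^ 3 * length I + 60 * n ^ 3 * nreg s 3)"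
    unfolding wp_Seq[of "Seq ?c add_row"]
  proof (rule wp_mono[OF pre], goal_cases)
    case (1 k s)
    let ?s = "s\<lparr>nreg := (nreg s)(2 := length ?J)\<rparr>"
    have es: "eff (Seq ?c add_row) st s" and k: "k \<le> 24 * n ^ 3" and
      hs: "holds n r ?s 1 (Suc t)" "\<And>j. j < length ?J \<Longrightarrow> holds n r ?s (2 + j) (?J ! j)"
      using 1 by (auto simp: holds_def)
    have s: "nreg ?s 0 = n" "nreg ?s 1 = W" "rreg ?s 0 = 4 * e" "rreg ?s 1 = \<mu>" "rreg ?s 2 = cap"
      "length (memory ?s) = ?B * (n * n + 1)" "nreg ?s 2 = length ?J" "nreg ?s 3 = nreg st 3"
      "nreg s 2 = length I"
      using es st by (auto simp: eff_def)
    show ?case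
    proof (cases "length ?J < nreg st 3")
      case True
      then have "tracks n W e \<mu> cap N r (Suc t) ?J ?s"
        using s st hs cov unfolding tracks_def by auto
      moreover have "k + 4 + 120 * n ^ 3 * length ?J \<le> 150 * n ^ 3 + 120 * n ^ 3 * length I"
        using k cube(1) by simp
      moreover have "nval (NAdd (NReg 2) (NConst 1)) s = length ?J" "bval (NLess (NReg 2) (NReg 3)) ?s"
        using True s by simp_all
      ultimately show ?thesis using s(8) unfolding wp_simps
        by (simp only: if_True) (intro exI[of _ ?J], simp)
    next
      case False
      then have thr: "nreg st 3 = length ?J" using st(8) by simp
      let ?S = "compress (dtime n \<mu> r (Suc t)) cap e ?J"
      have inv: "covers n \<mu> cap e r (Suc t) (rev ?S) \<and> spaced (dtime n \<mu> r (Suc t)) cap e ?S"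
        using compress_invariant[of n \<mu> cap e r "Suc t" ?J "[]"] cov e \<mu> by simp
      have lS: "length ?S \<le> N" using N inv by blast
      have v: "nval (NAdd (NReg 2) (NConst 1)) s = length ?J" and b: "\<not> bval (NLess (NReg 2) (NReg 3)) ?s"
        using False s by simp_all
      have c: "wp compress_prog ?s (\<lambda>k s'. k \<le> 60 * n ^ 3 * (length ?J + 1) \<and> eff compress_prog ?s s' \<and>
        nreg s' 2 = length ?S \<and> nreg s' 3 = 2 * length ?S + 2 \<and> holds n r s' 1 (Suc t) \<and>
        (\<forall>j<length ?S. holds n r s' (2 + j) (rev ?S ! j)))"
        by (rule wp_compress_prog[where B = ?B]) (use s n \<mu> hs ltJ thr st(10) in auto)
      show ?thesis unfolding wp_NSet wp_Cond wp_Seq[of "NSet _ _"] v if_not_P[OF b]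
      proof (rule wp_mono[OF c], goal_cases)
        case (1 k' s')
        have tr': "tracks n W e \<mu> cap N r (Suc t) (rev ?S) s'"
          using 1 s inv lS unfolding tracks_def
          by (auto simp: eff_def compress_prog_def)
        have "60 * n ^ 3 * (length I + 1 + 1) + 60 * n ^ 3 * nreg st 3 = 120 * n ^ 3 * length I + 180 * n ^ 3"
          unfolding thr by (simp add: algebra_simps)
        moreover have "k' \<le> 60 * n ^ 3 * (length I + 1 + 1)" using 1 by (simp add: algebra_simps)
        ultimately have "k' + 60 * n ^ 3 * nreg st 3 \<le> 120 * n ^ 3 * length I + 180 * n ^ 3"
          by linarith
        then have "k + 4 + k' + 120 * n ^ 3 * length ?S + 60 * n ^ 3 * nreg st 3
           \<le> 150 * n ^ 3 + 120 * n ^ 3 * length I + 60 * n ^ 3 * nreg s' 3"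
          using 1 k cube(1) by (simp add: algebra_simps)
        then show ?case using tr' by (intro exI[of _ "rev ?S"]) (simp add: algebra_simps)
      qed
    qed
  qed
  have "bval (RLess (RReg 0) (RConst 1)) st" using st e by simp
  then show ?thesis unfolding update_def wp_Cond by (simp only: if_True seq[unfolded wp_Seq_assoc])
qed

section \<open>Initialization and queries\<close>

text \<open>The exponent of the cap is \<open>n\<close> and not a constant of the program, hence the
  loop. The threshold 2 is \<open>2 * 0 + 2\<close> for the empty list.\<close>

definition initialize :: "nexp \<Rightarrow> cmd" where
  "initialize L = Cond (RLess (RReg 0) (RConst 1))
     (Seq (NSet 3 (NConst 2)) (Seq (RSet 1 (RDiv (RConst 1) (ROfNat L))) (Seq (RSet 2 (RConst 1))
       (For 20 (NReg 0) (RSet 2 (RMul (RReg 2) (ROfNat (NMul (NReg 0) (NAdd L (NConst 1))))))))))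
     Skip"

abbreviation from_end :: nexp where
  "from_end \<equiv> NAdd (NConst 2) (NSub (NSub (NReg 2) (NConst 1)) (NReg 6))"

text \<open>The scan runs from the latest stored time to the earliest and overwrites its choice, so
  the earliest time inside the window remains and no early exit is needed. The initial choice, slot
  1, is the current prefix and yields the empty suffix.\<close>

definition select :: cmd where
  "select = Seq (NSet 7 (NConst 1)) (Seq (Load 20 (slot_at (NConst 1) nn))
     (For 6 (NReg 2) (Seq (Load 21 (slot_at from_end nn))
       (Cond (RLess (RAdd (RReg 21) (ROfNat (NReg 1))) (RReg 20)) Skip (NSet 7 from_end)))))"

definition query :: "nexp \<Rightarrow> cmd" where
  "query L = Cond (RLess (RReg 0) (RConst 1))
     (Seq select (For 22 nn (Seq (Load 20 (slot_at (NConst 1) (NReg 22)))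
        (Seq (Load 21 (slot_at (NReg 7) (NReg 22))) (Emit (RSub (RReg 20) (RReg 21)))))))
     (For 21 (NReg 0) (For 22 (NReg 0)
        (Cond (BAnd (BNot (NLess (NReg 21) (NReg 22))) (BNot (NLess (NReg 22) (NReg 21))))
          (Emit (ROfNat L)) (Emit (RConst 0)))))"

lemma wp_initialize:
  assumes st: "st = start_state n W (4 * e) ((2 * N + 4) * (n * n + 1))" and e: "0 \<le> e" "4 * e < 1"
    and L: "\<And>s. nreg s 0 = n \<Longrightarrow> nreg s 1 = W \<Longrightarrow> nval L s = l" and l: "0 < l"
  shows "wp (initialize L) st (\<lambda>k s. k \<le> 3 * n + 6 \<and> nreg s 3 = 2 \<and>
    tracks n W e (1 / real l) (real (n * (l + 1)) ^ n) N r 0 [] s)"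
proof -
  let ?st = "st\<lparr>nreg := (nreg st)(3 := 2), rreg := (rreg st)(1 := 1 / real l, 2 := 1)\<rparr>"
  let ?c = "For 20 (NReg 0) (RSet 2 (RMul (RReg 2) (ROfNat (NMul (NReg 0) (NAdd L (NConst 1))))))"
  have "wp ?c ?st (\<lambda>k s. k + 4 \<le> 3 * n + 6 \<and> eff ?c ?st s \<and> memory s = memory st \<and>
      rreg s 2 = real (n * (l + 1)) ^ n)"
  proof (rule wp_For[where N = n and K = 1 and I = "\<lambda>i s. memory s = memory st \<and>
      rreg s 2 = real (n * (l + 1)) ^ i"], goal_cases)
    case (1 s) then show ?case by (simp add: eff_def st start_state_def)
  next
    case (4 i s)
    have "nval L s = l" "nreg s 0 = n" using 4(4) by (auto intro!: L simp: eff_def st start_state_def)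
    then show ?case using 4 unfolding wp_simps by (simp add: mult.commute)
  qed (auto simp: eff_def)
  then have *: "wp ?c ?st (\<lambda>k s. k + 4 \<le> 3 * n + 6 \<and> nreg s 3 = 2 \<and>
      tracks n W e (1 / real l) (real (n * (l + 1)) ^ n) N r 0 [] s)"
  proof (rule wp_mono, goal_cases)
    case (1 k s)
    have "slot n (memory s) 1 w = cell n r 0 w" if "w \<le> n * n" for w
    proof -
      have "adr n 1 w < (2 * N + 4) * (n * n + 1)"
        using adr_less[of 1 "2 * N + 4" w n "memory st"] that by (simp add: st start_state_def)
      then show ?thesis using 1 by (simp add: slot_def cell_def gram_def st start_state_def)
    qed
    then show ?case using 1 e l
      by (auto simp: tracks_def eff_def st start_state_def holds_def intro!: covers_Nil)
  qed
  have "nval L (st\<lparr>nreg := (nreg st)(3 := 2)\<rparr>) = l" by (rule L) (simp_all add: st start_state_def)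
  moreover have "rreg st 0 < 1" using e by (simp add: st start_state_def)
  ultimately show ?thesis using * unfolding initialize_def wp_simps by (simp add: add.commute)
qed

lemma wp_select:
  assumes tr: "tracks n W e \<mu> cap N r t I st" and W: "W \<le> t"
  shows "wp select st (\<lambda>k s. eff select st s \<and> memory s = memory st \<and> nreg s 7 < 2 * N + 4 \<and>
     holds n r st (nreg s 7) (sel (t - W) I t))"
proof -
  let ?B = "2 * N + 4"
  have st: "nreg st 0 = n" "nreg st 1 = W" "length (memory st) = ?B * (n * n + 1)" "nreg st 2 = length I"
    "length I < 2 * N + 2" "holds n r st 1 t" "\<And>j. j < length I \<Longrightarrow> holds n r st (2 + j) (I ! j)"
    using tr by (auto simp: tracks_def)
  have nnle: "n * n \<le> n * n" by simp
  have a: "adr n c (n * n) < length (memory st)" if "c < ?B" for c using adr_less[OF that nnle st(3)] .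
  have stamp: "holds n r st c \<tau> \<Longrightarrow> slot n (memory st) c (n * n) = real \<tau>" for c \<tau>
    by (simp add: holds_def cell_def)
  let ?c = "Seq (Load 21 (slot_at from_end nn))
       (Cond (RLess (RAdd (RReg 21) (ROfNat (NReg 1))) (RReg 20)) Skip (NSet 7 from_end))"
  let ?st = "st\<lparr>nreg := (nreg st)(7 := 1), rreg := (rreg st)(20 := real t)\<rparr>"
  have "wp (For 6 (NReg 2) ?c) ?st (\<lambda>k s. memory s = memory st \<and> nreg s 7 < ?B \<and>
     holds n r st (nreg s 7) (sel (t - W) I t))"
  proof (rule wp_For[where N = "length I" and K = 3 and I = "\<lambda>b s. memory s = memory st \<and> nreg s 7 < ?B \<and>
     holds n r st (nreg s 7) (sel (t - W) (drop (length I - b) I) t)"], goal_cases)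
    case (1 s) then show ?case using st by (simp add: eff_def)
  next
    case 3 then show ?case using st by simp
  next
    case (4 b s)
    let ?p = "length I - 1 - b"
    have s: "nreg s 0 = n" "nreg s 1 = W" "nreg s 2 = length I" "rreg s 20 = real t"
      using 4(4) st by (auto simp: eff_def)
    have p: "?p < length I" "length I - b = Suc ?p" "length I - Suc b = ?p" using 4(1) by auto
    have dr: "drop ?p I = I ! ?p # drop (Suc ?p) I" using p(1) by (simp add: Cons_nth_drop_Suc)
    have h: "holds n r st (2 + ?p) (I ! ?p)" using st(7) p(1) .
    have B: "2 + ?p < ?B" using p(1) st(5) by simp
    \<comment> \<open>The test adds \<open>W\<close> to the stamp. It agrees with the truncated
      difference \<open>t - W\<close> because \<open>W \<le> t\<close>.\<close>
    have lt: "real (I ! ?p) + real W < real t \<longleftrightarrow> \<not> t - W \<le> I ! ?p" using W by linarith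
    show ?case using 4(2,3) s a[OF B] stamp[OF h] h B p lt unfolding wp_simps p(3) dr
      by (auto simp: slot_def[symmetric])
  qed auto
  then have "wp select st (\<lambda>k s. memory s = memory st \<and> nreg s 7 < ?B \<and>
     holds n r st (nreg s 7) (sel (t - W) I t))"
    unfolding select_def wp_Seq[of "NSet _ _"] wp_Seq[of "Load _ _"] wp_NSet wp_Load
    using a[of 1] st stamp[OF st(6)] by (simp add: slot_def[symmetric])
  then show ?thesis by (rule wp_use) auto
qed

lemma concat_rows:
  "concat (map (\<lambda>i. map (f i) [0..<n]) [0..<m]) = map (\<lambda>w. f (w div n) (w mod n)) [0..<m * n]"
proof (induction m)
  case (Suc m)
  have "[0..<Suc m * n] = [0..<m * n] @ map (\<lambda>j. m * n + j) [0..<n]"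
    using upt_add_eq_append[of 0 "m * n" n] map_add_upt[of "m * n" n]
    by (simp add: add.commute)
  then show ?case using Suc by simp
qed simp

lemma concat_mat_of: "concat (mat_to_list (mat_of n G)) = map (\<lambda>w. G (w div n) (w mod n)) [0..<n * n]"
  unfolding concat_rows[of G n n, symmetric] mat_to_list_def
  by (intro arg_cong[where f = concat]) (auto intro!: map_cong)

lemma wp_query:
  assumes tr: "tracks n W e \<mu> cap N r t I st" and W: "W \<le> t" and e: "4 * e < 1" and o: "out_tape st = []"
    and le: "\<forall>\<tau>\<in>set I. \<tau> < t"
  shows "wp (query L) st (\<lambda>k s. out_tape s = concat (mat_to_list (mat_of n (gram r (sel (t - W) I t) t))))"
proof -
  let ?B = "2 * N + 4" and ?\<tau> = "sel (t - W) I t"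
  have st: "nreg st 0 = n" "length (memory st) = ?B * (n * n + 1)" "rreg st 0 < 1" "holds n r st 1 t"
    using tr e by (auto simp: tracks_def)
  have \<tau>: "?\<tau> \<le> t" by (rule sel_le[OF le])
  have "wp (For 22 nn (Seq (Load 20 (slot_at (NConst 1) (NReg 22)))
        (Seq (Load 21 (slot_at (NReg 7) (NReg 22))) (Emit (RSub (RReg 20) (RReg 21)))))) s
     (\<lambda>k s'. out_tape s' = concat (mat_to_list (mat_of n (gram r ?\<tau> t))))"
    if s: "eff select st s" "memory s = memory st" "nreg s 7 < ?B" "holds n r st (nreg s 7) ?\<tau>" for s
  proof (rule wp_For[where N = "n * n" and K = 3 and I = "\<lambda>p s'. memory s' = memory st \<and>
      out_tape s' = map (\<lambda>w. gram r ?\<tau> t (w div n) (w mod n)) [0..<p]"], goal_cases)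
    case (1 s') then show ?case using st s by (simp add: eff_def select_def)
  next
    case 3 then show ?case using s o by (simp add: eff_def select_def)
  next
    case (4 p s')
    have s': "nreg s' 0 = n" "nreg s' 7 = nreg s 7"
      using 4(4) s(1) st by (auto simp: eff_def select_def)
    have p: "p \<le> n * n" using 4(1) by simp
    have a: "adr n c p < length (memory st)" if "c < ?B" for c using adr_less[OF that p st(2)] .
    have "0 < n" using 4(1) by (cases n) auto
    then have m: "p div n < n" "p mod n < n" using 4(1) by (simp_all add: less_mult_imp_div_less)
    have "slot n (memory st) 1 p - slot n (memory st) (nreg s 7) p = gram r ?\<tau> t (p div n) (p mod n)"
      using cell_diff[OF \<tau> m, of r] st(4) s(4) p by (simp add: holds_def)
    then show ?case using 4(2,3) s' a[of 1] a[OF s(3)] unfolding wp_simps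
      by (simp add: slot_def[symmetric])
  next
    case (5 k s')
    then show ?case by (simp add: concat_mat_of)
  qed auto
  then show ?thesis unfolding query_def wp_Cond wp_Seq[of select] using st(3)
    by (simp add: wp_mono[OF wp_select[OF tr W]])
qed

lemma wp_query_large:
  assumes n: "nreg st 0 = n" and o: "out_tape st = []" and e: "\<not> rreg st 0 < 1"
    and L: "\<And>s. (\<And>x. x < 2 \<Longrightarrow> nreg s x = nreg st x) \<Longrightarrow> nval L s = l"
  shows "wp (query L) st (\<lambda>k s. out_tape s =
     concat (mat_to_list (mat_of n (\<lambda>i j. if i = j then real l else 0))))"
proof -
  define f where "f w = (if w div n = w mod n then real l else 0)" for w
  let ?c = "Cond (BAnd (BNot (NLess (NReg 21) (NReg 22))) (BNot (NLess (NReg 22) (NReg 21))))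
          (Emit (ROfNat L)) (Emit (RConst 0))"
  have "wp (For 21 (NReg 0) (For 22 (NReg 0) ?c)) st (\<lambda>k s. out_tape s = map f [0..<n * n])"
  proof (rule wp_For[where N = n and K = "n * 4 + 2" and I = "\<lambda>i s. out_tape s = map f [0..<i * n]"], goal_cases)
    case (1 s) then show ?case using n by (simp add: eff_def)
  next
    case 3 then show ?case using o by simp
  next
    case (4 i s)
    show ?case
    proof (rule wp_For[where N = n and K = 2 and I = "\<lambda>j s. out_tape s = map f [0..<i * n + j]"], goal_cases)
      case (1 s') then show ?case using 4(4) n by (simp add: eff_def)
    next
      case 3 then show ?case using 4(2) by simp
    next
      case (4 j s')
      have v: "nreg s' 21 = i" "nval L s' = l"
        using \<open>nreg s 21 = i\<close> 4(4) \<open>eff _ st s\<close> by (auto intro!: L simp: eff_def)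
      have "f (i * n + j) = (if i = j then real l else 0)" using 4(1) by (simp add: f_def)
      then show ?case using 4(2,3) v unfolding wp_simps by auto
    next
      case (5 k s')
      then show ?case by (simp add: add.commute)
    qed auto
  qed auto
  then show ?thesis using e unfolding query_def wp_Cond concat_mat_of f_def
    by (auto elim!: wp_mono)
qed

section \<open>Approximation quality\<close>

definition entry :: "real vec list \<Rightarrow> nat \<Rightarrow> nat \<Rightarrow> real" where
  "entry rs l i = rs ! l $ i"

lemma gram_matrix:
  assumes rs: "set rs \<subseteq> carrier_vec n" and a: "a \<le> length rs"
  shows "(mat_of_rows n (drop a rs))\<^sup>T * mat_of_rows n (drop a rs) = mat_of n (gram (entry rs) a (length rs))"
proof (rule eq_matI)
  fix i j assume "i < dim_row (mat_of n (gram (entry rs) a (length rs)))"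
    "j < dim_col (mat_of n (gram (entry rs) a (length rs)))"
  then have ij: "i < n" "j < n" by auto
  have "((mat_of_rows n (drop a rs))\<^sup>T * mat_of_rows n (drop a rs)) $$ (i, j)
      = (\<Sum>l = 0..<length rs - a. rs ! (a + l) $ i * rs ! (a + l) $ j)"
    using ij a by (simp add: scalar_prod_def mat_of_rows_def)
  also have "\<dots> = (\<Sum>l = a..<length rs. rs ! l $ i * rs ! l $ j)"
    using a sum.shift_bounds_nat_ivl[of "\<lambda>l. rs ! l $ i * rs ! l $ j" 0 a "length rs - a"]
    by (simp add: add.commute)
  finally show "((mat_of_rows n (drop a rs))\<^sup>T * mat_of_rows n (drop a rs)) $$ (i, j)
      = mat_of n (gram (entry rs) a (length rs)) $$ (i, j)"
    using ij by (simp add: gram_def entry_def)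
qed auto

lemma quadratic_form_mat_of:
  assumes "v \<in> carrier_vec n"
  shows "v \<bullet> (mat_of n H *\<^sub>v v) = qf n H (\<lambda>i. v $ i)"
  using assms by (simp add: scalar_prod_def qf_def ip_def app_def lessThan_atLeast0)

lemma loewner_mat_of:
  assumes "\<And>i j. G i j = G j i" "\<And>i j. H i j = H j i"
    and le: "\<And>x. c * qf n G x \<le> d * qf n H x"
  shows "c \<cdot>\<^sub>m mat_of n G \<preceq>\<^sub>L d \<cdot>\<^sub>m mat_of n H"
proof -
  let ?D = "\<lambda>i j. d * H i j - c * G i j"
  have D: "d \<cdot>\<^sub>m mat_of n H - c \<cdot>\<^sub>m mat_of n G = mat_of n ?D"
    by (rule eq_matI) auto
  have qD: "qf n ?D x = d * qf n H x - c * qf n G x" for x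
    by (simp add: qf_def ip_def app_def sum_distrib_left sum_subtractf algebra_simps)
  have "(mat_of n ?D)\<^sup>T = mat_of n ?D" using assms(1,2) by (intro eq_matI) auto
  then show ?thesis unfolding loewner_le_def psd_def D
    using le by (simp add: quadratic_form_mat_of qD)
qed

lemma one_smult_mat: "(1::real) \<cdot>\<^sub>m A = A"
  by (rule eq_matI) auto

lemma qf_gram: "qf n (gram r a b) x = (\<Sum>l = a..<b. (ip n (r l) x)\<^sup>2)"
proof (induction b)
  case 0 then show ?case by (simp add: gram_empty qf_def ip_def app_def)
next
  case (Suc b)
  show ?case
  proof (cases "a \<le> b")
    case True then show ?thesis using Suc by (simp add: gram_Suc qf_outer)
  next
    case False then show ?thesis by (simp add: gram_empty qf_def ip_def app_def)
  qed
qed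

lemma gram_sym_fun: "sym_fun n (gram r a b)"
  by (simp add: sym_fun_def gram_sym)

lemma gram_eigenvalue_nonneg:
  assumes "eigenvalue (mat_of n (gram r a b)) \<theta>"
  shows "0 \<le> \<theta>"
proof -
  obtain v where v: "v \<in> carrier_vec n" "v \<noteq> 0\<^sub>v n" "mat_of n (gram r a b) *\<^sub>v v = \<theta> \<cdot>\<^sub>v v"
    using assms by (auto simp: eigenvalue_def eigenvector_def)
  have "qf n (gram r a b) (\<lambda>i. v $ i) = v \<bullet> (\<theta> \<cdot>\<^sub>v v)" using quadratic_form_mat_of[OF v(1)] v(3) by metis
  also have "\<dots> = \<theta> * ip n (\<lambda>i. v $ i) (\<lambda>i. v $ i)"
    using v(1) by (simp add: scalar_prod_def ip_def lessThan_atLeast0 sum_distrib_left ac_simps)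
  finally have "0 \<le> \<theta> * ip n (\<lambda>i. v $ i) (\<lambda>i. v $ i)" using qf_gram_nonneg by metis
  moreover have "ip n (\<lambda>i. v $ i) (\<lambda>i. v $ i) \<noteq> 0"
  proof
    assume "ip n (\<lambda>i. v $ i) (\<lambda>i. v $ i) = 0"
    then have "v $ i = 0" if "i < n" for i using ip_self_eq_0[of n "\<lambda>i. v $ i"] that by blast
    then have "v = 0\<^sub>v n" using v(1) by (intro eq_vecI) auto
    with v(2) show False ..
  qed
  then have "0 < ip n (\<lambda>i. v $ i) (\<lambda>i. v $ i)" using ip_self_nonneg[of n "\<lambda>i. v $ i"] by linarith
  ultimately show ?thesis by (simp add: zero_le_mult_iff)
qed

text \<open>Square roots of eigenvalues of the Gram matrix are singular values of \<open>A\<close>.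
  Finiteness of their set comes from the spectrum and is what gives \<open>Min\<close> and
  \<open>Max\<close> their meaning.\<close>

lemma eigenvalue_bounds:
  assumes G: "A\<^sup>T * A = mat_of n (gram r a b)"
    and p: "0 < p" "1 / p \<le> sigma_min A" "sigma_max A \<le> p" and l: "p\<^sup>2 \<le> l"
    and ev: "eigenvalue (mat_of n (gram r a b)) \<theta>"
  shows "\<theta> \<le> l" and "\<theta> = 0 \<or> 1 / l \<le> \<theta>"
proof -
  have "singular_values A \<subseteq> sqrt ` {\<theta>. eigenvalue (mat_of n (gram r a b)) \<theta>}"
    unfolding singular_values_def G by (auto simp: image_iff intro!: exI[of _ "_\<^sup>2"])
  then have fin: "finite (singular_values A)"
    using eigen_sum_exists(1)[OF gram_sym_fun] finite_subset finite_imageI by metis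
  have \<theta>: "0 \<le> \<theta>" by (rule gram_eigenvalue_nonneg[OF ev])
  then have sv: "sqrt \<theta> \<in> singular_values A" unfolding singular_values_def G using ev by simp
  have "sqrt \<theta> \<le> p" using Max_ge[OF fin sv] p(3) by (simp add: sigma_max_def)
  then have "(sqrt \<theta>)\<^sup>2 \<le> p\<^sup>2" using \<theta> by (intro power_mono) auto
  then show "\<theta> \<le> l" using \<theta> l by simp
  show "\<theta> = 0 \<or> 1 / l \<le> \<theta>"
  proof (cases "\<theta> = 0")
    case False
    then have "sigma_min A \<le> sqrt \<theta>" unfolding sigma_min_def using fin sv by (intro Min_le) auto
    then have "1 / p \<le> sqrt \<theta>" using p(2) by linarith
    then have "(1 / p)\<^sup>2 \<le> (sqrt \<theta>)\<^sup>2" using p(1) by (intro power_mono) auto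
    then have "1 / p\<^sup>2 \<le> \<theta>" using \<theta> by (simp add: power_divide)
    moreover have "1 / l \<le> 1 / p\<^sup>2" using l p(1) by (intro frac_le) auto
    ultimately show ?thesis by linarith
  qed simp
qed

text \<open>A diagonal entry is the quadratic form at a unit vector; an off-diagonal one is at most
  the mean of two diagonal ones, by \<open>2 * \<bar>x * y\<bar> \<le> x\<^sup>2 + y\<^sup>2\<close>
  in each row.\<close>

lemma gram_entry_bound:
  assumes le: "\<And>x. qf n (gram r a b) x \<le> l * ip n x x" and ij: "i < n" "j < n"
  shows "\<bar>gram r a b i j\<bar> \<le> l"
proof -
  have diag: "gram r a b i i \<le> l" if i: "i < n" for i
  proof -
    let ?x = "\<lambda>k. if k = i then 1 else 0 :: real"
    have "qf n (gram r a b) ?x = gram r a b i i"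
      using i by (simp add: qf_def ip_def app_def if_distrib[of "\<lambda>t. _ * t"] if_distrib[of "\<lambda>t. t * _"] cong: if_cong)
    moreover have "ip n ?x ?x = 1" using i by (simp add: ip_def if_distrib[of "\<lambda>t. t * _"] cong: if_cong)
    ultimately show ?thesis using le[of ?x] by simp
  qed
  have am: "\<bar>x * y\<bar> \<le> (x * x + y * y) / 2" for x y :: real
  proof -
    have "2 * \<bar>x\<bar> * \<bar>y\<bar> \<le> \<bar>x\<bar>\<^sup>2 + \<bar>y\<bar>\<^sup>2" by (rule sum_squares_bound)
    then show ?thesis by (simp add: abs_mult power2_eq_square)
  qed
  have "\<bar>gram r a b i j\<bar> \<le> (\<Sum>k = a..<b. \<bar>r k i * r k j\<bar>)" unfolding gram_def by (rule sum_abs)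
  also have "\<dots> \<le> (\<Sum>k = a..<b. (r k i * r k i + r k j * r k j) / 2)" by (intro sum_mono am)
  also have "\<dots> = (gram r a b i i + gram r a b j j) / 2"
    by (simp add: gram_def sum.distrib sum_divide_distrib[symmetric])
  also have "\<dots> \<le> l" using diag[OF ij(1)] diag[OF ij(2)] by simp
  finally show ?thesis .
qed

lemma covered_approximation:
  assumes cov: "covers n (1 / real l) (real (n * (l + 1)) ^ n) e r t I" and w: "w \<le> t"
    and e: "0 < e" "4 * e \<le> 1" and l: "1 \<le> l"
    and ev: "\<And>\<theta>. eigenvalue (mat_of n (gram r w t)) \<theta> \<Longrightarrow> \<theta> \<le> real l"
      "\<And>\<theta>. eigenvalue (mat_of n (gram r w t)) \<theta> \<Longrightarrow> \<theta> = 0 \<or> 1 / real l \<le> \<theta>"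
  defines "\<tau> \<equiv> sel w I t"
  shows "(1 - 4 * e) * qf n (gram r \<tau> t) x \<le> qf n (gram r w t) x"
    and "qf n (gram r w t) x \<le> (1 + 4 * e) * qf n (gram r \<tau> t) x"
proof -
  let ?\<mu> = "1 / real l" and ?w = "gram r w t" and ?t = "gram r \<tau> t"
  have wt: "w \<le> \<tau>" unfolding \<tau>_def by (rule sel_ge[OF w])
  have "(1 - 4 * e) * qf n ?t x \<le> 1 * qf n ?t x" using e qf_gram_nonneg by (intro mult_right_mono) auto
  also have "\<dots> \<le> qf n ?w x" using qf_gram_mono[OF wt] by simp
  finally show "(1 - 4 * e) * qf n ?t x \<le> qf n ?w x" .
  have le: "qf n ?w y \<le> real l * ip n y y" for y using qf_le_of_eigenvalues[OF gram_sym_fun ev(1)] .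
  \<comment> \<open>The eigenvalue bound keeps this window below the cap, which rules out the first
    alternative of \<open>covers\<close>.\<close>
  have "dtime n ?\<mu> r t w \<le> (real n * (real l + 1)) ^ n"
    unfolding dtime_def
  proof (rule det_le_of_entries)
    fix i j assume "i < n" "j < n"
    then have "\<bar>?w i j\<bar> \<le> real l" by (rule gram_entry_bound[OF le])
    moreover have "0 \<le> ?\<mu>" "?\<mu> \<le> 1" using l by auto
    ultimately show "\<bar>shift ?\<mu> ?w i j\<bar> \<le> real l + 1" unfolding shift_def by (smt (verit))
  qed
  then have q: "(1 - e) * qtime n ?\<mu> r t w y \<le> qtime n ?\<mu> r t \<tau> y" for y
    using cov w unfolding covers_def \<tau>_def by (force simp: add.commute)
  obtain z where z: "\<And>i. i < n \<Longrightarrow> app n ?w z i = 0"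
    and y: "?\<mu> * ip n (\<lambda>i. x i - z i) (\<lambda>i. x i - z i) \<le> qf n ?w (\<lambda>i. x i - z i)"
    using split_off_kernel[OF gram_sym_fun ev(2)] by blast
  let ?y = "\<lambda>i. x i - z i"
  have "qf n ?w z = 0" using z by (simp add: qf_def ip_def)
  \<comment> \<open>A vanishing sum of squares: \<open>z\<close> is orthogonal to each row of the
    window, hence to each row of the shorter suffix, and neither form sees the component
    \<open>z\<close>.\<close>
  then have rz: "ip n (r k) z = 0" if "w \<le> k" "k < t" for k
    using that by (simp add: qf_gram sum_nonneg_eq_0_iff)
  have qw: "qf n ?w ?y = qf n ?w x" unfolding qf_gram ip_diff_right
    using rz by (intro sum.cong) auto
  have qt: "qf n ?t ?y = qf n ?t x" unfolding qf_gram ip_diff_right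
    using rz wt by (intro sum.cong) auto
  let ?a = "qf n ?w x" and ?b = "qf n ?t x" and ?m = "?\<mu> * ip n ?y ?y"
  have "(1 - e) * (?a + ?m) \<le> ?b + ?m" using q[of ?y] unfolding qtime_def qf_shift qw qt .
  moreover have "(1 - u) * v \<le> y + u * z" if "(1 - u) * (v + z) \<le> y + z" for u v y z :: real
    using that by (simp add: algebra_simps)
  ultimately have "(1 - e) * ?a \<le> ?b + e * ?m" by blast
  also have "e * ?m \<le> e * ?a" using y e unfolding qw by (intro mult_left_mono) auto
  finally have "(1 - 2 * e) * ?a \<le> ?b" by (simp add: algebra_simps)
  then have "(1 + 4 * e) * ((1 - 2 * e) * ?a) \<le> (1 + 4 * e) * ?b" using e by (intro mult_left_mono) auto
  \<comment> \<open>The product is \<open>1 + 2 * e * (1 - 4 * e)\<close>. This is the reason for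
    running with a quarter of \<epsilon>.\<close>
  moreover have "1 * ?a \<le> ((1 + 4 * e) * (1 - 2 * e)) * ?a"
  proof (rule mult_right_mono)
    have "4 * (e * e) \<le> e" using mult_right_mono[OF e(2), of e] e(1) by simp
    then show "1 \<le> (1 + 4 * e) * (1 - 2 * e)" by (simp add: algebra_simps)
  qed (rule qf_gram_nonneg)
  ultimately show "?a \<le> (1 + 4 * e) * ?b" by (simp add: mult.assoc)
qed

section \<open>Running the algorithm\<close>

definition sketch :: "nexp \<Rightarrow> streaming_algorithm" where
  "sketch L = \<lparr>init_prog = initialize L, update_prog = update, query_prog = query L\<rparr>"

lemma tracks_more: "tracks n W e \<mu> cap N r t I (st\<lparr>input_row := v\<rparr>) = tracks n W e \<mu> cap N r t I st"
  "tracks n W e \<mu> cap N r t I (st\<lparr>out_tape := out\<rparr>) = tracks n W e \<mu> cap N r t I st"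
  by (simp_all add: tracks_def holds_def)

lemma processes_sketch:
  assumes e: "0 < e" "4 * e < 1" and n: "1 \<le> n"
    and L: "\<And>s. nreg s 0 = n \<Longrightarrow> nreg s 1 = W \<Longrightarrow> nval L s = l" and l: "0 < l"
    and N: "\<And>r t S. spaced (dtime n (1 / real l) r t) (real (n * (l + 1)) ^ n) e S \<Longrightarrow> length S \<le> N"
    and rs: "set rs \<subseteq> carrier_vec n"
  shows "t \<le> length rs \<Longrightarrow> \<exists>k st I.
     processes (sketch L) (start_state n W (4 * e) ((2 * N + 4) * (n * n + 1))) (take t rs) k st \<and>
     tracks n W e (1 / real l) (real (n * (l + 1)) ^ n) N (entry rs) t I st \<and>
     k + 120 * n ^ 3 * length I \<le> 150 * n ^ 3 * t + 60 * n ^ 3 * nreg st 3 + (3 * n + 6)"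
proof (induction t)
  case 0
  have "wp (initialize L) (start_state n W (4 * e) ((2 * N + 4) * (n * n + 1))) (\<lambda>k s. k \<le> 3 * n + 6 \<and> nreg s 3 = 2 \<and>
    tracks n W e (1 / real l) (real (n * (l + 1)) ^ n) N (entry rs) 0 [] s)"
    by (rule wp_initialize[OF refl _ e(2) L l]) (use e in auto)
  then obtain k s where "exec (initialize L) (start_state n W (4 * e) ((2 * N + 4) * (n * n + 1))) k s"
    "k \<le> 3 * n + 6" "tracks n W e (1 / real l) (real (n * (l + 1)) ^ n) N (entry rs) 0 [] s"
    by (auto simp: wp_def)
  then show ?case
    by (intro exI[of _ k] exI[of _ s] exI[of _ "[]"]) (auto intro: processes_init simp: sketch_def)
next
  case (Suc t)
  let ?st0 = "start_state n W (4 * e) ((2 * N + 4) * (n * n + 1))"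
  obtain k st I where IH: "processes (sketch L) ?st0 (take t rs) k st"
    "tracks n W e (1 / real l) (real (n * (l + 1)) ^ n) N (entry rs) t I st"
    "k + 120 * n ^ 3 * length I \<le> 150 * n ^ 3 * t + 60 * n ^ 3 * nreg st 3 + (3 * n + 6)"
    using Suc by auto
  let ?v = "rs ! t"
  let ?s = "st\<lparr>input_row := ?v\<rparr>"
  have v: "dim_vec ?v = n" using rs Suc.prems by (metis Suc_le_lessD carrier_vecD nth_mem subsetD)
  have "wp update ?s (\<lambda>k s. \<exists>I'. tracks n W e (1 / real l) (real (n * (l + 1)) ^ n) N (entry rs) (Suc t) I' s \<and>
    k + 120 * n ^ 3 * length I' + 60 * n ^ 3 * nreg ?s 3 \<le> 150 * n ^ 3 + 120 * n ^ 3 * length I + 60 * n ^ 3 * nreg s 3)"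
    by (rule wp_update[where v = ?v]) (use IH(2) n e l v N in \<open>auto simp: tracks_more entry_def\<close>)
  then obtain k' s I' where s: "exec update ?s k' s"
    "tracks n W e (1 / real l) (real (n * (l + 1)) ^ n) N (entry rs) (Suc t) I' s"
    "k' + 120 * n ^ 3 * length I' + 60 * n ^ 3 * nreg st 3 \<le> 150 * n ^ 3 + 120 * n ^ 3 * length I + 60 * n ^ 3 * nreg s 3"
    by (auto simp: wp_def)
  have "processes (sketch L) ?st0 (take (Suc t) rs) (k + k') s"
    using processes_row[OF IH(1), of ?v k' s] s(1) Suc.prems by (simp add: sketch_def take_Suc_conv_app_nth)
  moreover have "(k + k') + 120 * n ^ 3 * length I' \<le> 150 * n ^ 3 * Suc t + 60 * n ^ 3 * nreg s 3 + (3 * n + 6)"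
    using IH(3) s(3) by simp
  ultimately show ?case using s(2) by blast
qed

lemma processes_sketch_large:
  assumes "1 \<le> \<epsilon>"
  shows "\<exists>k st. processes (sketch L) (start_state n W \<epsilon> s) rs k st \<and> k \<le> 2 * length rs + 2 \<and>
     nreg st = nreg (start_state n W \<epsilon> s) \<and> rreg st = rreg (start_state n W \<epsilon> s)"
proof (induction rs rule: rev_induct)
  case Nil
  let ?st = "start_state n W \<epsilon> s"
  have "exec (initialize L) ?st (1 + 1) ?st" unfolding initialize_def
    by (rule exec_CondFalse) (use assms in \<open>auto simp: start_state_def intro: exec_Skip\<close>)
  then show ?case by (intro exI[of _ 2] exI[of _ ?st]) (auto intro!: processes_init simp: sketch_def)
next
  case (snoc v rs)
  then obtain k st where IH: "processes (sketch L) (start_state n W \<epsilon> s) rs k st" "k \<le> 2 * length rs + 2"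
     "nreg st = nreg (start_state n W \<epsilon> s)" "rreg st = rreg (start_state n W \<epsilon> s)" by blast
  let ?s = "st\<lparr>input_row := v\<rparr>"
  have "exec update ?s (1 + 1) ?s" unfolding update_def
    by (rule exec_CondFalse) (use assms IH in \<open>auto simp: start_state_def intro: exec_Skip\<close>)
  then have "processes (sketch L) (start_state n W \<epsilon> s) (rs @ [v]) (k + (1 + 1)) ?s"
    by (intro processes_row[OF IH(1)]) (simp add: sketch_def)
  then show ?case using IH by (intro exI[of _ "k + (1 + 1)"] exI[of _ ?s]) simp
qed

subsection \<open>Resource bounds\<close>

text \<open>Expressions have no powers. The exponent depends only on the polynomial, so it is
  unfolded into the program text.\<close>

primrec npow :: "nat \<Rightarrow> nexp" where
  "npow 0 = NConst 1"
| "npow (Suc d) = NMul (NReg 1) (npow d)"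

lemma nval_npow: "nval (npow d) s = nreg s 1 ^ d"
  by (induction d) auto

text \<open>The coefficients of \<open>Q\<close> are real, while programs have integer constants
  only. A monomial with natural coefficient is a majorant on \<open>x \<ge> 1\<close> that a program
  can evaluate.\<close>

lemma poly_le_monomial:
  fixes Q :: "real poly"
  obtains a d :: nat where "1 \<le> a" "\<And>x. 1 \<le> x \<Longrightarrow> poly Q x \<le> real a * x ^ d"
proof -
  define a where "a = nat \<lceil>\<Sum>i\<le>degree Q. \<bar>coeff Q i\<bar>\<rceil> + 1"
  have a: "(\<Sum>i\<le>degree Q. \<bar>coeff Q i\<bar>) \<le> real a"
    unfolding a_def by (simp add: le_nat_iff) linarith
  have "poly Q x \<le> real a * x ^ degree Q" if x: "1 \<le> x" for x
  proof -
    have "poly Q x = (\<Sum>i\<le>degree Q. coeff Q i * x ^ i)" by (rule poly_altdef)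
    also have "\<dots> \<le> (\<Sum>i\<le>degree Q. \<bar>coeff Q i\<bar> * x ^ degree Q)"
    proof (rule sum_mono)
      fix i assume "i \<in> {..degree Q}"
      then have "x ^ i \<le> x ^ degree Q" using x by (intro power_increasing) auto
      moreover have "coeff Q i * x ^ i \<le> \<bar>coeff Q i\<bar> * x ^ i" using x by (intro mult_right_mono) auto
      ultimately show "coeff Q i * x ^ i \<le> \<bar>coeff Q i\<bar> * x ^ degree Q"
        using mult_left_mono[of "x ^ i" "x ^ degree Q" "\<bar>coeff Q i\<bar>"] by linarith
    qed
    also have "\<dots> = (\<Sum>i\<le>degree Q. \<bar>coeff Q i\<bar>) * x ^ degree Q" by (simp add: sum_distrib_right)
    also have "\<dots> \<le> real a * x ^ degree Q" using a x by (intro mult_right_mono) auto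
    finally show ?thesis .
  qed
  then show thesis using that[of a "degree Q"] by (simp add: a_def)
qed

text \<open>The place where \<open>W < n powr p\<close> enters: it makes \<open>ln l\<close> a
  multiple of \<open>ln n\<close>. Constants are absorbed by \<open>ln 2 \<le> ln n\<close>.\<close>

lemma ln_bound:
  fixes a d n W l :: nat
  assumes n: "2 \<le> n" and W: "1 \<le> W" "real W < real n powr p" and p: "0 < p"
    and a: "1 \<le> a" and l: "l = a * W ^ d"
  shows "ln (real (n * (l + 1) * l)) \<le> (2 + 2 * ln (real a) / ln 2 + 2 * (p * real d)) * ln (real n)"
proof -
  have "0 < a" "0 < W" using a W by linarith+
  then have "0 < l" by (simp add: l)
  then have l1: "1 \<le> l" by linarith
  have ln2: "ln 2 \<le> ln (real n)" "0 < ln (2::real)" using n by auto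
  have "ln (real W) \<le> ln (real n powr p)" using W n by (subst ln_le_cancel_iff) auto
  then have lW: "ln (real W) \<le> p * ln (real n)" using n by (simp add: ln_powr)
  have "ln (real l) = ln (real a) + real d * ln (real W)"
    unfolding l using a W by (simp add: ln_mult ln_realpow)
  also have "\<dots> \<le> ln (real a) + real d * (p * ln (real n))" using lW by (intro add_left_mono mult_left_mono) auto
  also have "ln (real a) = ln (real a) / ln 2 * ln 2" using ln2 by simp
  also have "\<dots> \<le> ln (real a) / ln 2 * ln (real n)" using ln2 a by (intro mult_left_mono) auto
  finally have ll: "ln (real l) \<le> (ln (real a) / ln 2 + p * real d) * ln (real n)" by (simp add: algebra_simps)
  have "real (n * (l + 1) * l) \<le> real n * (2 * real l) * real l"
    using l1 by (simp add: mult_mono)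
  then have "ln (real (n * (l + 1) * l)) \<le> ln (real n * (2 * real l) * real l)"
    using n l1 by (subst ln_le_cancel_iff) auto
  also have "\<dots> = ln (real n) + ln 2 + 2 * ln (real l)" using n l1 by (simp add: ln_mult)
  also have "\<dots> \<le> ln (real n) + ln (real n) + 2 * ((ln (real a) / ln 2 + p * real d) * ln (real n))"
    using ll ln2 by linarith
  finally show ?thesis by (simp add: algebra_simps)
qed

lemma stack_bound:
  assumes "1 \<le> n" "1 \<le> l" "0 < e" "e < 1"
    and sp: "spaced (dtime n (1 / real l) r t) (real (n * (l + 1)) ^ n) e S"
  shows "e * real (length S) \<le> 2 + 2 * (real n * ln (real (n * (l + 1) * l)))"
proof -
  let ?cap = "real (n * (l + 1)) ^ n" and ?lo = "(1 / real l) ^ n"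
  have lo: "0 < ?lo" using assms by simp
  have "?lo \<le> 1" using assms by (intro power_le_one) auto
  also have "1 \<le> ?cap" using assms by (intro one_le_power) (metis One_nat_def Suc_le_eq add_gr_0 less_numeral_extra(1) nat_0_less_mult_iff of_nat_1 of_nat_le_iff)
  finally have "?lo \<le> ?cap" .
  then have "e * real (length S) \<le> 2 + 2 * ln (?cap / ?lo)"
    using length_spaced[OF sp assms(3,4) _ lo] dt_shift_gram_ge[of "1 / real l" n r _ t] assms(2)
    by (simp add: dtime_def)
  moreover have "?cap / ?lo = real (n * (l + 1) * l) ^ n"
    using assms(2) by (simp add: power_divide power_mult_distrib)
  moreover have "ln (real (n * (l + 1) * l) ^ n) = real n * ln (real (n * (l + 1) * l))"
    by (rule ln_realpow)
  ultimately show ?thesis by simp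
qed

lemma memory_bound:
  assumes n: "2 \<le> n" and \<epsilon>: "0 < \<epsilon>" "\<epsilon> < 1" and c: "0 \<le> c"
    and N: "real N \<le> (2 + 2 * (real n * (c * ln (real n)))) / (\<epsilon> / 4)"
  shows "real ((2 * N + 4) * (n * n + 1)) \<le> (40 + 32 * c) * (real n ^ 3 / \<epsilon> * ln (real n))"
proof -
  let ?h = "real n * ln (real n)"
  \<comment> \<open>From \<open>n \<ge> 2\<close> one gets
    \<open>n * ln n \<ge> ln 4 \<ge> 1\<close>, which absorbs the additive constants in the number
    of slots.\<close>
  have "1 \<le> ln (4::real)" using exp_le by (simp add: ln_ge_iff)
  also have "ln (4::real) = 2 * ln 2" using ln_realpow[of 2 2] by simp
  also have "\<dots> \<le> ?h" using n by (intro mult_mono) auto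
  finally have h: "1 \<le> ?h" .
  have N': "real N \<le> (8 + 8 * c) * (?h / \<epsilon>)"
  proof -
    have "(2 + 2 * (real n * (c * ln (real n)))) / (\<epsilon> / 4) = (8 + 8 * (c * ?h)) / \<epsilon>" by (simp add: field_simps)
    also have "\<dots> \<le> (8 * ?h + 8 * (c * ?h)) / \<epsilon>" using h \<epsilon> by (intro divide_right_mono) auto
    also have "\<dots> = (8 + 8 * c) * (?h / \<epsilon>)" by (simp add: algebra_simps add_divide_distrib)
    finally show ?thesis using N by linarith
  qed
  have "1 \<le> ?h / \<epsilon>" using h \<epsilon> by (simp add: le_divide_eq)
  moreover have "2 * x + 4 \<le> (20 + 16 * c) * y" if "1 \<le> y" "x \<le> (8 + 8 * c) * y" for x y :: real
    using that by (simp add: algebra_simps)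
  ultimately have "2 * real N + 4 \<le> (20 + 16 * c) * (?h / \<epsilon>)" using N' by blast
  moreover have "real n * real n + 1 \<le> 2 * (real n * real n)"
    using n mult_mono[of 1 "real n" 1 "real n"] by simp
  ultimately have "(2 * real N + 4) * (real n * real n + 1) \<le> (20 + 16 * c) * (?h / \<epsilon>) * (2 * (real n * real n))"
    using c h \<epsilon> by (intro mult_mono) auto
  also have "\<dots> = (40 + 32 * c) * (real n ^ 3 / \<epsilon> * ln (real n))"
    by (simp add: power3_eq_cube algebra_simps)
  finally show ?thesis by simp
qed

section \<open>Choice of the constants and the two ranges of \<epsilon>\<close>

theorem mainTheorem1:
  fixes p :: real and P :: "real poly"
  assumes "p > 0"
    and "\<And>w :: nat. w \<ge> 1 \<Longrightarrow> poly P (real w) > 0"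
  shows "\<exists>(alg :: streaming_algorithm) (C :: real). C > 0 \<and>
    (\<forall>(n :: nat) (W :: nat) (\<epsilon> :: real).
       n \<ge> 1 \<longrightarrow> W \<ge> 1 \<longrightarrow> real W < real n powr p \<longrightarrow> \<epsilon> > 0 \<longrightarrow>
       (\<exists>s :: nat. real s \<le> C * (real n ^ 3 / \<epsilon> * ln (real n)) \<and>
         (\<forall>(rs :: real vec list) (A :: real mat).
            set rs \<subseteq> carrier_vec n \<longrightarrow> W \<le> length rs \<longrightarrow> A = window n W rs \<longrightarrow>
            1 / poly P (real W) \<le> sigma_min A \<and> sigma_min A \<le> sigma_max A \<and>
              sigma_max A \<le> poly P (real W) \<longrightarrow>
            (\<exists>(k :: nat) (st :: state) (m :: nat) (M :: real mat).
               processes alg (start_state n W \<epsilon> s) rs k st \<and>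
               real k \<le> C * real n ^ 3 * real (length rs) \<and>
               M \<in> carrier_mat m n \<and>
               answers alg st (transpose_mat M * M) \<and>
               (1 - \<epsilon>) \<cdot>\<^sub>m (transpose_mat M * M) \<preceq>\<^sub>L transpose_mat A * A \<and>
               transpose_mat A * A \<preceq>\<^sub>L (1 + \<epsilon>) \<cdot>\<^sub>m (transpose_mat M * M)))))"
proof -
  \<comment> \<open>The square of \<open>P\<close> is majorized, since singular values enter the
    Gram matrix squared; this gives \<open>l \<ge> P(W)\<^sup>2\<close>.\<close>
  obtain a d where a: "1 \<le> a" and ad: "\<And>x. 1 \<le> x \<Longrightarrow> poly (P * P) x \<le> real a * x ^ d"
    using poly_le_monomial by blast
  define L where "L = NMul (NConst a) (npow d)"
  define c where "c = 2 + 2 * ln (real a) / ln 2 + 2 * (p * real d)"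
  \<comment> \<open>Space needs \<open>40 + 32 * c\<close>, time needs 400; the sum
    \<open>400 + 32 * c\<close> serves both.\<close>
  define C where "C = 400 + 32 * c"
  have c: "0 \<le> c" using a \<open>p > 0\<close> by (simp add: c_def)
  have nL: "nval L s = a * nreg s 1 ^ d" for s by (simp add: L_def nval_npow)
  show ?thesis
  proof (rule exI[of _ "sketch L"], rule exI[of _ C], intro conjI allI impI)
    show "C > 0" using c by (simp add: C_def)
  next
    fix n W :: nat and \<epsilon> :: real
    assume n1: "1 \<le> n" and W: "1 \<le> W" "real W < real n powr p" and \<epsilon>: "0 < \<epsilon>"
    define l where "l = a * W ^ d"
    have "0 < a" "0 < W" using a W by linarith+
    then have "0 < l" by (simp add: l_def)
    then have l: "1 \<le> l" by linarith
    have n: "2 \<le> n"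
    proof (rule ccontr)
      assume "\<not> 2 \<le> n"
      then have "n = 1" using n1 by simp
      then show False using W by simp
    qed
    have pW: "0 < poly P (real W)" using assms(2) W by simp
    have pl: "(poly P (real W))\<^sup>2 \<le> real l"
      using ad[of "real W"] W by (simp add: l_def power2_eq_square)
    have cube: "1 \<le> n ^ 3" "n \<le> n ^ 3" using cube_bounds[OF n1] by auto
    show "\<exists>s :: nat. real s \<le> C * (real n ^ 3 / \<epsilon> * ln (real n)) \<and>
         (\<forall>(rs :: real vec list) (A :: real mat).
            set rs \<subseteq> carrier_vec n \<longrightarrow> W \<le> length rs \<longrightarrow> A = window n W rs \<longrightarrow>
            1 / poly P (real W) \<le> sigma_min A \<and> sigma_min A \<le> sigma_max A \<and>
              sigma_max A \<le> poly P (real W) \<longrightarrow>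
            (\<exists>(k :: nat) (st :: state) (m :: nat) (M :: real mat).
               processes (sketch L) (start_state n W \<epsilon> s) rs k st \<and>
               real k \<le> C * real n ^ 3 * real (length rs) \<and>
               M \<in> carrier_mat m n \<and>
               answers (sketch L) st (transpose_mat M * M) \<and>
               (1 - \<epsilon>) \<cdot>\<^sub>m (transpose_mat M * M) \<preceq>\<^sub>L transpose_mat A * A \<and>
               transpose_mat A * A \<preceq>\<^sub>L (1 + \<epsilon>) \<cdot>\<^sub>m (transpose_mat M * M)))"
    \<comment> \<open>For large \<epsilon> the space bound drops below one word, so this case must
      do without any memory.\<close>
    proof (cases "1 \<le> \<epsilon>")
      case True
      show ?thesis
      proof (rule exI[of _ 0], intro conjI allI impI)
        show "real 0 \<le> C * (real n ^ 3 / \<epsilon> * ln (real n))" using c \<epsilon> n1 by (simp add: C_def)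
      next
        fix rs A
        assume rs: "set rs \<subseteq> carrier_vec n" and len: "W \<le> length rs" and A: "A = window n W rs"
          and \<sigma>: "1 / poly P (real W) \<le> sigma_min A \<and> sigma_min A \<le> sigma_max A \<and> sigma_max A \<le> poly P (real W)"
        let ?t = "length rs"
        let ?G = "gram (entry rs) (?t - W) ?t" and ?I = "\<lambda>i j. if i = j then real l else 0 :: real"
        have G: "A\<^sup>T * A = mat_of n ?G" unfolding A window_def by (rule gram_matrix[OF rs]) simp
        let ?M = "sqrt (real l) \<cdot>\<^sub>m (1\<^sub>m n :: real mat)"
        have MM: "?M\<^sup>T * ?M = mat_of n ?I"
          by (rule eq_matI) (auto simp: scalar_prod_def if_distrib[of "\<lambda>t. t * _"] if_distrib[of "\<lambda>t. _ * t"] cong: if_cong)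
        obtain k st where run: "processes (sketch L) (start_state n W \<epsilon> 0) rs k st" "k \<le> 2 * ?t + 2"
          "nreg st = nreg (start_state n W \<epsilon> 0)" "rreg st = rreg (start_state n W \<epsilon> 0)"
          using processes_sketch_large[OF True] by blast
        have "wp (query L) (st\<lparr>input_row := 0\<^sub>v 0, out_tape := []\<rparr>)
          (\<lambda>k s. out_tape s = concat (mat_to_list (mat_of n ?I)))"
          by (rule wp_query_large) (use run True nL in \<open>auto simp: start_state_def l_def\<close>)
        then have ans: "answers (sketch L) st (?M\<^sup>T * ?M)"
          unfolding MM answers_def wp_def sketch_def by simp
        have le: "qf n ?G x \<le> real l * ip n x x" for x
          by (rule qf_le_of_eigenvalues[OF gram_sym_fun]) (rule eigenvalue_bounds[OF G pW _ _ pl], use \<sigma> in auto)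
        have "app n ?I x i = real l * x i" if "i < n" for x i
          using that by (simp add: app_def if_distrib[of "\<lambda>t. t * _"] cong: if_cong)
        then have I: "qf n ?I x = real l * ip n x x" for x
          unfolding qf_def ip_scale_right[symmetric] by (intro ip_cong) auto
        have 1: "(1 - \<epsilon>) \<cdot>\<^sub>m mat_of n ?I \<preceq>\<^sub>L 1 \<cdot>\<^sub>m mat_of n ?G"
        proof (rule loewner_mat_of)
          fix x
          have "(1 - \<epsilon>) * (real l * ip n x x) \<le> 0" using True ip_self_nonneg by (intro mult_nonpos_nonneg) auto
          then show "(1 - \<epsilon>) * qf n ?I x \<le> 1 * qf n ?G x"
            using qf_gram_nonneg[of n "entry rs" "?t - W" ?t x] unfolding I by linarith
        qed (auto simp: gram_sym)
        have 2: "1 \<cdot>\<^sub>m mat_of n ?G \<preceq>\<^sub>L (1 + \<epsilon>) \<cdot>\<^sub>m mat_of n ?I"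
        proof (rule loewner_mat_of)
          fix x
          have "0 \<le> \<epsilon> * (real l * ip n x x)" using \<epsilon> ip_self_nonneg[of n x] by simp
          then show "1 * qf n ?G x \<le> (1 + \<epsilon>) * qf n ?I x"
            using le[of x] unfolding I by (simp add: distrib_right)
        qed (auto simp: gram_sym)
        have "real k \<le> C * real n ^ 3 * real ?t"
        proof -
          have "1 \<le> ?t" using len W by simp
          then have "real k \<le> 4 * real ?t" using run(2) by linarith
          also have "\<dots> \<le> (C * real n ^ 3) * real ?t"
          proof (rule mult_right_mono)
            have "4 * 1 \<le> C * real n ^ 3" using c cube(1) n1 by (intro mult_mono) (auto simp: C_def)
            then show "4 \<le> C * real n ^ 3" by simp
          qed simp
          finally show ?thesis .
        qed
        then have "processes (sketch L) (start_state n W \<epsilon> 0) rs k st \<and>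
               real k \<le> C * real n ^ 3 * real (length rs) \<and> ?M \<in> carrier_mat (n) n \<and>
               answers (sketch L) st (?M\<^sup>T * ?M) \<and> (1 - \<epsilon>) \<cdot>\<^sub>m (?M\<^sup>T * ?M) \<preceq>\<^sub>L A\<^sup>T * A \<and>
               A\<^sup>T * A \<preceq>\<^sub>L (1 + \<epsilon>) \<cdot>\<^sub>m (?M\<^sup>T * ?M)"
          using run(1) ans 1 2 unfolding one_smult_mat G by (simp add: MM)
        then show "\<exists>k st m M. processes (sketch L) (start_state n W \<epsilon> 0) rs k st \<and>
               real k \<le> C * real n ^ 3 * real (length rs) \<and> M \<in> carrier_mat m n \<and>
               answers (sketch L) st (M\<^sup>T * M) \<and> (1 - \<epsilon>) \<cdot>\<^sub>m (M\<^sup>T * M) \<preceq>\<^sub>L A\<^sup>T * A \<and>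
               A\<^sup>T * A \<preceq>\<^sub>L (1 + \<epsilon>) \<cdot>\<^sub>m (M\<^sup>T * M)"
          by blast
      qed
    next
      case False
      define e where "e = \<epsilon> / 4"
      have e: "0 < e" "4 * e < 1" "4 * e = \<epsilon>" "e < 1" using \<epsilon> False by (auto simp: e_def)
      define b where "b = (2 + 2 * (real n * ln (real (n * (l + 1) * l)))) / e"
      define N where "N = nat \<lfloor>b\<rfloor>"
      have lnb: "ln (real (n * (l + 1) * l)) \<le> c * ln (real n)"
        unfolding c_def by (rule ln_bound[OF n W \<open>p > 0\<close> a l_def])
      have "0 < n * (l + 1) * l" using n1 \<open>0 < l\<close> by simp
      then have "1 \<le> n * (l + 1) * l" by linarith
      then have "0 \<le> ln (real (n * (l + 1) * l))" by (metis ln_ge_zero of_nat_1 of_nat_le_iff)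
      then have b0: "0 \<le> b" using e by (simp add: b_def)
      have Nb: "real N \<le> b" using b0 by (simp add: N_def)
      have "b \<le> (2 + 2 * (real n * (c * ln (real n)))) / e"
        unfolding b_def using lnb e by (intro divide_right_mono add_left_mono mult_left_mono) auto
      then have NN: "real N \<le> (2 + 2 * (real n * (c * ln (real n)))) / (\<epsilon> / 4)"
        using Nb by (simp add: e_def)
      have stk: "length S \<le> N" if "spaced (dtime n (1 / real l) r t) (real (n * (l + 1)) ^ n) e S" for r t S
      proof -
        have "real (length S) \<le> b"
          using stack_bound[OF n1 l e(1,4) that] e(1) by (simp add: b_def le_divide_eq mult.commute)
        then show ?thesis unfolding N_def by (simp add: le_nat_floor)
      qed
      let ?s = "(2 * N + 4) * (n * n + 1)"
      show ?thesis
      proof (rule exI[of _ ?s], intro conjI allI impI)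
        have "real ?s \<le> (40 + 32 * c) * (real n ^ 3 / \<epsilon> * ln (real n))"
          by (rule memory_bound[OF n \<epsilon> _ c NN]) (use False in simp)
        also have "\<dots> \<le> C * (real n ^ 3 / \<epsilon> * ln (real n))"
          using \<epsilon> n1 by (intro mult_right_mono) (auto simp: C_def)
        finally show "real ?s \<le> C * (real n ^ 3 / \<epsilon> * ln (real n))" .
      next
        fix rs A
        assume rs: "set rs \<subseteq> carrier_vec n" and len: "W \<le> length rs" and A: "A = window n W rs"
          and \<sigma>: "1 / poly P (real W) \<le> sigma_min A \<and> sigma_min A \<le> sigma_max A \<and> sigma_max A \<le> poly P (real W)"
        let ?t = "length rs"
        let ?r = "entry rs"
        let ?G = "gram ?r (?t - W) ?t"
        have G: "A\<^sup>T * A = mat_of n ?G" unfolding A window_def by (rule gram_matrix[OF rs]) simp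
        have nL': "nval L s = l" if "nreg s 0 = n" "nreg s 1 = W" for s using that nL by (simp add: l_def)
        have reach: "\<exists>k st I. processes (sketch L) (start_state n W (4 * e) ?s) (take ?t rs) k st \<and>
            tracks n W e (1 / real l) (real (n * (l + 1)) ^ n) N ?r ?t I st \<and>
            k + 120 * n ^ 3 * length I \<le> 150 * n ^ 3 * ?t + 60 * n ^ 3 * nreg st 3 + (3 * n + 6)"
          by (rule processes_sketch[OF e(1,2) n1 _ \<open>0 < l\<close> stk rs order.refl]) (rule nL')
        obtain k st I where run: "processes (sketch L) (start_state n W \<epsilon> ?s) rs k st"
          and tr: "tracks n W e (1 / real l) (real (n * (l + 1)) ^ n) N ?r ?t I st"
          and k: "k + 120 * n ^ 3 * length I \<le> 150 * n ^ 3 * ?t + 60 * n ^ 3 * nreg st 3 + (3 * n + 6)"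
          using reach unfolding e(3) by auto
        have cov: "covers n (1 / real l) (real (n * (l + 1)) ^ n) e ?r ?t I" and thr: "nreg st 3 \<le> 2 * length I + 2"
          using tr by (auto simp: tracks_def)
        let ?\<tau> = "sel (?t - W) I ?t"
        have lt: "\<forall>\<tau>\<in>set I. \<tau> < ?t" using cov by (simp add: covers_def)
        have \<tau>: "?\<tau> \<le> ?t" by (rule sel_le[OF lt])
        let ?M = "mat_of_rows n (drop ?\<tau> rs)"
        have carr: "?M \<in> carrier_mat (length (drop ?\<tau> rs)) n" by (rule mat_of_rows_carrier)
        have M: "?M\<^sup>T * ?M = mat_of n (gram ?r ?\<tau> ?t)" by (rule gram_matrix[OF rs \<tau>])
        have "wp (query L) (st\<lparr>input_row := 0\<^sub>v 0, out_tape := []\<rparr>)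
          (\<lambda>k s. out_tape s = concat (mat_to_list (mat_of n (gram ?r ?\<tau> ?t))))"
          by (rule wp_query[OF _ len e(2) _ lt]) (use tr in \<open>simp_all add: tracks_more\<close>)
        then have ans: "answers (sketch L) st (?M\<^sup>T * ?M)"
          unfolding M answers_def wp_def sketch_def by simp
        have ev: "\<theta> \<le> real l" "\<theta> = 0 \<or> 1 / real l \<le> \<theta>" if "eigenvalue (mat_of n ?G) \<theta>" for \<theta>
          using eigenvalue_bounds[OF G pW _ _ pl that] \<sigma> by auto
        have e1: "4 * e \<le> 1" using e by simp
        have q: "(1 - \<epsilon>) * qf n (gram ?r ?\<tau> ?t) x \<le> qf n ?G x"
          "qf n ?G x \<le> (1 + \<epsilon>) * qf n (gram ?r ?\<tau> ?t) x" for x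
          using covered_approximation[OF cov _ e(1) e1 l ev, where x = x] unfolding e(3) by auto
        have 1: "(1 - \<epsilon>) \<cdot>\<^sub>m mat_of n (gram ?r ?\<tau> ?t) \<preceq>\<^sub>L 1 \<cdot>\<^sub>m mat_of n ?G"
          by (rule loewner_mat_of) (use q in \<open>auto simp: gram_sym\<close>)
        have 2: "1 \<cdot>\<^sub>m mat_of n ?G \<preceq>\<^sub>L (1 + \<epsilon>) \<cdot>\<^sub>m mat_of n (gram ?r ?\<tau> ?t)"
          by (rule loewner_mat_of) (use q in \<open>auto simp: gram_sym\<close>)
        have "real k \<le> C * real n ^ 3 * real ?t"
        proof -
          have t1: "1 \<le> ?t" using len W by simp
          \<comment> \<open>The threshold is at most \<open>2 * length I + 2\<close>, so the terms
            in \<open>length I\<close> cancel and the potential leaves only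
            \<open>120 * n ^ 3\<close>. As \<open>1 \<le> ?t\<close>, this and the initialization
            are charged to the rows.\<close>
          have "60 * n ^ 3 * nreg st 3 \<le> 60 * n ^ 3 * (2 * length I + 2)" using thr by (rule mult_le_mono2)
          then have "k \<le> 150 * (n ^ 3 * ?t) + 120 * n ^ 3 + 3 * n + 6" using k by (simp add: algebra_simps)
          moreover have "n ^ 3 \<le> n ^ 3 * ?t" using t1 by (simp add: mult_le_cancel1)
          ultimately have "k \<le> 400 * (n ^ 3 * ?t)" using cube by linarith
          then have "real k \<le> real (400 * (n ^ 3 * ?t))" by (simp only: of_nat_le_iff)
          also have "\<dots> = 400 * (real n ^ 3 * real ?t)" by simp
          also have "\<dots> \<le> C * (real n ^ 3 * real ?t)" using c by (intro mult_right_mono) (auto simp: C_def)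
          finally show ?thesis by (simp add: mult.assoc)
        qed
        then have "processes (sketch L) (start_state n W \<epsilon> ?s) rs k st \<and>
               real k \<le> C * real n ^ 3 * real (length rs) \<and> ?M \<in> carrier_mat (length (drop ?\<tau> rs)) n \<and>
               answers (sketch L) st (?M\<^sup>T * ?M) \<and> (1 - \<epsilon>) \<cdot>\<^sub>m (?M\<^sup>T * ?M) \<preceq>\<^sub>L A\<^sup>T * A \<and>
               A\<^sup>T * A \<preceq>\<^sub>L (1 + \<epsilon>) \<cdot>\<^sub>m (?M\<^sup>T * ?M)"
          using run ans carr 1 2 unfolding one_smult_mat G by (simp add: M)
        then show "\<exists>k st m M. processes (sketch L) (start_state n W \<epsilon> ?s) rs k st \<and>
               real k \<le> C * real n ^ 3 * real (length rs) \<and> M \<in> carrier_mat m n \<and>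
               answers (sketch L) st (M\<^sup>T * M) \<and> (1 - \<epsilon>) \<cdot>\<^sub>m (M\<^sup>T * M) \<preceq>\<^sub>L A\<^sup>T * A \<and>
               A\<^sup>T * A \<preceq>\<^sub>L (1 + \<epsilon>) \<cdot>\<^sub>m (M\<^sup>T * M)"
          by blast
      qed
    qed
  qed
qed

end
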